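(* Suppose $\beta>1$, $\mathbb{E}[\eta_0^2]<\infty$ and that $\mathbf{E}\big[E^\omega[\eta_0]^{2+\varepsilon}\big]<\infty$ for some $\varepsilon>0$. Let $\nu=\frac{\beta-1}{\mathbb{E}[\eta_0](\beta+1)}$, $\sigma^2=\mathbf{E}[\mathrm{Var}_{P^\omega}(\tau_1)]$, $\vartheta=\sigma\nu^{3/2}$ and $$\mathcal{G}^\omega(t)=\nu t-\nu\sum_{k=0}^{\lfloor\nu t-1\rfloor}\frac{\beta+1}{\beta-1}\big(E^\omega[\eta_{k,0}]-\mathbb{E}[\eta_{k,0}]\big).$$ Then for $\mathbf{P}$-a.e. $\omega$, $$P^\omega\left(\frac{X_t-\mathcal{G}^\omega(t)}{\vartheta\sqrt t}\le x\right)\to\Phi(x)$$ uniformly in $x\in\mathbb{R}$ as $t\to\infty$, where $\Phi(x)=\int_{-\infty}^x\frac{e^{-u^2/2}}{\sqrt{2\pi}}\,du$.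
   Context: Randomly trapped random walk on $\mathbb{Z}$. Let $Y_0=0$ and $Y_k=\sum_{j=1}^k\chi_j$, where $(\chi_j)_{j\ge1}$ are i.i.d. with $P(\chi_j=-1)=(\beta+1)^{-1}=1-P(\chi_j=1)$. Let $L(x,n)=\sum_{k=0}^n\mathbf{1}_{\{Y_k=x\}}$ for $x\in\mathbb{Z}$. A random environment is a sequence $\omega=(\omega_x)_{x\in\mathbb{Z}}$ of probability measures on $(0,\infty)$ with law $\mathbf{P}=\pi^{\otimes\mathbb{Z}}$, i.e. the $\omega_x$ are i.i.d. with a fixed law $\pi$ (a law on probability measures on $(0,\infty)$). Given $\omega$, let $(\eta_{x,i})_{x\in\mathbb{Z},i\ge0}$ be independent random variables with $\eta_{x,i}\sim\omega_x$, independent of $Y$. Put $\eta_k=\eta_{Y_k,L(Y_k,k)}$ for $k\ge0$ (the $k$-th holding time), $S_n=\sum_{k=0}^{n-1}\eta_k$, $S^{-1}_t=\max\{k\ge0:S_k\le t\}$ and $X_t=Y_{S^{-1}_t}$ for real $t\ge0$. $P^\omega$ (expectation $E^\omega$) denotes the law for fixed $\omega$ (averaging over $Y$ and the holding times), $\mathbf{E}$ is expectation under $\mathbf{P}$, and $\mathbb{P}(\cdot)=\int P^\omega(\cdot)\,\mathbf{P}(d\omega)$ is the annealed law with expectation $\mathbb{E}$. The first hitting times are $\tau_n=\inf\{t\ge0:X_t=n\}$. Empty sums are zero. *)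

theory Defs
  imports "HOL-Probability.Probability"
begin

section \<open>Randomly trapped random walk on the integers\<close>

subsection \<open>Path functionals\<close>

text \<open>
  A sample point is a pair \<open>s = (\<chi>, \<eta>)\<close> of a step sequence and an array of holding times
  \<open>\<eta> (x, i)\<close>. The steps in use are \<open>\<chi> 1, \<chi> 2, \<dots>\<close>; the coordinate \<open>\<chi> 0\<close> is ignored.
\<close>

type_synonym sample = "(nat \<Rightarrow> int) \<times> (int \<times> nat \<Rightarrow> real)"

definition walk :: "sample \<Rightarrow> nat \<Rightarrow> int" where
  "walk s k = (\<Sum>j = 1..k. fst s j)"

definition local_time :: "sample \<Rightarrow> int \<Rightarrow> nat \<Rightarrow> nat" where
  "local_time s x n = (\<Sum>k = 0..n. of_bool (walk s k = x))"

definition site_time :: "int \<Rightarrow> nat \<Rightarrow> sample \<Rightarrow> real" where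
  "site_time x i s = snd s (x, i)"

definition holding_time :: "nat \<Rightarrow> sample \<Rightarrow> real" where
  "holding_time k s = site_time (walk s k) (local_time s (walk s k) k) s"

definition clock :: "sample \<Rightarrow> nat \<Rightarrow> real" where
  "clock s n = (\<Sum>k<n. holding_time k s)"

text \<open>
  The maximum is taken over a nonempty set, as \<open>clock s 0 = 0\<close>. On samples whose clock is
  bounded the set is infinite for large \<open>t\<close>, and \<^const>\<open>Max\<close> then has a fixed unspecified value.
\<close>

definition clock_inv :: "sample \<Rightarrow> real \<Rightarrow> nat" where
  "clock_inv s t = Max {k. clock s k \<le> t}"

definition trapped_walk :: "sample \<Rightarrow> real \<Rightarrow> int" where
  "trapped_walk s t = walk s (clock_inv s t)"

text \<open>
  The infimum is real-valued, so it has a fixed unspecified value (instead of infinity)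
  on samples that never hit \<open>n\<close>.
\<close>

definition hitting_time :: "int \<Rightarrow> sample \<Rightarrow> real" where
  "hitting_time n s = Inf {t. 0 \<le> t \<and> trapped_walk s t = n}"


subsection \<open>Environment, quenched law and annealed law\<close>

abbreviation pos_borel :: "real measure" where
  "pos_borel \<equiv> restrict_space borel {0<..}"

text \<open>
  Probability measures on \<open>(0, \<infinity>)\<close> are the points of \<^term>\<open>prob_algebra pos_borel\<close>, and
  a law on them is a point of \<^term>\<open>prob_algebra (prob_algebra pos_borel)\<close>.
\<close>

type_synonym environment = "int \<Rightarrow> real measure"

definition env_law :: "real measure measure \<Rightarrow> environment measure" where
  "env_law \<pi> = (\<Pi>\<^sub>M x\<in>UNIV. \<pi>)"

definition step_pmf :: "real \<Rightarrow> int pmf" where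
  "step_pmf \<beta> = map_pmf (\<lambda>b. if b then -1 else 1) (bernoulli_pmf (1 / (\<beta> + 1)))"

definition quenched :: "real \<Rightarrow> environment \<Rightarrow> sample measure" where
  "quenched \<beta> \<omega> =
     (\<Pi>\<^sub>M j\<in>UNIV. measure_pmf (step_pmf \<beta>)) \<Otimes>\<^sub>M (\<Pi>\<^sub>M p\<in>UNIV. \<omega> (fst p))"

definition annealed :: "real \<Rightarrow> real measure measure \<Rightarrow> sample measure" where
  "annealed \<beta> \<pi> = env_law \<pi> \<bind> quenched \<beta>"

text \<open>
  The quenched law is a probability kernel, so \<^const>\<open>annealed\<close> is indeed the mixture
  of the quenched laws.
\<close>

lemma quenched_kernel:
  assumes "\<pi> \<in> space (prob_algebra (prob_algebra pos_borel))"
  shows "quenched \<beta> \<in> env_law \<pi> \<rightarrow>\<^sub>M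
           prob_algebra ((\<Pi>\<^sub>M j\<in>UNIV. count_space UNIV) \<Otimes>\<^sub>M (\<Pi>\<^sub>M p\<in>UNIV. pos_borel))"
proof -
  let ?A = "(\<Pi>\<^sub>M j\<in>UNIV. measure_pmf (step_pmf \<beta>)) :: (nat \<Rightarrow> int) measure"
  let ?N = "(\<Pi>\<^sub>M p\<in>UNIV. pos_borel) :: (int \<times> nat \<Rightarrow> real) measure"
  let ?H = "\<lambda>\<omega>. (\<Pi>\<^sub>M p\<in>UNIV. \<omega> (fst p)) :: (int \<times> nat \<Rightarrow> real) measure"
  have sets_pi: "sets \<pi> = sets (prob_algebra pos_borel)"
    using assms by (simp add: space_prob_algebra)
  have space_pi: "space \<pi> = space (prob_algebra pos_borel)"
    using sets_pi by (rule sets_eq_imp_space_eq)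
  have ps: "prob_space (\<omega> x)" and st: "sets (\<omega> x) = sets pos_borel"
    if "\<omega> \<in> space (env_law \<pi>)" for \<omega> x
    using that space_pi by (auto simp: env_law_def space_PiM space_prob_algebra PiE_iff)
  have A: "prob_space ?A"
    by (intro prob_space_PiM prob_space_measure_pmf)
  have H: "prob_space (?H \<omega>)" if "\<omega> \<in> space (env_law \<pi>)" for \<omega>
    using that by (intro prob_space_PiM ps)
  have meas: "(\<lambda>\<omega>. emeasure (\<omega> x) B) \<in> borel_measurable (env_law \<pi>)"
    if B: "B \<in> sets pos_borel" for x B
  proof -
    have "(\<lambda>\<omega>. \<omega> x) \<in> env_law \<pi> \<rightarrow>\<^sub>M \<pi>"
      unfolding env_law_def by (rule measurable_component_singleton) simp
    then have "(\<lambda>\<omega>. \<omega> x) \<in> env_law \<pi> \<rightarrow>\<^sub>M prob_algebra pos_borel"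
      by (simp cong: measurable_cong_sets add: sets_pi)
    then have "(\<lambda>\<omega>. \<omega> x) \<in> env_law \<pi> \<rightarrow>\<^sub>M subprob_algebra pos_borel"
      by (rule measurable_prob_algebraD)
    from measurable_compose[OF this measurable_emeasure_subprob_algebra[OF B]]
    show ?thesis .
  qed
  have Hk: "?H \<in> env_law \<pi> \<rightarrow>\<^sub>M prob_algebra ?N"
  proof (rule measurable_prob_algebra_generated)
    show "sets ?N = sigma_sets (\<Pi>\<^sub>E p\<in>UNIV. space pos_borel) (prod_algebra UNIV (\<lambda>p. pos_borel))"
      by (rule sets_PiM)
    show "Int_stable (prod_algebra UNIV (\<lambda>p::int \<times> nat. pos_borel))"
      by (rule Int_stable_prod_algebra)
    show "prod_algebra UNIV (\<lambda>p::int \<times> nat. pos_borel) \<subseteq> Pow (\<Pi>\<^sub>E p\<in>UNIV. space pos_borel)"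
      by (rule prod_algebra_sets_into_space)
    show "prob_space (?H \<omega>)" if "\<omega> \<in> space (env_law \<pi>)" for \<omega>
      using that by (rule H)
    show "sets (?H \<omega>) = sets ?N" if "\<omega> \<in> space (env_law \<pi>)" for \<omega>
      using that by (intro sets_PiM_cong refl st)
  next
    fix B :: "(int \<times> nat \<Rightarrow> real) set"
    assume "B \<in> prod_algebra UNIV (\<lambda>p. pos_borel)"
    then obtain J E where B: "B = prod_emb UNIV (\<lambda>p. pos_borel) J (Pi\<^sub>E J E)"
      "finite J" "\<And>p. p \<in> J \<Longrightarrow> E p \<in> sets pos_borel"
      by (elim prod_algebraE) auto
    have "emeasure (?H \<omega>) B = (\<Prod>p\<in>J. emeasure (\<omega> (fst p)) (E p))"
      if w: "\<omega> \<in> space (env_law \<pi>)" for \<omega>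
    proof -
      have "B = prod_emb UNIV (\<lambda>p. \<omega> (fst p)) J (Pi\<^sub>E J E)"
        unfolding B(1) prod_emb_def using sets_eq_imp_space_eq[OF st[OF w]] by simp
      then show ?thesis
        using B(2,3) w by (simp add: emeasure_PiM_emb ps st)
    qed
    then show "(\<lambda>\<omega>. emeasure (?H \<omega>) B) \<in> borel_measurable (env_law \<pi>)"
      using B(3) meas by (simp cong: measurable_cong)
  qed
  let ?C = "(\<Pi>\<^sub>M j\<in>UNIV. count_space UNIV) :: (nat \<Rightarrow> int) measure"
  have sets_A: "sets ?A = sets ?C"
    by (intro sets_PiM_cong) auto
  show ?thesis
  proof (rule measurable_prob_algebra_generated)
    show "sets (?C \<Otimes>\<^sub>M ?N) = sigma_sets (space ?C \<times> space ?N) {a \<times> b | a b. a \<in> sets ?C \<and> b \<in> sets ?N}"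
      by (rule sets_pair_measure)
    show "Int_stable {a \<times> b | a b. a \<in> sets ?C \<and> b \<in> sets ?N}"
      by (rule Int_stable_pair_measure_generator)
    show "{a \<times> b | a b. a \<in> sets ?C \<and> b \<in> sets ?N} \<subseteq> Pow (space ?C \<times> space ?N)"
      using sets.sets_into_space[of _ ?C] sets.sets_into_space[of _ ?N] by fast
  next
    fix \<omega> assume w: "\<omega> \<in> space (env_law \<pi>)"
    interpret pair_prob_space ?A "?H \<omega>"
      using A H[OF w] by (simp add: pair_prob_space_def pair_sigma_finite_def prob_space_imp_sigma_finite)
    show "prob_space (quenched \<beta> \<omega>)"
      unfolding quenched_def by unfold_locales
    show "sets (quenched \<beta> \<omega>) = sets (?C \<Otimes>\<^sub>M ?N)"
      unfolding quenched_def using w by (intro sets_pair_measure_cong sets_PiM_cong st) auto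
  next
    fix B assume "B \<in> {a \<times> b | a b. a \<in> sets ?C \<and> b \<in> sets ?N}"
    then obtain a b where B: "B = a \<times> b" "a \<in> sets ?A" "b \<in> sets ?N"
      using sets_A by auto
    have "emeasure (quenched \<beta> \<omega>) B = emeasure ?A a * emeasure (?H \<omega>) b"
      if w: "\<omega> \<in> space (env_law \<pi>)" for \<omega>
    proof -
      interpret H: prob_space "?H \<omega>" using w by (rule H)
      have "sets (?H \<omega>) = sets ?N"
        using w by (intro sets_PiM_cong refl st)
      then show ?thesis
        unfolding quenched_def B(1) using B(2,3) by (intro H.emeasure_pair_measure_Times) auto
    qed
    moreover have "(\<lambda>\<omega>. emeasure (?H \<omega>) b) \<in> borel_measurable (env_law \<pi>)"
      using measurable_compose[OF measurable_prob_algebraD[OF Hk]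
          measurable_emeasure_subprob_algebra[OF B(3)]] .
    ultimately show "(\<lambda>\<omega>. emeasure (quenched \<beta> \<omega>) B) \<in> borel_measurable (env_law \<pi>)"
      by (simp cong: measurable_cong)
  qed
qed

lemma emeasure_annealed:
  assumes \<pi>: "\<pi> \<in> space (prob_algebra (prob_algebra pos_borel))"
    and B: "B \<in> sets ((\<Pi>\<^sub>M j\<in>UNIV. count_space UNIV) \<Otimes>\<^sub>M (\<Pi>\<^sub>M p\<in>UNIV. pos_borel))"
  shows "emeasure (annealed \<beta> \<pi>) B = (\<integral>\<^sup>+\<omega>. emeasure (quenched \<beta> \<omega>) B \<partial>env_law \<pi>)"
proof -
  have "prob_space (env_law \<pi>)"
    unfolding env_law_def using \<pi> by (intro prob_space_PiM) (simp add: space_prob_algebra)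
  then have "space (env_law \<pi>) \<noteq> {}"
    by (rule prob_space.not_empty)
  then show ?thesis
    unfolding annealed_def
    by (rule emeasure_bind[OF _ measurable_prob_algebraD[OF quenched_kernel[OF \<pi>]] B])
qed

end

theory Submission
  imports Defs "HOL-Real_Asymp.Real_Asymp"
begin

text \<open>
  Write \<open>B = (\<beta> + 1) / (\<beta> - 1)\<close>, \<open>m\<^sub>k\<close> for the mean of \<open>\<omega>\<^sub>k\<close>, \<open>\<mu>\<^sub>0\<close> for the annealed mean holding time
  and \<open>D\<^sub>n = (\<Sum>k<n. m\<^sub>k - \<mu>\<^sub>0)\<close>. Given the path of the walk, the holding times along it are independent,
  because the pairs (site, number of visits) along a path never repeat; and the path regenerates at
  its first passage times. Hence the crossing times \<open>\<tau>\<^sub>k\<^sub>+\<^sub>1 - \<tau>\<^sub>k\<close> are independent under the quenched law,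
  and the \<open>k\<close>-th one is distributed as \<open>\<tau>\<^sub>1\<close> in the environment shifted by \<open>k\<close>. It is enough to know this
  for characteristic functions (lemma \<open>char_hitting_time_prod\<close>) and for means.

  The variances and the truncated third moments of the crossing times are values of fixed integrable
  functions of the environment along its shifts, so the ergodic theorem supplies the convergence of
  the averaged variances and Lindeberg's condition for almost every environment. This gives the
  quenched central limit theorem \<open>hitting_time_clt\<close> for \<open>\<tau>\<^sub>n\<close> around its quenched mean. Conditioning on
  the first step of the walk gives a recursion between neighbouring mean crossing times, which
  telescopes: up to \<open>o(sqrt n)\<close>, the quenched mean of \<open>\<tau>\<^sub>n\<close> is \<open>B \<Sum>k<n. m\<^sub>k = B \<mu>\<^sub>0 n + B D\<^sub>n\<close>, where
  \<open>B \<mu>\<^sub>0 = 1 / \<nu>\<close> (lemma \<open>mean_time_centering\<close>).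

  Finally this limit theorem is inverted. The events \<open>X\<^sub>t \<ge> n\<close> and \<open>\<tau>\<^sub>n \<le> t\<close> differ only if the walk
  steps back below \<open>n\<close>, and the probability of a step back by \<open>r\<close> decays geometrically in \<open>r\<close>
  (lemma \<open>prob_trapped_walk_bounds\<close>). With \<open>n\<close> close to \<open>G \<omega> t + x \<theta> sqrt t\<close>, the
  centring \<open>G \<omega> t\<close> contains \<open>D\<close> at \<open>\<nu> t\<close> where the mean of \<open>\<tau>\<^sub>n\<close> contains \<open>D\<close> at \<open>n\<close>. The two
  indices differ by more than \<open>sqrt t\<close>, namely by the size of \<open>D\<close> itself, so what is needed is that \<open>D\<close>
  varies by \<open>o(sqrt t)\<close> over windows slightly longer than \<open>sqrt t\<close>. This is where the moment of order
  \<open>2 + \<epsilon>\<close> enters: the \<open>m\<^sub>k\<close> with \<open>k < n\<close> are then at most \<open>n\<^sup>1\<^sup>/\<^sup>2\<^sup>-\<^sup>d\<close>, and an exponential inequality with a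
  union bound controls all the windows at once (lemma \<open>window_bound\<close>). Uniformity in \<open>x\<close> is Polya's
  theorem on monotone functions that converge to a continuous one.
\<close>

section \<open>Real sequences, exponentials and the normal distribution function\<close>

lemma eventually_all_less_linear:
  fixes x :: "nat \<Rightarrow> real"
  assumes x: "(\<lambda>n. x n / real n) \<longlonglongrightarrow> 0" and d: "0 < \<delta>"
  shows "\<forall>\<^sub>F n in sequentially. \<forall>k<n. x k \<le> \<delta> * real n"
proof -
  have "\<forall>\<^sub>F n in sequentially. x n / real n < \<delta>"
    using x d by (rule order_tendstoD)
  then obtain N where N: "\<And>n. N \<le> n \<Longrightarrow> x n / real n < \<delta>"
    by (auto simp: eventually_sequentially)
  define A where "A = Max (insert 0 (x ` {..N}))"
  have A: "x k \<le> A" if "k \<le> N" for k using that unfolding A_def by (intro Max_ge) auto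
  have "\<forall>\<^sub>F n in sequentially. A / \<delta> \<le> real n"
    using filterlim_real_sequentially by (simp add: filterlim_at_top)
  then show ?thesis
  proof eventually_elim
    case (elim n)
    show ?case
    proof (intro allI impI)
      fix k assume "k < n"
      show "x k \<le> \<delta> * real n"
      proof (cases "k \<le> N")
        case True
        have "A \<le> \<delta> * real n" using elim d by (simp add: field_simps)
        with A[OF True] show ?thesis by linarith
      next
        case False
        then have "x k < \<delta> * real k" using N[of k] by (simp add: field_simps)
        also have "\<dots> \<le> \<delta> * real n" using \<open>k < n\<close> d by simp
        finally show ?thesis by simp
      qed
    qed
  qed
qed

lemma exp_minus_le:
  fixes a :: real assumes a: "0 \<le> a" shows "exp (- a) \<le> 1 - a + a\<^sup>2"
proof -
  have "exp (- a) * (1 + a) \<le> exp (- a) * exp a"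
    using exp_ge_add_one_self[of a] by (intro mult_left_mono) auto
  then have "exp (- a) * (1 + a) \<le> 1" by (simp add: exp_minus)
  also have "1 \<le> (1 - a + a\<^sup>2) * (1 + a)"
    using a by (simp add: algebra_simps power2_eq_square)
  finally show ?thesis using a by (simp add: mult_le_cancel_right)
qed

lemma exp_le_quadratic:
  fixes y :: real assumes "\<bar>y\<bar> \<le> 1" shows "exp y \<le> 1 + y + y\<^sup>2"
proof (cases "0 \<le> y")
  case True
  then show ?thesis using exp_bound[of y] assms by simp
next
  case False
  then show ?thesis using exp_minus_le[of "- y"] by simp
qed

lemma exp_minus_approx:
  fixes a :: real assumes "0 \<le> a" shows "\<bar>(1 - a) - exp (- a)\<bar> \<le> a\<^sup>2"
  using exp_ge_add_one_self[of "- a"] exp_minus_le[OF assms] by (simp add: abs_le_iff)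

text \<open>Lindeberg's method for characteristic functions: in the application \<open>\<theta> k\<close> is the
  characteristic function of the \<open>k\<close>-th centred summand, \<open>V k\<close> its variance and
  \<open>L j k\<close> the expectation of \<open>min (6 \<xi>\<^sup>2) (\<bar>\<xi>\<bar>\<^sup>3 / (j +
  1))\<close>. The factors are compared with \<open>exp (- u\<^sup>2 V k / 2)\<close>, whose product depends on
  the variances only through their average. The hypothesis on \<open>V n / n\<close> makes all the factors
  uniformly close to 1.\<close>

lemma lindeberg_product:
  fixes \<theta> :: "nat \<Rightarrow> real \<Rightarrow> complex" and V :: "nat \<Rightarrow> real" and L :: "nat \<Rightarrow> nat \<Rightarrow> real"
  assumes V0: "\<And>k. 0 \<le> V k" and V: "(\<lambda>n. (\<Sum>k<n. V k) / real n) \<longlonglongrightarrow> \<sigma>\<^sup>2" and sigma: "0 < \<sigma>"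
    and V_lin: "(\<lambda>n. V n / real n) \<longlonglongrightarrow> 0"
    and L: "\<And>j. (\<lambda>n. (\<Sum>k<n. L j k) / real n) \<longlonglongrightarrow> \<kappa> j" and lam: "\<kappa> \<longlonglongrightarrow> 0"
    and norm_le: "\<And>k u. norm (\<theta> k u) \<le> 1"
    and approx: "\<And>j k u. \<bar>u\<bar> \<le> inverse (real (Suc j)) \<Longrightarrow> norm (\<theta> k u - (1 - u\<^sup>2 * V k / 2)) \<le> u\<^sup>2 / 6 * L j k"
  shows "(\<lambda>n. \<Prod>k<n. \<theta> k (t / (\<sigma> * sqrt (real n)))) \<longlonglongrightarrow> exp (- (t\<^sup>2) / 2)"
proof -
  define u where "u n = t / (\<sigma> * sqrt (real n))" for n
  define a where "a n k = (u n)\<^sup>2 * V k / 2" for n k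
  have a0: "0 \<le> a n k" for n k unfolding a_def using V0 by simp
  have u2: "(u n)\<^sup>2 = t\<^sup>2 / (\<sigma>\<^sup>2 * real n)" for n
    unfolding u_def by (simp add: power_divide power_mult_distrib)
  have sum_a: "(\<Sum>k<n. a n k) = t\<^sup>2 / (2 * \<sigma>\<^sup>2) * ((\<Sum>k<n. V k) / real n)" for n
    unfolding a_def u2 by (simp add: sum_distrib_left[symmetric] sum_divide_distrib[symmetric])
  have lim_a: "(\<lambda>n. \<Sum>k<n. a n k) \<longlonglongrightarrow> t\<^sup>2 / 2"
  proof -
    have "(\<lambda>n. t\<^sup>2 / (2 * \<sigma>\<^sup>2) * ((\<Sum>k<n. V k) / real n)) \<longlonglongrightarrow> t\<^sup>2 / (2 * \<sigma>\<^sup>2) * \<sigma>\<^sup>2"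
      by (intro tendsto_intros V)
    then show ?thesis using sigma by (simp add: sum_a)
  qed
  have lim_a2: "(\<lambda>n. \<Sum>k<n. (a n k)\<^sup>2) \<longlonglongrightarrow> 0"
  proof (rule LIMSEQ_I)
    fix r :: real assume r: "0 < r"
    \<comment> \<open>If every \<open>V k\<close> is at most \<open>\<delta> n\<close>, the sum of squares is at most \<open>t\<^sup>2 \<delta> / (2 \<sigma>\<^sup>2)\<close> times a bound for the sum.\<close>
    define \<delta> where "\<delta> = r * \<sigma>\<^sup>2 * 2 / ((t\<^sup>2 + 1) * (t\<^sup>2 / 2 + 1))"
    have d: "0 < \<delta>" unfolding \<delta>_def using r sigma by (auto intro!: divide_pos_pos mult_pos_pos add_nonneg_pos)
    have "\<forall>\<^sub>F n in sequentially. (\<Sum>k<n. a n k) < t\<^sup>2 / 2 + 1"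
      using lim_a by (rule order_tendstoD) simp
    then have "\<forall>\<^sub>F n in sequentially. norm ((\<Sum>k<n. (a n k)\<^sup>2) - 0) < r"
      using eventually_all_less_linear[OF V_lin d] eventually_gt_at_top[of 0]
    proof eventually_elim
      case (elim n)
      define b where "b = t\<^sup>2 * \<delta> / (2 * \<sigma>\<^sup>2)"
      have b0: "0 \<le> b" unfolding b_def using d by simp
      have ab: "a n k \<le> b" if "k < n" for k
      proof -
        have "a n k = t\<^sup>2 / (2 * \<sigma>\<^sup>2) * (V k / real n)" unfolding a_def u2 by simp
        also have "\<dots> \<le> t\<^sup>2 / (2 * \<sigma>\<^sup>2) * \<delta>"
          using elim that by (intro mult_left_mono) (auto simp: field_simps)
        finally show ?thesis unfolding b_def by simp
      qed
      have "(\<Sum>k<n. (a n k)\<^sup>2) \<le> (\<Sum>k<n. b * a n k)"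
        using ab a0 by (intro sum_mono) (auto simp: power2_eq_square intro!: mult_right_mono)
      also have "\<dots> = b * (\<Sum>k<n. a n k)" by (simp add: sum_distrib_left)
      also have "\<dots> \<le> b * (t\<^sup>2 / 2 + 1)" using elim b0 by (intro mult_left_mono) auto
      also have "\<dots> = r * (t\<^sup>2 / (t\<^sup>2 + 1))"
      proof -
        have "t\<^sup>2 / 2 + 1 \<noteq> 0" by (smt (verit) zero_le_power2 field_sum_of_halves)
        then show ?thesis unfolding b_def \<delta>_def using sigma by (simp add: divide_simps)
      qed
      also have "\<dots> < r * 1"
        using r by (intro mult_strict_left_mono) (auto simp: divide_less_eq add_nonneg_pos)
      finally show ?case using a0 by (simp add: abs_of_nonneg sum_nonneg)
    qed
    then show "\<exists>no. \<forall>n\<ge>no. norm ((\<Sum>k<n. (a n k)\<^sup>2) - 0) < r" by (simp add: eventually_sequentially)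
  qed
  have u_lim: "u \<longlonglongrightarrow> 0"
  proof -
    have "(\<lambda>n. (t / \<sigma>) * (1 / sqrt (real n))) \<longlonglongrightarrow> (t / \<sigma>) * 0"
      by (intro tendsto_intros) real_asymp
    then show ?thesis unfolding u_def by simp
  qed
  have diff: "(\<lambda>n. (\<Prod>k<n. \<theta> k (u n)) - (\<Prod>k<n. complex_of_real (exp (- a n k)))) \<longlonglongrightarrow> 0"
  proof (rule LIMSEQ_I)
    fix r :: real assume r: "0 < r"
    have "(\<lambda>j. t\<^sup>2 / (6 * \<sigma>\<^sup>2) * \<kappa> j) \<longlonglongrightarrow> t\<^sup>2 / (6 * \<sigma>\<^sup>2) * 0" by (intro tendsto_intros lam)
    then have "\<forall>\<^sub>F j in sequentially. t\<^sup>2 / (6 * \<sigma>\<^sup>2) * \<kappa> j < r / 2"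
      using r by (intro order_tendstoD) auto
    then obtain j where j: "t\<^sup>2 / (6 * \<sigma>\<^sup>2) * \<kappa> j < r / 2" by (auto simp: eventually_sequentially)
    have "(\<lambda>n. t\<^sup>2 / (6 * \<sigma>\<^sup>2) * ((\<Sum>k<n. L j k) / real n) + (\<Sum>k<n. (a n k)\<^sup>2)) \<longlonglongrightarrow>
      t\<^sup>2 / (6 * \<sigma>\<^sup>2) * \<kappa> j + 0"
      by (intro tendsto_intros L lim_a2)
    moreover have "t\<^sup>2 / (6 * \<sigma>\<^sup>2) * \<kappa> j + 0 < r" using j r by linarith
    ultimately have "\<forall>\<^sub>F n in sequentially. t\<^sup>2 / (6 * \<sigma>\<^sup>2) * ((\<Sum>k<n. L j k) / real n) + (\<Sum>k<n. (a n k)\<^sup>2) < r"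
      by (rule order_tendstoD(2))
    moreover have "\<forall>\<^sub>F n in sequentially. \<bar>u n\<bar> < inverse (real (Suc j))"
      using tendsto_rabs_zero[OF u_lim] by (rule order_tendstoD) simp
    ultimately have "\<forall>\<^sub>F n in sequentially.
      norm ((\<Prod>k<n. \<theta> k (u n)) - (\<Prod>k<n. complex_of_real (exp (- a n k))) - 0) < r"
    proof eventually_elim
      case (elim n)
      have "norm ((\<Prod>k<n. \<theta> k (u n)) - (\<Prod>k<n. complex_of_real (exp (- a n k)))) \<le>
        (\<Sum>k<n. norm (\<theta> k (u n) - complex_of_real (exp (- a n k))))"
        using a0 by (intro norm_prod_diff) (auto simp: norm_le)
      also have "\<dots> \<le> (\<Sum>k<n. (u n)\<^sup>2 / 6 * L j k + (a n k)\<^sup>2)"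
      proof (rule sum_mono)
        fix k
        have "norm (\<theta> k (u n) - complex_of_real (exp (- a n k))) \<le>
          norm (\<theta> k (u n) - (1 - (u n)\<^sup>2 * V k / 2)) + norm (complex_of_real ((1 - a n k) - exp (- a n k)))"
          unfolding a_def by (intro norm_triangle_le norm_triangle_ineq4 order_trans[OF eq_refl norm_triangle_ineq])
            (simp add: algebra_simps)
        also have "\<dots> \<le> (u n)\<^sup>2 / 6 * L j k + (a n k)\<^sup>2"
          using elim exp_minus_approx[OF a0, of n k] by (intro add_mono approx) (auto simp only: norm_of_real)
        finally show "norm (\<theta> k (u n) - complex_of_real (exp (- a n k))) \<le> (u n)\<^sup>2 / 6 * L j k + (a n k)\<^sup>2" .
      qed
      also have "\<dots> = t\<^sup>2 / (6 * \<sigma>\<^sup>2) * ((\<Sum>k<n. L j k) / real n) + (\<Sum>k<n. (a n k)\<^sup>2)"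
        by (simp add: sum.distrib u2 sum_distrib_left[symmetric] sum_divide_distrib[symmetric])
      finally show ?case using elim by simp
    qed
    then show "\<exists>no. \<forall>n\<ge>no. norm ((\<Prod>k<n. \<theta> k (u n)) - (\<Prod>k<n. complex_of_real (exp (- a n k))) - 0) < r"
      by (simp add: eventually_sequentially)
  qed
  have "(\<lambda>n. complex_of_real (exp (- (\<Sum>k<n. a n k)))) \<longlonglongrightarrow> complex_of_real (exp (- (t\<^sup>2 / 2)))"
    by (intro tendsto_intros lim_a)
  then have "(\<lambda>n. \<Prod>k<n. complex_of_real (exp (- a n k))) \<longlonglongrightarrow> exp (- (t\<^sup>2) / 2)"
    by (simp add: exp_sum sum_negf[symmetric] of_real_exp)
  from tendsto_add[OF diff this] show ?thesis unfolding u_def by simp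
qed

text \<open>Polya's theorem. Monotone functions that are close to \<open>\<Phi>\<close> at finitely many points, chosen so
  that \<open>\<Phi>\<close> increases by little from one to the next, are close to \<open>\<Phi>\<close>
  everywhere.\<close>

lemma polya_uniform_limit:
  fixes f :: "'b \<Rightarrow> real \<Rightarrow> real" and \<Phi> :: "real \<Rightarrow> real"
  assumes mono: "\<And>t. mono (f t)" and f01: "\<And>t x. 0 \<le> f t x" "\<And>t x. f t x \<le> 1"
    and lim: "\<And>x. ((\<lambda>t. f t x) \<longlongrightarrow> \<Phi> x) F"
    and Phi: "mono \<Phi>" "\<And>x. isCont \<Phi> x" "(\<Phi> \<longlongrightarrow> 0) at_bot" "(\<Phi> \<longlongrightarrow> 1) at_top"
  shows "uniform_limit UNIV f \<Phi> F"
proof (rule uniform_limitI)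
  fix e :: real assume e: "0 < e"
  then obtain n where n: "0 < n" "inverse (real n) < e / 4" using ex_inverse_of_nat_less[of "e / 4"] by auto
  have ex: "\<exists>p. \<Phi> p = real i / real n" if "0 < i" "i < n" for i
  proof -
    have "0 < real i / real n" "real i / real n < 1" using that by auto
    then have "\<forall>\<^sub>F x in at_bot. \<Phi> x < real i / real n" "\<forall>\<^sub>F x in at_top. real i / real n < \<Phi> x"
      using order_tendstoD[OF Phi(3)] order_tendstoD[OF Phi(4)] by auto
    then obtain u w where uw: "\<Phi> u < real i / real n" "real i / real n < \<Phi> w"
      by (auto simp: eventually_at_bot_linorder eventually_at_top_linorder)
    then have "u < w" using Phi(1) by (metis monoD not_less order.asym order.strict_trans1)
    then obtain p where "u \<le> p" "p \<le> w" "\<Phi> p = real i / real n"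
      using IVT[of \<Phi> u "real i / real n" w] uw Phi(2) by auto
    then show ?thesis by blast
  qed
  define p where "p i = (SOME p. \<Phi> p = real i / real n)" for i
  have p: "\<Phi> (p i) = real i / real n" if "0 < i" "i < n" for i
    unfolding p_def by (rule someI_ex) (rule ex[OF that])
  have Phi01: "0 \<le> \<Phi> x" "\<Phi> x \<le> 1" for x
  proof -
    have "\<forall>\<^sub>F y in at_bot. \<Phi> y \<le> \<Phi> x"
      using eventually_le_at_bot[of x] by eventually_elim (rule monoD[OF Phi(1)])
    then show "0 \<le> \<Phi> x" by (rule tendsto_upperbound[OF Phi(3)]) simp
    have "\<forall>\<^sub>F y in at_top. \<Phi> x \<le> \<Phi> y"
      using eventually_ge_at_top[of x] by eventually_elim (rule monoD[OF Phi(1)])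
    then show "\<Phi> x \<le> 1" by (rule tendsto_lowerbound[OF Phi(4)]) simp
  qed
  have "\<forall>\<^sub>F t in F. \<forall>i\<in>{..<n}. dist (f t (p i)) (\<Phi> (p i)) < e / 4"
    by (rule eventually_ball_finite) (use tendstoD[OF lim, of "e / 4"] e in auto)
  then show "\<forall>\<^sub>F t in F. \<forall>x\<in>UNIV. dist (f t x) (\<Phi> x) < e"
  proof eventually_elim
    case (elim t)
    have near: "\<bar>f t (p i) - real i / real n\<bar> < e / 4" if "0 < i" "i < n" for i
    proof -
      have "dist (f t (p i)) (\<Phi> (p i)) < e / 4" using elim that by blast
      then show ?thesis unfolding p[OF that] dist_real_def .
    qed
    show ?case
    proof
      fix x
      \<comment> \<open>The level of \<open>\<Phi> x\<close> on a scale of \<open>n\<close> steps; neighbours at distance two are needed below,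
        since \<open>\<Phi> x\<close> may itself be a multiple of \<open>1 / n\<close>.\<close>
      define i where "i = nat \<lfloor>real n * \<Phi> x\<rfloor>"
      have i: "real i \<le> real n * \<Phi> x" "real n * \<Phi> x < real i + 1"
        unfolding i_def using Phi01[of x] n by (simp_all add: of_nat_floor)
      have i': "real i / real n \<le> \<Phi> x" "\<Phi> x < real (i + 1) / real n"
        using i n by (auto simp: field_simps)
      have up: "f t x \<le> \<Phi> x + inverse (real n) + e / 4"
      proof (cases "i + 1 < n")
        case True
        have "\<Phi> x < \<Phi> (p (i + 1))" using i' p[of "i + 1"] True by simp
        then have "x \<le> p (i + 1)" using Phi(1) by (meson monoD not_le less_imp_le not_less)
        then have "f t x \<le> f t (p (i + 1))" by (rule monoD[OF mono])
        also have "\<dots> \<le> real (i + 1) / real n + e / 4" using conjunct1[OF near[of "i + 1", unfolded abs_less_iff]] True by linarith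
        also have "real (i + 1) / real n = real i / real n + inverse (real n)" by (simp add: add_divide_distrib inverse_eq_divide)
        finally show ?thesis using i' by simp
      next
        case False
        then have "1 \<le> real (i + 1) / real n" using n by (simp add: field_simps)
        also have "real (i + 1) / real n = real i / real n + inverse (real n)" by (simp add: add_divide_distrib inverse_eq_divide)
        finally show ?thesis using i' f01(2)[of t x] e by linarith
      qed
      have low: "\<Phi> x \<le> f t x + 2 * inverse (real n) + e / 4"
      proof (cases "1 < i")
        case True
        have "real i \<le> real n" using i(1) Phi01[of x] n by (smt (verit) mult_left_le of_nat_0_le_iff)
        then have lt: "i - 1 < n" using True by auto
        have "real (i - 1) / real n < real i / real n" using True n by (intro divide_strict_right_mono) auto
        moreover have "\<Phi> (p (i - 1)) = real (i - 1) / real n" using True lt by (intro p) auto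
        ultimately have "\<Phi> (p (i - 1)) < \<Phi> x" using i' by linarith
        then have "p (i - 1) \<le> x" using Phi(1) by (meson monoD not_le less_imp_le not_less)
        then have "f t (p (i - 1)) \<le> f t x" by (rule monoD[OF mono])
        moreover have "real (i - 1) / real n - e / 4 \<le> f t (p (i - 1))"
          using conjunct2[OF near[of "i - 1", unfolded abs_less_iff]] True lt by linarith
        moreover have "real (i + 1) / real n = real (i - 1) / real n + 2 * inverse (real n)"
          using True by (simp add: of_nat_diff add_divide_distrib diff_divide_distrib inverse_eq_divide)
        ultimately show ?thesis using i' by linarith
      next
        case False
        then have "real (i + 1) / real n \<le> 2 * inverse (real n)" using n by (simp add: field_simps)
        then show ?thesis using i' f01(1)[of t x] e by linarith
      qed
      show "dist (f t x) (\<Phi> x) < e" unfolding dist_real_def using up low n(2) by linarith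
    qed
  qed
qed

lemma uniform_limit_moving:
  fixes f :: "nat \<Rightarrow> real \<Rightarrow> real"
  assumes unif: "uniform_limit UNIV f g sequentially" and g: "isCont g y0"
    and N: "filterlim N sequentially F" and y: "(y \<longlongrightarrow> y0) F"
  shows "((\<lambda>t. f (N t) (y t)) \<longlongrightarrow> g y0) F"
proof -
  have "((\<lambda>t. f (N t) (y t) - g (y t)) \<longlongrightarrow> 0) F"
  proof (rule tendstoI)
    fix e :: real assume "0 < e"
    then have "\<forall>\<^sub>F n in sequentially. \<forall>x\<in>UNIV. dist (f n x) (g x) < e" by (rule uniform_limitD[OF unif])
    from eventually_compose_filterlim[OF this N]
    show "\<forall>\<^sub>F t in F. dist (f (N t) (y t) - g (y t)) 0 < e"
      by eventually_elim (simp add: dist_real_def)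
  qed
  from tendsto_add[OF this isCont_tendsto_compose[OF g y]] show ?thesis by simp
qed

lemma cdf_normal_isCont: "isCont (cdf std_normal_distribution) x"
proof -
  interpret real_distribution std_normal_distribution by (rule real_dist_normal_dist)
  have "AE y in lborel. y \<noteq> x" by (rule AE_lborel_singleton)
  then have "AE y in lborel. y \<in> {x} \<longrightarrow> ennreal (std_normal_density y) = 0"
    by eventually_elim simp
  then have "{x} \<in> null_sets std_normal_distribution"
    by (subst null_sets_density_iff) auto
  then show ?thesis by (simp add: isCont_cdf measure_def null_setsD1)
qed

lemma normal_cdf_eq: "cdf std_normal_distribution x = (LBINT u:{..x}. exp (- u\<^sup>2 / 2) / sqrt (2 * pi))"
proof -
  have "cdf std_normal_distribution x = enn2real (\<integral>\<^sup>+u. ennreal (std_normal_density u) * indicator {..x} u \<partial>lborel)"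
    unfolding cdf_def measure_def by (subst emeasure_density) auto
  also have "(\<integral>\<^sup>+u. ennreal (std_normal_density u) * indicator {..x} u \<partial>lborel) =
    (\<integral>\<^sup>+u. ennreal (indicator {..x} u *\<^sub>R std_normal_density u) \<partial>lborel)"
    by (intro nn_integral_cong) (auto simp: indicator_def)
  also have "enn2real \<dots> = (LBINT u:{..x}. std_normal_density u)"
    unfolding set_lebesgue_integral_def by (rule integral_eq_nn_integral[symmetric]) auto
  also have "\<dots> = (LBINT u:{..x}. exp (- u\<^sup>2 / 2) / sqrt (2 * pi))"
    by (intro set_lebesgue_integral_cong) (auto simp: std_normal_density_def)
  finally show ?thesis .
qed

text \<open>The event \<open>\<tau>\<^sub>n > t\<close> becomes \<open>X\<^sub>t < n\<close> when the limit theorem is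
  inverted, which turns \<open>\<Phi> (- x)\<close> into \<open>1 - \<Phi> x\<close>.\<close>

lemma normal_cdf_uminus: "cdf std_normal_distribution (- x) = 1 - cdf std_normal_distribution x"
proof -
  interpret real_distribution std_normal_distribution by (rule real_dist_normal_dist)
  have "emeasure std_normal_distribution {..- x} = (\<integral>\<^sup>+u. ennreal (std_normal_density u) * indicator {..- x} u \<partial>lborel)"
    by (rule emeasure_density) auto
  also have "\<dots> = (\<integral>\<^sup>+u. ennreal (std_normal_density (0 + (-1) * u)) * indicator {..- x} (0 + (-1) * u) \<partial>lborel)"
    by (subst nn_integral_real_affine[where c="-1" and t=0]) simp_all
  also have "\<dots> = (\<integral>\<^sup>+u. ennreal (std_normal_density u) * indicator {x..} u \<partial>lborel)"
    by (auto intro!: nn_integral_cong simp: std_normal_density_def indicator_def)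
  also have "\<dots> = (\<integral>\<^sup>+u. ennreal (std_normal_density u) * indicator {x<..} u \<partial>lborel)"
    by (rule nn_integral_cong_AE) (use AE_lborel_singleton[of x] in eventually_elim, auto simp: indicator_def)
  also have "\<dots> = emeasure std_normal_distribution {x<..}"
    by (rule emeasure_density[symmetric]) auto
  finally have "cdf std_normal_distribution (- x) = prob {x<..}"
    unfolding cdf_def measure_def by simp
  also have "{x<..} = space std_normal_distribution - {..x}" by auto
  also have "prob \<dots> = 1 - prob {..x}" by (rule prob_compl) auto
  finally show ?thesis unfolding cdf_def .
qed

abbreviation \<Phi> :: "real \<Rightarrow> real" where "\<Phi> \<equiv> cdf std_normal_distribution"

lemma Phi_facts: "mono \<Phi>" "(\<Phi> \<longlongrightarrow> 0) at_bot" "(\<Phi> \<longlongrightarrow> 1) at_top"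
proof -
  interpret real_distribution std_normal_distribution by (rule real_dist_normal_dist)
  show "mono \<Phi>" by (intro monoI cdf_nondecreasing)
  show "(\<Phi> \<longlongrightarrow> 0) at_bot" by (rule cdf_lim_at_bot)
  show "(\<Phi> \<longlongrightarrow> 1) at_top" by (rule cdf_lim_at_top_prob)
qed

lemma sum_lessThan_split: "(\<Sum>k<a + b. g k) = (\<Sum>k<a. g k) + (\<Sum>k<b. g (a + k :: nat) :: 'a :: comm_monoid_add)"
  by (induction b) (simp_all add: ac_simps)

lemma prod_lessThan_split: "(\<Prod>k<a + b. g k) = (\<Prod>k<a. g k) * (\<Prod>k<b. g (a + k :: nat) :: 'a :: comm_monoid_mult)"
  by (induction b) (simp_all add: ac_simps)

section \<open>The ergodic theorem\<close>

text \<open>The maximum of 0 and of the first \<open>n\<close> Birkhoff sums. In this recursive form the maximal ergodic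
  inequality is almost immediate.\<close>

primrec max_sum :: "('a \<Rightarrow> 'a) \<Rightarrow> ('a \<Rightarrow> real) \<Rightarrow> nat \<Rightarrow> 'a \<Rightarrow> real" where
  "max_sum T f 0 x = 0"
| "max_sum T f (Suc n) x = max 0 (f x + max_sum T f n (T x))"

lemma max_sum_nonneg: "0 \<le> max_sum T f n x"
  by (cases n) auto

lemma max_sum_mono: "max_sum T f n x \<le> max_sum T f (Suc n) x"
proof (induction n arbitrary: x)
  case (Suc n)
  have "max 0 (f x + max_sum T f n (T x)) \<le> max 0 (f x + max_sum T f (Suc n) (T x))"
    using Suc[of "T x"] by linarith
  then show ?case by (simp only: max_sum.simps)
qed auto

lemma birkhoff_sum_Suc:
  "(\<Sum>k<Suc n. f ((T ^^ k) x)) = f x + (\<Sum>k<n. f ((T ^^ k) (T x)) :: real)"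
  by (subst sum.lessThan_Suc_shift) (simp del: funpow.simps add: funpow_Suc_right)

lemma birkhoff_sum_le_max_sum:
  "(\<Sum>k<n. f ((T ^^ k) x)) \<le> max_sum T f n x"
proof (induction n arbitrary: x)
  case (Suc n)
  show ?case unfolding birkhoff_sum_Suc using Suc[of "T x"] by simp
qed auto

context prob_space
begin

lemma integrable_measure_preserving:
  fixes f :: "'a \<Rightarrow> real"
  assumes T: "T \<in> measurable M M" "distr M M T = M" and f: "integrable M f"
  shows "integrable M (\<lambda>x. f (T x))" "(\<integral>x. f (T x) \<partial>M) = (\<integral>x. f x \<partial>M)"
proof -
  have "integrable (distr M M T) f" using T f by simp
  then show "integrable M (\<lambda>x. f (T x))" using T(1) f by (subst (asm) integrable_distr_eq) auto
  show "(\<integral>x. f (T x) \<partial>M) = (\<integral>x. f x \<partial>M)"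
    using integral_distr[OF T(1), of f] f T(2) by auto
qed

lemma integrable_max_sum:
  fixes f :: "'a \<Rightarrow> real"
  assumes T: "T \<in> measurable M M" "distr M M T = M" and f: "integrable M f"
  shows "integrable M (max_sum T f n)"
proof (induction n)
  case (Suc n)
  have "integrable M (\<lambda>x. max_sum T f n (T x))"
    by (rule integrable_measure_preserving(1)[OF T Suc])
  then have "integrable M (\<lambda>x. max 0 (f x + max_sum T f n (T x)))"
    using f by (intro integrable_max) auto
  then show ?case by simp
qed (simp add: fun_eq_iff[symmetric])

text \<open>Garsia's argument: where the maximum \<open>S\<close> is positive, \<open>f\<close> is at least \<open>S - S
  \<circ> T\<close>; elsewhere \<open>S\<close> vanishes and \<open>S - S \<circ> T\<close> is not positive. The
  integral of \<open>S - S \<circ> T\<close> is zero.\<close>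

lemma maximal_ergodic:
  fixes f :: "'a \<Rightarrow> real"
  assumes T: "T \<in> measurable M M" "distr M M T = M" and f: "integrable M f"
  shows "0 \<le> (\<integral>x. f x * indicator {x. 0 < max_sum T f n x} x \<partial>M)"
proof (cases n)
  case (Suc m)
  let ?S = "max_sum T f"
  have int: "integrable M (?S n)" "integrable M (\<lambda>x. ?S n (T x))"
    using integrable_max_sum[OF assms, of n] integrable_measure_preserving[OF T, of "?S n"] by auto
  have meas: "?S n \<in> borel_measurable M" using int by auto
  have "0 = (\<integral>x. ?S n x - ?S n (T x) \<partial>M)"
    using int integrable_measure_preserving(2)[OF T int(1)] by simp
  also have "\<dots> \<le> (\<integral>x. f x * indicator {x. 0 < ?S n x} x \<partial>M)"
  proof (rule integral_mono)
    show "integrable M (\<lambda>x. ?S n x - ?S n (T x))" using int by auto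
    show "integrable M (\<lambda>x. f x * indicator {x. 0 < ?S n x} x)"
    proof (rule Bochner_Integration.integrable_bound[OF f])
      show "(\<lambda>x. f x * indicator {x. 0 < ?S n x} x) \<in> borel_measurable M"
        using meas f by measurable
    qed (auto simp: indicator_def)
    fix x
    show "?S n x - ?S n (T x) \<le> f x * indicator {x. 0 < ?S n x} x"
    proof (cases "0 < ?S n x")
      case True
      then have "?S n x = f x + ?S m (T x)" unfolding Suc by (auto simp: max_def split: if_splits)
      also have "\<dots> \<le> f x + ?S n (T x)" using max_sum_mono[of T f m "T x"] Suc by simp
      finally show ?thesis using True by simp
    next
      case False
      then show ?thesis using max_sum_nonneg[of T f n x] max_sum_nonneg[of T f n "T x"] by simp
    qed
  qed
  finally show ?thesis .
qed simp

lemma funpow_measurable: "T \<in> measurable M M \<Longrightarrow> T ^^ k \<in> measurable M M"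
  by (induction k) (auto simp: id_def intro: measurable_comp)

text \<open>The set where the Birkhoff sums are unbounded above is invariant. If it had full measure, then the sets in the
  maximal inequality would exhaust the space, and \<open>f\<close> would have a nonnegative integral.\<close>

lemma birkhoff_sums_bounded_above:
  fixes f :: "'a \<Rightarrow> real"
  assumes T: "T \<in> measurable M M" "distr M M T = M" and f: "integrable M f"
    and erg: "\<And>A. A \<in> sets M \<Longrightarrow> T -` A \<inter> space M = A \<Longrightarrow> prob A = 0 \<or> prob A = 1"
    and neg: "(\<integral>x. f x \<partial>M) < 0"
  shows "AE x in M. \<exists>C. \<forall>n. (\<Sum>k<n. f ((T ^^ k) x)) \<le> C"
proof -
  let ?B = "\<lambda>n x. (\<Sum>k<n. f ((T ^^ k) x)) :: real"
  have [measurable]: "f \<in> borel_measurable M" using f by auto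
  have B[measurable]: "?B n \<in> borel_measurable M" for n
    using funpow_measurable[OF T(1)] by (intro borel_measurable_sum measurable_compose[OF _ \<open>f \<in> _\<close>])
  define A where "A = {x \<in> space M. \<forall>C::nat. \<exists>n. real C < ?B n x}"
  have A: "A \<in> sets M" unfolding A_def by measurable
  have unb: "(\<forall>C::nat. \<exists>n. real C < ?B n x) \<longleftrightarrow> (\<forall>C::real. \<exists>n. C < ?B n x)" for x
    by (meson le_less_trans real_arch_simple)
  have unb_T: "(\<forall>C::real. \<exists>n. C < ?B n (T x)) \<longleftrightarrow> (\<forall>C::real. \<exists>n. C < ?B n x)" for x
  proof (intro iffI allI)
    fix C :: real assume "\<forall>C::real. \<exists>n. C < ?B n (T x)"
    then obtain n where "C - f x < ?B n (T x)" by blast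
    then have "C < ?B (Suc n) x" unfolding birkhoff_sum_Suc by simp
    then show "\<exists>n. C < ?B n x" ..
  next
    fix C :: real assume "\<forall>C::real. \<exists>n. C < ?B n x"
    then obtain n where n: "max 0 (C + f x) < ?B n x" by blast
    then obtain m where "n = Suc m" by (cases n) auto
    then have "C < ?B m (T x)" using n unfolding \<open>n = Suc m\<close> birkhoff_sum_Suc by simp
    then show "\<exists>n. C < ?B n (T x)" ..
  qed
  have "T -` A \<inter> space M = A"
    using measurable_space[OF T(1)] unfolding A_def unb by (auto simp: unb_T)
  with erg A consider "prob A = 0" | "prob A = 1" by blast
  then show ?thesis
  proof cases
    case 1
    then have "AE x in M. x \<notin> A" using A by (simp add: prob_eq_0)
    then show ?thesis
    proof (rule AE_mp, intro AE_I2 impI)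
      fix x assume "x \<in> space M" "x \<notin> A"
      then obtain C :: nat where "\<forall>n. \<not> real C < ?B n x" unfolding A_def by auto
      then show "\<exists>C. \<forall>n. ?B n x \<le> C" by (intro exI[of _ "real C"]) (simp add: not_less)
    qed
  next
    case 2
    let ?I = "\<lambda>n x. f x * indicator {x. 0 < max_sum T f n x} x"
    have ms[measurable]: "max_sum T f n \<in> borel_measurable M" for n
      using integrable_max_sum[OF T f, of n] by auto
    have "AE x in M. x \<in> A" using A 2 by (simp add: prob_eq_1)
    then have "AE x in M. (\<lambda>n. ?I n x) \<longlonglongrightarrow> f x"
    proof (rule AE_mp, intro AE_I2 impI)
      fix x assume "x \<in> space M" "x \<in> A"
      then obtain n0 where "real 0 < ?B n0 x" unfolding A_def by blast
      then have n0: "0 < max_sum T f n0 x"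
        using birkhoff_sum_le_max_sum[where T=T and f=f and n=n0 and x=x] by simp
      have "0 < max_sum T f n x" if "n0 \<le> n" for n
        using that by (induction n rule: dec_induct) (use n0 max_sum_mono[of T f _ x] in \<open>force intro: less_le_trans\<close>)+
      then have "eventually (\<lambda>n. f x = ?I n x) sequentially"
        by (intro eventually_sequentiallyI[of n0]) simp
      then show "(\<lambda>n. ?I n x) \<longlonglongrightarrow> f x" by (rule Lim_transform_eventually[OF tendsto_const])
    qed
    then have "(\<lambda>n. \<integral>x. ?I n x \<partial>M) \<longlonglongrightarrow> (\<integral>x. f x \<partial>M)"
      using f by (intro integral_dominated_convergence[where w="\<lambda>x. norm (f x)"])
        (auto simp: indicator_def)
    then have "0 \<le> (\<integral>x. f x \<partial>M)"
      by (rule LIMSEQ_le_const) (use maximal_ergodic[OF T f] in auto)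
    with neg show ?thesis by simp
  qed
qed

text \<open>Birkhoff's theorem for ergodic maps: both \<open>f - \<integral>f - d\<close> and \<open>\<integral>f - f -
  d\<close> have a negative integral, so their Birkhoff sums are bounded above.\<close>

theorem ergodic_theorem:
  fixes f :: "'a \<Rightarrow> real"
  assumes T: "T \<in> measurable M M" "distr M M T = M" and f: "integrable M f"
    and erg: "\<And>A. A \<in> sets M \<Longrightarrow> T -` A \<inter> space M = A \<Longrightarrow> prob A = 0 \<or> prob A = 1"
  shows "AE x in M. (\<lambda>n. (\<Sum>k<n. f ((T ^^ k) x)) / real n) \<longlonglongrightarrow> (\<integral>x. f x \<partial>M)"
proof -
  have bound: "AE x in M. \<forall>j. \<forall>\<^sub>F n in sequentially.
      (\<Sum>k<n. g ((T ^^ k) x)) / real n < (\<integral>x. g x \<partial>M) + inverse (real (Suc j))"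
    if g: "integrable M g" for g
  proof (subst AE_all_countable, intro allI)
    fix j
    define d where "d = inverse (real (Suc j)) / 2"
    have d: "d > 0" unfolding d_def by simp
    define h where "h x = g x - (\<integral>x. g x \<partial>M) - d" for x
    have h: "integrable M h" "(\<integral>x. h x \<partial>M) < 0"
      unfolding h_def using g d by (auto simp: prob_space)
    have "AE x in M. \<exists>C. \<forall>n. (\<Sum>k<n. h ((T ^^ k) x)) \<le> C"
      by (rule birkhoff_sums_bounded_above[OF T h(1) _ h(2)]) (rule erg)
    then show "AE x in M. \<forall>\<^sub>F n in sequentially.
        (\<Sum>k<n. g ((T ^^ k) x)) / real n < (\<integral>x. g x \<partial>M) + inverse (real (Suc j))"
    proof (rule AE_mp, intro AE_I2 impI)
      fix x assume "\<exists>C. \<forall>n. (\<Sum>k<n. h ((T ^^ k) x)) \<le> C"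
      then obtain C where C: "(\<Sum>k<n. h ((T ^^ k) x)) \<le> C" for n by blast
      have "(\<lambda>n. C / real n) \<longlonglongrightarrow> 0" by real_asymp
      then have "\<forall>\<^sub>F n in sequentially. C / real n < d" using d by (rule order_tendstoD)
      then show "\<forall>\<^sub>F n in sequentially.
        (\<Sum>k<n. g ((T ^^ k) x)) / real n < (\<integral>x. g x \<partial>M) + inverse (real (Suc j))"
        using eventually_gt_at_top[of 0]
      proof eventually_elim
        case (elim n)
        have "(\<Sum>k<n. h ((T ^^ k) x)) = (\<Sum>k<n. g ((T ^^ k) x)) - n * ((\<integral>x. g x \<partial>M) + d)"
          unfolding h_def by (simp add: sum_subtractf algebra_simps)
        with C[of n] have "(\<Sum>k<n. g ((T ^^ k) x)) \<le> C + n * ((\<integral>x. g x \<partial>M) + d)" by simp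
        then have "(\<Sum>k<n. g ((T ^^ k) x)) / n \<le> C / n + ((\<integral>x. g x \<partial>M) + d)"
          using elim by (simp add: field_simps)
        also have "\<dots> < (\<integral>x. g x \<partial>M) + (d + d)" using elim by simp
        finally show ?case unfolding d_def by simp
      qed
    qed
  qed
  have nf: "integrable M (\<lambda>x. - f x)" using f by simp
  show ?thesis
    using bound[OF f] bound[OF nf]
  proof eventually_elim
    case (elim x)
    show ?case
    proof (rule LIMSEQ_I)
      fix r :: real assume "0 < r"
      then obtain j where j: "inverse (real (Suc j)) < r" using reals_Archimedean by blast
      have "\<forall>\<^sub>F n in sequentially. norm ((\<Sum>k<n. f ((T ^^ k) x)) / real n - (\<integral>x. f x \<partial>M)) < r"
        using elim(1)[rule_format, of j] elim(2)[rule_format, of j]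
        by eventually_elim (use j in \<open>auto simp: sum_negf abs_less_iff\<close>)
      then show "\<exists>no. \<forall>n\<ge>no. norm ((\<Sum>k<n. f ((T ^^ k) x)) / real n - (\<integral>x. f x \<partial>M)) < r"
        by (simp add: eventually_sequentially)
    qed
  qed
qed

end

section \<open>Shifts of an i.i.d. field\<close>

text \<open>The finitely many coordinates in \<open>J\<close> are independent, also inside an infinite product.\<close>

lemma (in product_prob_space) integral_PiM_prod:
  fixes f :: "'i \<Rightarrow> 'a \<Rightarrow> 'c :: {real_normed_field, banach, second_countable_topology}"
  assumes J: "finite J" "J \<subseteq> I" and f: "\<And>i. i \<in> J \<Longrightarrow> integrable (M i) (f i)"
  shows "(\<integral>x. (\<Prod>i\<in>J. f i (x i)) \<partial>PiM I M) = (\<Prod>i\<in>J. \<integral>y. f i y \<partial>M i)"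
proof -
  have f': "(\<lambda>x. \<Prod>i\<in>J. f i (x i)) \<in> borel_measurable (PiM J M)"
  proof (rule borel_measurable_prod)
    fix i assume i: "i \<in> J"
    show "(\<lambda>x. f i (x i)) \<in> borel_measurable (PiM J M)"
    proof (rule measurable_compose[where f="\<lambda>x. x i" and g="f i" and N="M i"])
      show "(\<lambda>x. x i) \<in> PiM J M \<rightarrow>\<^sub>M M i" by (rule measurable_component_singleton[OF i])
      show "f i \<in> borel_measurable (M i)" by (rule borel_measurable_integrable[OF f[OF i]])
    qed
  qed
  have "(\<Prod>i\<in>J. \<integral>y. f i y \<partial>M i) = (\<integral>x. (\<Prod>i\<in>J. f i (x i)) \<partial>PiM J M)"
    using product_integral_prod[where f=f and I=J] J(1) f by presburger
  also have "\<dots> = (\<integral>x. (\<Prod>i\<in>J. f i (x i)) \<partial>distr (PiM I M) (PiM J M) (\<lambda>x. restrict x J))"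
    by (subst distr_PiM_restrict_finite[OF J]) (rule refl)
  also have "\<dots> = (\<integral>x. (\<Prod>i\<in>J. f i (restrict x J i)) \<partial>PiM I M)"
    using integral_distr[OF measurable_restrict_subset[OF J(2)] f'] .
  also have "\<dots> = (\<integral>x. (\<Prod>i\<in>J. f i (x i)) \<partial>PiM I M)"
    by (intro Bochner_Integration.integral_cong refl prod.cong) auto
  finally show ?thesis ..
qed

definition env_shift :: "int \<Rightarrow> (int \<Rightarrow> 'a) \<Rightarrow> (int \<Rightarrow> 'a)" where
  "env_shift k \<omega> = (\<lambda>x. \<omega> (x + k))"

lemma env_shift_apply: "env_shift k \<omega> x = \<omega> (x + k)"
  by (simp add: env_shift_def)

lemma env_shift_shift: "env_shift j (env_shift k \<omega>) = env_shift (j + k) \<omega>"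
  by (simp add: env_shift_def fun_eq_iff ac_simps)

lemma env_shift_0 [simp]: "env_shift 0 \<omega> = \<omega>"
  by (simp add: env_shift_def)

lemma funpow_shift: "(env_shift 1 ^^ n) = env_shift (int n)"
proof (induction n)
  case (Suc n)
  show ?case by (simp add: Suc fun_eq_iff env_shift_shift)
qed (simp add: fun_eq_iff)

locale iid_field = prob_space N for N :: "'a measure"
begin

abbreviation P :: "(int \<Rightarrow> 'a) measure" where "P \<equiv> \<Pi>\<^sub>M x\<in>UNIV. N"

sublocale P: product_prob_space "\<lambda>_. N" "UNIV :: int set" ..

lemma measurable_shift [measurable]: "env_shift k \<in> P \<rightarrow>\<^sub>M P"
proof (rule measurable_PiM_single')
  fix i :: int
  have "(\<lambda>\<omega>. \<omega> (i + k)) \<in> P \<rightarrow>\<^sub>M N" by (rule measurable_component_singleton) simp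
  then show "(\<lambda>\<omega>. env_shift k \<omega> i) \<in> P \<rightarrow>\<^sub>M N" by (simp add: env_shift_apply)
qed (auto simp: space_PiM PiE_iff env_shift_apply)

lemma distr_shift: "distr P P (env_shift k) = P"
proof -
  have "distr P P (\<lambda>\<omega>. \<lambda>n\<in>UNIV. \<omega> (n + k)) = P"
    by (rule distr_PiM_reindex[where f="\<lambda>n. n + k" and M="\<lambda>_. N"]) (auto simp: prob_space_axioms)
  moreover have "(\<lambda>\<omega>. \<lambda>n\<in>UNIV. \<omega> (n + k)) = env_shift k"
    by (simp add: fun_eq_iff env_shift_apply)
  ultimately show ?thesis by metis
qed

lemma prob_shift:
  assumes "A \<in> sets P" shows "P.prob (env_shift k -` A \<inter> space P) = P.prob A"
proof -
  have "measure (distr P P (env_shift k)) A = P.prob (env_shift k -` A \<inter> space P)"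
    by (rule measure_distr) (use assms in auto)
  then show ?thesis by (simp add: distr_shift)
qed

lemma AE_shift:
  assumes "AE \<omega> in P. Q \<omega>" shows "AE \<omega> in P. Q (env_shift k \<omega>)"
proof -
  have "AE \<omega> in distr P P (env_shift k). Q \<omega>" unfolding distr_shift by (rule assms)
  then show ?thesis by (rule AE_distrD[OF measurable_shift])
qed

definition cyl :: "int set \<Rightarrow> (int \<Rightarrow> 'a set) \<Rightarrow> (int \<Rightarrow> 'a) set" where
  "cyl J E = {\<omega> \<in> space P. \<forall>i\<in>J. \<omega> i \<in> E i}"

lemma prob_cyl:
  assumes "finite J" "\<And>i. i \<in> J \<Longrightarrow> E i \<in> sets N"
  shows "P.prob (cyl J E) = (\<Prod>i\<in>J. prob (E i))"
proof -
  have "emeasure P (cyl J E) = (\<Prod>i\<in>J. emeasure N (E i))"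
    unfolding cyl_def by (rule P.emeasure_PiM_Collect) (use assms in auto)
  then show ?thesis
    by (simp add: P.emeasure_eq_measure emeasure_eq_measure prod_ennreal prod_nonneg)
qed

lemma sets_cyl:
  assumes "finite J" "\<And>i. i \<in> J \<Longrightarrow> E i \<in> sets N"
  shows "cyl J E \<in> sets P"
  unfolding cyl_def using assms by measurable

lemma mixing_cyl:
  assumes J: "finite J" "\<And>i. i \<in> J \<Longrightarrow> E i \<in> sets N" and K: "finite K" "\<And>i. i \<in> K \<Longrightarrow> F i \<in> sets N"
  shows "(\<lambda>n. P.prob (cyl J E \<inter> (env_shift (int n) -` cyl K F \<inter> space P)))
    \<longlonglongrightarrow> P.prob (cyl J E) * P.prob (cyl K F)"
proof -
  obtain a where a: "\<And>i j. i \<in> J \<Longrightarrow> j \<in> K \<Longrightarrow> i - j < a"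
  proof -
    have "finite ((\<lambda>(i,j). i - j) ` (J \<times> K))" using J K by auto
    then obtain a where "\<And>x. x \<in> (\<lambda>(i,j). i - j) ` (J \<times> K) \<Longrightarrow> x < a"
      using bounded_nat_set_is_finite by (metis Max_ge add.commute le_imp_less_or_eq less_add_one less_le_trans linorder_not_less order_less_le_trans zle_add1_eq_le)
    then show ?thesis using that by force
  qed
  have "\<forall>\<^sub>F n in sequentially. P.prob (cyl J E) * P.prob (cyl K F) =
    P.prob (cyl J E \<inter> (env_shift (int n) -` cyl K F \<inter> space P))"
  proof (rule eventually_sequentiallyI)
    fix n assume "nat a \<le> n"
    then have n: "a \<le> int n" by linarith
    let ?K = "(\<lambda>j. j + int n) ` K"
    have disj: "J \<inter> ?K = {}" using a n by force
    let ?G = "\<lambda>i. if i \<in> J then E i else F (i - int n)"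
    have G: "?G i \<in> sets N" if "i \<in> J \<union> ?K" for i using that J K by auto
    have notJ: "j + int n \<notin> J" if "j \<in> K" for j using disj that by auto
    have "cyl J E \<inter> (env_shift (int n) -` cyl K F \<inter> space P) = cyl (J \<union> ?K) ?G"
      using notJ by (fastforce simp: cyl_def space_PiM env_shift_apply split: if_splits)
    then have "P.prob (cyl J E \<inter> (env_shift (int n) -` cyl K F \<inter> space P)) = (\<Prod>i\<in>J \<union> ?K. prob (?G i))"
      using G J K by (subst prob_cyl[symmetric]) auto
    also have "\<dots> = (\<Prod>i\<in>J. prob (?G i)) * (\<Prod>i\<in>?K. prob (?G i))"
      using J K disj by (intro prod.union_disjoint) auto
    also have "(\<Prod>i\<in>?K. prob (?G i)) = (\<Prod>i\<in>K. prob (F i))"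
      using notJ by (subst prod.reindex) (auto simp: inj_on_def intro!: prod.cong)
    also have "(\<Prod>i\<in>J. prob (?G i)) = (\<Prod>i\<in>J. prob (E i))" by (intro prod.cong) auto
    finally show "P.prob (cyl J E) * P.prob (cyl K F) =
       P.prob (cyl J E \<inter> (env_shift (int n) -` cyl K F \<inter> space P))"
      using J K by (simp add: prob_cyl)
  qed
  then show ?thesis by (rule Lim_transform_eventually[OF tendsto_const])
qed

lemma prod_algebra_cyl:
  assumes "X \<in> prod_algebra UNIV (\<lambda>_::int. N)"
  obtains J E where "X = cyl J E" "finite J" "\<And>i. i \<in> J \<Longrightarrow> E i \<in> sets N"
  using assms by (elim prod_algebraE) (auto simp: cyl_def prod_emb_def space_PiM PiE_iff intro!: that)

text \<open>The cylinder sets generate the product \<open>\<sigma>\<close>-algebra and are stable under intersection.\<close>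

lemma dynkin_induct [consumes 1, case_names cyl empty compl union]:
  assumes A: "A \<in> sets P"
    and cyl: "\<And>J E. finite J \<Longrightarrow> (\<And>i. i \<in> J \<Longrightarrow> E i \<in> sets N) \<Longrightarrow> Q (cyl J E)"
    and empty: "Q {}"
    and compl: "\<And>A. A \<in> sets P \<Longrightarrow> Q A \<Longrightarrow> Q (space P - A)"
    and union: "\<And>A. disjoint_family A \<Longrightarrow> range A \<subseteq> sets P \<Longrightarrow> (\<And>i. Q (A i)) \<Longrightarrow> Q (\<Union>i::nat. A i)"
  shows "Q A"
proof -
  have "A \<in> sigma_sets (\<Pi>\<^sub>E i\<in>UNIV. space N) (prod_algebra UNIV (\<lambda>_::int. N))"
    using A by (simp add: sets_PiM)
  from Int_stable_prod_algebra prod_algebra_sets_into_space this show ?thesis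
  proof (induction rule: sigma_sets_induct_disjoint)
    case (basic A) then show ?case by (elim prod_algebra_cyl) (auto intro: cyl)
  next
    case (compl A) then show ?case using assms(4)[of A] by (simp add: sets_PiM space_PiM)
  next
    case (union A) then show ?case using assms(5)[of A] by (simp add: sets_PiM)
  qed (rule empty)
qed

text \<open>The shift moves the coordinates of the second cylinder away from those of the first, so for two cylinders the
  sequence is eventually constant (lemma \<open>mixing_cyl\<close>). For fixed \<open>F\<close> the sets
  \<open>A\<close> with this limit form a Dynkin system: Tannery's theorem handles countable disjoint unions.\<close>

lemma mixing:
  assumes A: "A \<in> sets P" and K: "finite K" "\<And>i. i \<in> K \<Longrightarrow> F i \<in> sets N"
  shows "(\<lambda>n. P.prob (A \<inter> (env_shift (int n) -` cyl K F \<inter> space P))) \<longlonglongrightarrow> P.prob A * P.prob (cyl K F)"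
  using A
proof (induction rule: dynkin_induct)
  case (cyl J E) then show ?case by (intro mixing_cyl K)
next
  case (compl A)
  let ?C = "\<lambda>n. env_shift (int n) -` cyl K F \<inter> space P"
  have C: "?C n \<in> sets P" "P.prob (?C n) = P.prob (cyl K F)" for n
    using measurable_sets[OF measurable_shift sets_cyl[OF K]] prob_shift[OF sets_cyl[OF K]] by auto
  have "P.prob ((space P - A) \<inter> ?C n) = P.prob (cyl K F) - P.prob (A \<inter> ?C n)" for n
  proof -
    have "(space P - A) \<inter> ?C n = ?C n - A \<inter> ?C n" by auto
    moreover have "P.prob (?C n - A \<inter> ?C n) = P.prob (?C n) - P.prob (A \<inter> ?C n)"
      using C(1)[of n] compl(1) by (intro P.finite_measure_Diff) auto
    ultimately show ?thesis unfolding C(2) by simp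
  qed
  moreover have "(\<lambda>n. P.prob (cyl K F) - P.prob (A \<inter> ?C n)) \<longlonglongrightarrow>
    P.prob (cyl K F) - P.prob A * P.prob (cyl K F)"
    using compl by (intro tendsto_intros)
  moreover have "P.prob (cyl K F) - P.prob A * P.prob (cyl K F) = P.prob (space P - A) * P.prob (cyl K F)"
    using compl(1) by (simp add: P.prob_compl algebra_simps)
  ultimately show ?case by simp
next
  case (union A)
  let ?C = "\<lambda>n. env_shift (int n) -` cyl K F \<inter> space P"
  have C: "?C n \<in> sets P" for n
    using measurable_sets[OF measurable_shift sets_cyl[OF K]] by auto
  have sums: "(\<lambda>i. P.prob (A i)) sums P.prob (\<Union>i. A i)"
    using union by (intro P.finite_measure_UNION) auto
  have "(\<lambda>i. P.prob (A i \<inter> ?C n)) sums P.prob (\<Union>i. A i \<inter> ?C n)" for n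
    using union C by (intro P.finite_measure_UNION) (auto simp: disjoint_family_on_def)
  then have eq: "P.prob ((\<Union>i. A i) \<inter> ?C n) = (\<Sum>i. P.prob (A i \<inter> ?C n))" for n
    by (simp add: sums_iff)
  have "(\<lambda>n. \<Sum>i. P.prob (A i \<inter> ?C n)) \<longlonglongrightarrow> (\<Sum>i. P.prob (A i) * P.prob (cyl K F))"
  proof (rule tannerys_theorem[THEN conjunct2, THEN conjunct2])
    show "summable (\<lambda>i. P.prob (A i))" using sums by (rule sums_summable)
    show "\<forall>\<^sub>F (k, n) in at_top \<times>\<^sub>F sequentially. norm (P.prob (A k \<inter> ?C n)) \<le> P.prob (A k)"
      using union by (intro always_eventually) (auto intro!: P.finite_measure_mono)
  qed (use union in auto)
  also have "(\<Sum>i. P.prob (A i) * P.prob (cyl K F)) = P.prob (\<Union>i. A i) * P.prob (cyl K F)"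
    using sums by (simp add: suminf_mult2[symmetric] sums_iff)
  finally show ?case unfolding eq .
qed auto

text \<open>By mixing, an invariant set is independent of every cylinder set, hence of every measurable set, hence of
  itself.\<close>

lemma shift_invariant_trivial:
  assumes A: "A \<in> sets P" and inv: "env_shift 1 -` A \<inter> space P = A"
  shows "P.prob A = 0 \<or> P.prob A = 1"
proof -
  have inv_n: "env_shift (int n) -` A \<inter> space P = A" for n
  proof (induction n)
    case (Suc n)
    have "env_shift (int (Suc n)) -` A \<inter> space P = env_shift (int n) -` (env_shift 1 -` A \<inter> space P) \<inter> space P"
      using measurable_space[OF measurable_shift] by (auto simp: env_shift_shift ac_simps)
    then show ?case using Suc inv by simp
  qed (use sets.sets_into_space[OF A] in auto)
  have ind: "P.prob (A \<inter> B) = P.prob A * P.prob B" if "B \<in> sets P" for B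
    using that
  proof (induction rule: dynkin_induct)
    case (cyl J E)
    have "A \<inter> (env_shift (int n) -` cyl J E \<inter> space P) = env_shift (int n) -` (A \<inter> cyl J E) \<inter> space P" for n
      using inv_n[of n] by blast
    moreover have "P.prob (env_shift (int n) -` (A \<inter> cyl J E) \<inter> space P) = P.prob (A \<inter> cyl J E)" for n
      using A sets_cyl[OF cyl] by (intro prob_shift sets.Int) auto
    ultimately have "P.prob (A \<inter> (env_shift (int n) -` cyl J E \<inter> space P)) = P.prob (A \<inter> cyl J E)" for n
      by presburger
    then show ?case
      using mixing[OF A cyl(1), of E] cyl(2) by (simp only: LIMSEQ_const_iff)
  next
    case (compl B)
    have "A \<inter> (space P - B) = A - A \<inter> B" using sets.sets_into_space[OF A] by auto
    then show ?case using A compl by (simp add: P.finite_measure_Diff P.prob_compl algebra_simps)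
  next
    case (union B)
    have "(\<lambda>i. P.prob (B i)) sums P.prob (\<Union>i. B i)"
      using union by (intro P.finite_measure_UNION) auto
    then have "(\<lambda>i. P.prob A * P.prob (B i)) sums (P.prob A * P.prob (\<Union>i. B i))"
      by (rule sums_mult)
    moreover have "(\<lambda>i. P.prob (A \<inter> B i)) sums P.prob (\<Union>i. A \<inter> B i)"
      using union A by (intro P.finite_measure_UNION) (auto simp: disjoint_family_on_def)
    ultimately show ?case using union by (simp add: sums_iff)
  qed auto
  from ind[OF A] show ?thesis by auto
qed

theorem shift_ergodic:
  fixes f :: "(int \<Rightarrow> 'a) \<Rightarrow> real"
  assumes "integrable P f"
  shows "AE \<omega> in P. (\<lambda>n. (\<Sum>k<n. f (env_shift (int k) \<omega>)) / real n) \<longlonglongrightarrow> (\<integral>\<omega>. f \<omega> \<partial>P)"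
  using P.ergodic_theorem[where T="env_shift 1", OF measurable_shift distr_shift assms shift_invariant_trivial]
  unfolding funpow_shift .

text \<open>The terms of a sequence with convergent averages are \<open>o(n)\<close>. Applied to the square of a function
  this shows that the values of the function along the shifts are \<open>o(sqrt n)\<close>.\<close>

lemma shift_sublinear:
  fixes f :: "(int \<Rightarrow> 'a) \<Rightarrow> real"
  assumes "integrable P f"
  shows "AE \<omega> in P. (\<lambda>n. f (env_shift (int n) \<omega>) / real n) \<longlonglongrightarrow> 0"
  using shift_ergodic[OF assms]
proof eventually_elim
  case (elim \<omega>)
  let ?S = "\<lambda>n. \<Sum>k<n. f (env_shift (int k) \<omega>)"
  have "(\<lambda>n. ?S (Suc n) / real (Suc n) * (real (Suc n) / real n) - ?S n / real n)
    \<longlonglongrightarrow> (\<integral>\<omega>. f \<omega> \<partial>P) * 1 - (\<integral>\<omega>. f \<omega> \<partial>P)"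
    by (intro tendsto_diff tendsto_mult elim LIMSEQ_Suc[OF elim]) real_asymp
  moreover have "?S (Suc n) / real (Suc n) * (real (Suc n) / real n) - ?S n / real n = f (env_shift (int n) \<omega>) / real n" for n
    by (simp add: diff_divide_distrib[symmetric])
  ultimately show ?case by simp
qed

end

section \<open>Fluctuations of i.i.d. sums over short windows\<close>

context iid_field
begin

lemma measurable_coord: "f \<in> borel_measurable N \<Longrightarrow> (\<lambda>\<omega>. f (\<omega> k)) \<in> borel_measurable P"
proof -
  assume f: "f \<in> borel_measurable N"
  have "(\<lambda>\<omega>. \<omega> k) \<in> P \<rightarrow>\<^sub>M N" by (rule measurable_component_singleton) simp
  from measurable_compose[OF this f] show ?thesis .
qed

text \<open>Chernoff's bound. For \<open>\<bar>y\<bar> \<le> 1\<close> the inequality \<open>exp y \<le> 1 + y +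
  y\<^sup>2\<close> bounds the moment generating function of a centred variable in terms of its variance.\<close>

lemma prob_sum_ge:
  fixes g :: "'a \<Rightarrow> real" and \<eta> v x :: real
  assumes g: "g \<in> borel_measurable N" and bnd: "\<And>x. x \<in> space N \<Longrightarrow> \<bar>\<eta> * g x\<bar> \<le> 1" and lam: "0 < \<eta>"
    and mean: "(\<integral>x. g x \<partial>N) = 0" and var: "(\<integral>x. (g x)\<^sup>2 \<partial>N) \<le> v" and J: "finite J"
  shows "P.prob {\<omega> \<in> space P. x \<le> (\<Sum>k\<in>J. g (\<omega> k))} \<le> exp (card J * \<eta>\<^sup>2 * v - \<eta> * x)"
proof -
  have int_g: "integrable N g"
    by (rule integrable_const_bound[where B="1 / \<eta>"]) (use bnd lam g in \<open>auto simp: field_simps abs_mult\<close>)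
  have int_g2: "integrable N (\<lambda>x. (g x)\<^sup>2)"
  proof (rule integrable_const_bound[where B="(1 / \<eta>)\<^sup>2"])
    show "AE x in N. norm ((g x)\<^sup>2) \<le> (1 / \<eta>)\<^sup>2"
    proof (rule AE_I2)
      fix x assume "x \<in> space N"
      then have "\<bar>g x\<bar> \<le> \<bar>1 / \<eta>\<bar>" using bnd[of x] lam by (simp add: field_simps abs_mult)
      then show "norm ((g x)\<^sup>2) \<le> (1 / \<eta>)\<^sup>2" unfolding abs_le_square_iff by simp
    qed
  qed (use g in measurable)
  have int_e: "integrable N (\<lambda>x. exp (\<eta> * g x))"
    by (rule integrable_const_bound[where B="exp 1"]) (use bnd g in \<open>auto simp: abs_le_iff\<close>)
  have "(\<integral>x. exp (\<eta> * g x) \<partial>N) \<le> (\<integral>x. 1 + \<eta> * g x + \<eta>\<^sup>2 * (g x)\<^sup>2 \<partial>N)"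
    using exp_le_quadratic[OF bnd] int_g int_g2 int_e
    by (intro integral_mono) (auto simp: power_mult_distrib)
  also have "\<dots> = 1 + \<eta>\<^sup>2 * (\<integral>x. (g x)\<^sup>2 \<partial>N)"
    using int_g int_g2 mean by (simp add: prob_space)
  also have "\<dots> \<le> 1 + \<eta>\<^sup>2 * v" using var by (simp add: mult_left_mono)
  also have "\<dots> \<le> exp (\<eta>\<^sup>2 * v)" by (rule exp_ge_add_one_self)
  finally have mgf: "(\<integral>x. exp (\<eta> * g x) \<partial>N) \<le> exp (\<eta>\<^sup>2 * v)" .
  let ?S = "\<lambda>\<omega>. \<Sum>k\<in>J. g (\<omega> k)"
  have S: "?S \<in> borel_measurable P" by (intro borel_measurable_sum measurable_coord g)
  have S_bound: "\<eta> * ?S \<omega> \<le> card J" if "\<omega> \<in> space P" for \<omega>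
  proof -
    have "\<eta> * ?S \<omega> = (\<Sum>k\<in>J. \<eta> * g (\<omega> k))" by (simp add: sum_distrib_left)
    also have "\<dots> \<le> (\<Sum>k\<in>J. 1)"
      using that bnd by (intro sum_mono) (auto simp: space_PiM PiE_iff abs_le_iff)
    finally show ?thesis by simp
  qed
  have int_S: "integrable P (\<lambda>\<omega>. exp (\<eta> * ?S \<omega>))"
    by (rule P.integrable_const_bound[where B="exp (card J)"]) (use S S_bound in auto)
  have "P.prob {\<omega> \<in> space P. x \<le> ?S \<omega>} = P.prob {\<omega> \<in> space P. exp (\<eta> * x) \<le> exp (\<eta> * ?S \<omega>)}"
    using lam by simp
  also have "\<dots> \<le> (\<integral>\<omega>. exp (\<eta> * ?S \<omega>) \<partial>P) / exp (\<eta> * x)"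
    by (rule integral_Markov_inequality_measure[where A="{}"]) (use int_S in auto)
  also have "(\<integral>\<omega>. exp (\<eta> * ?S \<omega>) \<partial>P) = (\<integral>\<omega>. (\<Prod>k\<in>J. exp (\<eta> * g (\<omega> k))) \<partial>P)"
    using J by (simp add: sum_distrib_left exp_sum)
  also have "\<dots> = (\<Prod>k\<in>J. \<integral>x. exp (\<eta> * g x) \<partial>N)"
    by (rule P.integral_PiM_prod[where f="\<lambda>_ x. exp (\<eta> * g x)"]) (use J int_e in auto)
  also have "\<dots> \<le> (\<Prod>k\<in>J. exp (\<eta>\<^sup>2 * v))"
    using mgf by (intro prod_mono) (auto intro: integral_nonneg_AE)
  also have "\<dots> = exp (card J * \<eta>\<^sup>2 * v)"
    by (simp add: exp_of_nat_mult[symmetric] mult.assoc)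
  finally show ?thesis by (simp add: exp_diff divide_right_mono)
qed

lemma prob_abs_sum_ge:
  fixes g :: "'a \<Rightarrow> real" and \<eta> v x :: real
  assumes g: "g \<in> borel_measurable N" and bnd: "\<And>x. x \<in> space N \<Longrightarrow> \<bar>\<eta> * g x\<bar> \<le> 1" and lam: "0 < \<eta>"
    and mean: "(\<integral>x. g x \<partial>N) = 0" and var: "(\<integral>x. (g x)\<^sup>2 \<partial>N) \<le> v" and J: "finite J"
  shows "P.prob {\<omega> \<in> space P. x \<le> \<bar>\<Sum>k\<in>J. g (\<omega> k)\<bar>} \<le> 2 * exp (card J * \<eta>\<^sup>2 * v - \<eta> * x)"
proof -
  have S: "(\<lambda>\<omega>. \<Sum>k\<in>J. g (\<omega> k)) \<in> borel_measurable P" by (intro borel_measurable_sum measurable_coord g)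
  have "P.prob {\<omega> \<in> space P. x \<le> \<bar>\<Sum>k\<in>J. g (\<omega> k)\<bar>} \<le>
    P.prob ({\<omega> \<in> space P. x \<le> (\<Sum>k\<in>J. g (\<omega> k))} \<union> {\<omega> \<in> space P. x \<le> (\<Sum>k\<in>J. - g (\<omega> k))})"
    using S by (intro P.finite_measure_mono) (auto simp: abs_if sum_negf split: if_splits)
  also have "\<dots> \<le> P.prob {\<omega> \<in> space P. x \<le> (\<Sum>k\<in>J. g (\<omega> k))} + P.prob {\<omega> \<in> space P. x \<le> (\<Sum>k\<in>J. - g (\<omega> k))}"
    using S by (intro measure_Un_le) (auto simp: sum_negf)
  also have "\<dots> \<le> exp (card J * \<eta>\<^sup>2 * v - \<eta> * x) + exp (card J * \<eta>\<^sup>2 * v - \<eta> * x)"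
    by (intro add_mono prob_sum_ge[OF g bnd lam mean var J] prob_sum_ge[OF _ _ lam _ _ J])
      (use g bnd mean var in auto)
  finally show ?thesis by simp
qed

text \<open>The summands are truncated at \<open>n powr c\<close>, which for large \<open>n\<close> changes none of them.
  Chernoff's bound with rate \<open>n powr (- q) / 2\<close> applies as \<open>c \<le> q\<close>. Its variance
  term stays bounded as \<open>a \<le> 2 q\<close>, so a window exceeds half of \<open>n powr b\<close> with
  probability at most a constant times \<open>exp (- (n powr (b - q)) / 4)\<close>. This is summable even after
  a union bound over \<open>n + 1\<close> windows. The truncation lowers the mean by at most a constant times
  \<open>n powr (- c)\<close>, which over a window of length \<open>n powr a\<close> amounts to \<open>o(n powr
  b)\<close>.\<close>

lemma window_bound:
  fixes m :: "'a \<Rightarrow> real"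
  assumes m: "m \<in> borel_measurable N" and m0: "\<And>x. x \<in> space N \<Longrightarrow> 0 \<le> m x" and m2: "integrable N (\<lambda>x. (m x)\<^sup>2)"
    and trunc: "AE \<omega> in P. \<forall>\<^sub>F n in sequentially. \<forall>k<n. m (\<omega> (int k)) \<le> real n powr c"
    and exps: "c \<le> q" "a \<le> 2 * q" "q < b" "a - c < b"
  shows "AE \<omega> in P. \<forall>\<^sub>F n in sequentially. \<forall>l\<le>n. real l \<le> real n powr a \<longrightarrow>
    \<bar>\<Sum>k\<in>{n-l..<n}. m (\<omega> (int k)) - (\<integral>x. m x \<partial>N)\<bar> \<le> real n powr b"
proof -
  define \<mu> where "\<mu> = (\<integral>x. m x \<partial>N)"
  define v where "v = (\<integral>x. (m x)\<^sup>2 \<partial>N)"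
  define f where "f n x = min (m x) (real n powr c)" for n :: nat and x
  define g where "g n x = f n x - (\<integral>x. f n x \<partial>N)" for n x
  have v0: "0 \<le> v" unfolding v_def by simp
  have m1: "integrable N m" by (rule square_integrable_imp_integrable[OF m m2])
  have fm[measurable]: "f n \<in> borel_measurable N" for n unfolding f_def using m by measurable
  have f0: "0 \<le> f n x" "f n x \<le> m x" "f n x \<le> real n powr c" if "x \<in> space N" for n x
    using m0[OF that] by (auto simp: f_def)
  have intf: "integrable N (f n)" for n
    by (rule Bochner_Integration.integrable_bound[OF m1]) (use f0 m0 in auto)
  have intf2: "integrable N (\<lambda>x. (f n x)\<^sup>2)" for n
    by (rule Bochner_Integration.integrable_bound[OF m2]) (use f0 m0 in \<open>auto intro!: power_mono\<close>)
  have meanf: "0 \<le> (\<integral>x. f n x \<partial>N)" "(\<integral>x. f n x \<partial>N) \<le> real n powr c" for n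
  proof -
    show "0 \<le> (\<integral>x. f n x \<partial>N)" by (rule integral_nonneg_AE) (use f0 in auto)
    have "(\<integral>x. f n x \<partial>N) \<le> (\<integral>x. real n powr c \<partial>N)"
      by (intro integral_mono) (use f0 intf in auto)
    then show "(\<integral>x. f n x \<partial>N) \<le> real n powr c" by (simp add: prob_space)
  qed
  have gm: "g n \<in> borel_measurable N" for n unfolding g_def[abs_def] by measurable
  have gb: "\<bar>g n x\<bar> \<le> real n powr c" if "x \<in> space N" for n x
    unfolding g_def using f0[OF that, of n] meanf[of n] by (auto simp: abs_le_iff)
  have gmean: "(\<integral>x. g n x \<partial>N) = 0" for n
    unfolding g_def using intf by (simp add: prob_space)
  have gvar: "(\<integral>x. (g n x)\<^sup>2 \<partial>N) \<le> v" for n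
  proof -
    have "(\<integral>x. (g n x)\<^sup>2 \<partial>N) = (\<integral>x. (f n x)\<^sup>2 \<partial>N) - (\<integral>x. f n x \<partial>N)\<^sup>2"
      unfolding g_def by (rule variance_eq[OF intf intf2])
    also have "\<dots> \<le> (\<integral>x. (f n x)\<^sup>2 \<partial>N)" by simp
    also have "\<dots> \<le> v" unfolding v_def
      by (intro integral_mono intf2 m2) (use f0 m0 in \<open>auto intro!: power_mono\<close>)
    finally show ?thesis .
  qed
  have bias: "\<bar>(\<integral>x. f n x \<partial>N) - \<mu>\<bar> \<le> v * real n powr (- c)" if n: "0 < n" for n
  proof -
    have "\<mu> - (\<integral>x. f n x \<partial>N) = (\<integral>x. m x - f n x \<partial>N)"
      unfolding \<mu>_def using m1 intf by simp
    also have "\<dots> \<le> (\<integral>x. real n powr (- c) * (m x)\<^sup>2 \<partial>N)"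
    proof (intro integral_mono)
      fix x assume x: "x \<in> space N"
      show "m x - f n x \<le> real n powr (- c) * (m x)\<^sup>2"
      proof (cases "m x \<le> real n powr c")
        case False
        have "m x * real n powr c \<le> m x * m x" using False m0[OF x] by (intro mult_left_mono) auto
        then have "m x \<le> real n powr (- c) * (m x)\<^sup>2"
          using n by (simp add: powr_minus field_simps power2_eq_square)
        then show ?thesis using f0[OF x, of n] by linarith
      qed (simp add: f_def)
    qed (use m1 intf m2 in auto)
    also have "\<dots> = v * real n powr (- c)" by (simp add: v_def)
    finally have "\<mu> - (\<integral>x. f n x \<partial>N) \<le> v * real n powr (- c)" .
    moreover have "(\<integral>x. f n x \<partial>N) \<le> \<mu>"
      unfolding \<mu>_def by (intro integral_mono) (use f0 intf m1 in auto)
    ultimately show ?thesis by simp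
  qed
  define L where "L n = {l. l \<le> n \<and> real l \<le> real n powr a}" for n
  have finL: "finite (L n)" "card (L n) \<le> n + 1" for n
  proof -
    have "L n \<subseteq> {..n}" by (auto simp: L_def)
    then show "finite (L n)" "card (L n) \<le> n + 1"
      using card_mono[of "{..n}" "L n"] by (auto intro: finite_subset)
  qed
  define S where "S n l \<omega> = (\<Sum>k\<in>{n-l..<n}. g n (\<omega> (int k)))" for n l and \<omega> :: "int \<Rightarrow> 'a"
  have S_eq: "S n l \<omega> = (\<Sum>k\<in>int ` {n-l..<n}. g n (\<omega> k))" for n l \<omega>
    unfolding S_def by (subst sum.reindex) auto
  define A where "A n = (\<Union>l\<in>L n. {\<omega> \<in> space P. real n powr b / 2 \<le> \<bar>S n l \<omega>\<bar>})" for n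
  have Sm: "S n l \<in> borel_measurable P" for n l
    unfolding S_def[abs_def] by (intro borel_measurable_sum measurable_coord gm)
  have A: "A n \<in> sets P" for n
    unfolding A_def using finL Sm by (intro sets.finite_UN) auto
  have pA: "P.prob (A n) \<le> 2 * exp (v / 4) * (real (n + 1) * exp (- (real n powr (b - q)) / 4))" if n: "0 < n" for n
  proof -
    define \<eta> where "\<eta> = real n powr (- q) / 2"
    have lam: "0 < \<eta>" unfolding \<eta>_def using n by simp
    have one: "P.prob {\<omega> \<in> space P. real n powr b / 2 \<le> \<bar>S n l \<omega>\<bar>} \<le> 2 * exp (v / 4 - real n powr (b - q) / 4)"
      if l: "l \<in> L n" for l
    proof -
      have "P.prob {\<omega> \<in> space P. real n powr b / 2 \<le> \<bar>S n l \<omega>\<bar>} \<le>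
        2 * exp (card (int ` {n-l..<n}) * \<eta>\<^sup>2 * v - \<eta> * (real n powr b / 2))"
        unfolding S_eq
      proof (rule prob_abs_sum_ge[OF gm _ lam gmean gvar])
        fix x assume "x \<in> space N"
        then have "\<bar>\<eta> * g n x\<bar> \<le> \<eta> * real n powr c"
          using gb lam by (simp add: abs_mult)
        also have "\<dots> = real n powr (c - q) / 2" unfolding \<eta>_def by (simp add: powr_add[symmetric])
        also have "\<dots> \<le> 1" using exps n powr_mono[of "c - q" 0 "real n"] by simp
        finally show "\<bar>\<eta> * g n x\<bar> \<le> 1" .
      qed simp
      also have "card (int ` {n-l..<n}) = l" using l by (subst card_image) (auto simp: L_def)
      also have "real l * \<eta>\<^sup>2 * v - \<eta> * (real n powr b / 2) \<le> v / 4 - real n powr (b - q) / 4"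
      proof -
        have "real l * \<eta>\<^sup>2 \<le> real n powr a * \<eta>\<^sup>2" using l by (intro mult_right_mono) (auto simp: L_def)
        also have "\<dots> = real n powr (a - 2 * q) / 4"
        proof -
          have "(real n powr (- q))\<^sup>2 = real n powr (- 2 * q)"
            by (simp add: power2_eq_square powr_add[symmetric])
          then show ?thesis unfolding \<eta>_def by (simp add: power_divide powr_add[symmetric])
        qed
        also have "\<dots> \<le> 1 / 4" using exps n powr_mono[of "a - 2 * q" 0 "real n"] by simp
        finally have "real l * \<eta>\<^sup>2 * v \<le> 1 / 4 * v" using v0 by (rule mult_right_mono)
        moreover have "\<eta> * (real n powr b / 2) = real n powr (b - q) / 4"
          unfolding \<eta>_def by (simp add: powr_add[symmetric])
        ultimately show ?thesis by simp
      qed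
      finally show ?thesis by simp
    qed
    have "P.prob (A n) \<le> (\<Sum>l\<in>L n. P.prob {\<omega> \<in> space P. real n powr b / 2 \<le> \<bar>S n l \<omega>\<bar>})"
      unfolding A_def using finL Sm by (intro P.finite_measure_subadditive_finite) auto
    also have "\<dots> \<le> (\<Sum>l\<in>L n. 2 * exp (v / 4 - real n powr (b - q) / 4))" by (intro sum_mono one)
    also have "\<dots> = real (card (L n)) * (2 * exp (v / 4 - real n powr (b - q) / 4))" by simp
    also have "\<dots> \<le> real (n + 1) * (2 * exp (v / 4 - real n powr (b - q) / 4))"
      using finL(2)[of n] by (intro mult_right_mono) auto
    also have "exp (v / 4 - real n powr (b - q) / 4) = exp (v / 4) * exp (- (real n powr (b - q)) / 4)"
      by (simp add: exp_add[symmetric])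
    finally show ?thesis by (simp only: ac_simps)
  qed
  have "summable (\<lambda>n. 2 * exp (v / 4) * (real (n + 1) * exp (- (real n powr (b - q)) / 4)))"
  proof (rule summable_mult, rule summable_comparison_test_bigo)
    show "summable (\<lambda>n. norm (1 / real n ^ 2))"
      using inverse_power_summable[of 2, where 'a=real] by (simp add: inverse_eq_divide)
    have "0 < b - q" using exps by simp
    then show "(\<lambda>n. real (n + 1) * exp (- (real n powr (b - q)) / 4)) \<in> O(\<lambda>n. 1 / real n ^ 2)"
      by real_asymp
  qed
  then have "summable (\<lambda>n. P.prob (A n))"
  proof (rule summable_comparison_test_ev[rotated])
    show "\<forall>\<^sub>F n in sequentially. norm (P.prob (A n)) \<le> 2 * exp (v / 4) * (real (n + 1) * exp (- (real n powr (b - q)) / 4))"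
      using eventually_gt_at_top[of 0] by eventually_elim (use pA in auto)
  qed
  then have "AE \<omega> in P. \<forall>\<^sub>F n in sequentially. \<omega> \<in> space P - A n"
    using A by (intro borel_cantelli_AE1) (auto simp: less_top[symmetric])
  then show ?thesis
    using trunc AE_space
  proof eventually_elim
    case (elim \<omega>)
    have "0 < b - (a - c)" using exps by simp
    then have "(\<lambda>n. v * real n powr (a - c) / real n powr b) \<longlonglongrightarrow> 0" by real_asymp
    then have "\<forall>\<^sub>F n in sequentially. v * real n powr (a - c) / real n powr b < 1 / 2"
      by (rule order_tendstoD) simp
    with elim(1,2) eventually_gt_at_top[of 0] show ?case
    proof eventually_elim
      case (elim n)
      show ?case
      proof (intro allI impI)
        fix l assume l: "l \<le> n" "real l \<le> real n powr a"
        have fm_eq: "m (\<omega> (int k)) = f n (\<omega> (int k))" if "k \<in> {n-l..<n}" for k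
          using elim(2) that by (simp add: f_def)
        have "(\<Sum>k\<in>{n-l..<n}. m (\<omega> (int k)) - \<mu>) = (\<Sum>k\<in>{n-l..<n}. g n (\<omega> (int k)) + ((\<integral>x. f n x \<partial>N) - \<mu>))"
          by (intro sum.cong) (auto simp: fm_eq g_def)
        also have "\<dots> = S n l \<omega> + real l * ((\<integral>x. f n x \<partial>N) - \<mu>)"
          using l by (simp add: sum.distrib S_def)
        also have "\<bar>\<dots>\<bar> \<le> \<bar>S n l \<omega>\<bar> + real l * \<bar>(\<integral>x. f n x \<partial>N) - \<mu>\<bar>"
          by (rule order_trans[OF abs_triangle_ineq]) (simp add: abs_mult)
        also have "\<dots> \<le> real n powr b / 2 + real n powr a * (v * real n powr (- c))"
        proof (rule add_mono)
          have "l \<in> L n" using l by (simp add: L_def)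
          then have "\<not> real n powr b / 2 \<le> \<bar>S n l \<omega>\<bar>" using elim(1) by (auto simp: A_def)
          then show "\<bar>S n l \<omega>\<bar> \<le> real n powr b / 2" by simp
          show "real l * \<bar>(\<integral>x. f n x \<partial>N) - \<mu>\<bar> \<le> real n powr a * (v * real n powr (- c))"
            using l bias[OF elim(3)] by (intro mult_mono) auto
        qed
        also have "real n powr a * (v * real n powr (- c)) = v * real n powr (a - c)"
          by (simp add: powr_diff powr_minus field_simps)
        also have "\<dots> \<le> real n powr b / 2"
          using elim(3,4) by (simp add: field_simps)
        finally show "\<bar>\<Sum>k\<in>{n-l..<n}. m (\<omega> (int k)) - (\<integral>x. m x \<partial>N)\<bar> \<le> real n powr b"
          unfolding \<mu>_def by simp
      qed
    qed
  qed
qed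

text \<open>The \<open>p\<close>-th powers of the summands are \<open>o(n)\<close>.\<close>

lemma eventually_truncated:
  fixes m :: "'a \<Rightarrow> real"
  assumes m: "m \<in> borel_measurable N" and m0: "\<And>x. x \<in> space N \<Longrightarrow> 0 \<le> m x"
    and mp: "integrable N (\<lambda>x. m x powr p)" and p: "0 < p" "1 / p \<le> c"
  shows "AE \<omega> in P. \<forall>\<^sub>F n in sequentially. \<forall>k<n. m (\<omega> (int k)) \<le> real n powr c"
proof -
  have int: "integrable P (\<lambda>\<omega>. m (\<omega> 0) powr p)"
  proof -
    have "integrable (distr P N (\<lambda>\<omega>. \<omega> 0)) (\<lambda>x. m x powr p)" using mp by (simp add: P.PiM_component)
    then show ?thesis by (rule integrable_distr[rotated]) (rule measurable_component_singleton, simp)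
  qed
  show ?thesis
    using shift_sublinear[OF int] AE_space
  proof eventually_elim
    case (elim \<omega>)
    then have "(\<lambda>n. m (\<omega> (int n)) powr p / real n) \<longlonglongrightarrow> 0" by (simp add: env_shift_apply)
    from eventually_all_less_linear[OF this zero_less_one] eventually_gt_at_top[of 0] show ?case
    proof eventually_elim
      case (elim n)
      show ?case
      proof (intro allI impI)
        fix k assume "k < n"
        have nn: "0 \<le> m (\<omega> (int k))" using \<open>\<omega> \<in> space P\<close> by (intro m0) (auto simp: space_PiM)
        have "m (\<omega> (int k)) = (m (\<omega> (int k)) powr p) powr (1 / p)"
          using p nn by (simp add: powr_powr)
        also have "\<dots> \<le> real n powr (1 / p)"
          using elim \<open>k < n\<close> p by (intro powr_mono2) auto
        also have "\<dots> \<le> real n powr c" using elim p by (intro powr_mono) auto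
        finally show "m (\<omega> (int k)) \<le> real n powr c" .
      qed
    qed
  qed
qed

end

section \<open>The biased nearest-neighbour walk\<close>

text \<open>Position of the walk after \<open>k\<close> steps. The increments are counted from 0 here (and not from 1 as in
  \<^const>\<open>walk\<close>), so that cutting a path at time \<open>a\<close> is cutting the sequence of
  increments at \<open>a\<close>.\<close>

definition pos :: "(nat \<Rightarrow> int) \<Rightarrow> nat \<Rightarrow> int" where
  "pos z k = (\<Sum>j<k. z j)"

definition passage :: "(nat \<Rightarrow> int) \<Rightarrow> int \<Rightarrow> nat" where
  "passage z n = (LEAST k. pos z k = n)"

definition hits_at :: "(nat \<Rightarrow> int) \<Rightarrow> int \<Rightarrow> nat \<Rightarrow> bool" where
  "hits_at z n a \<longleftrightarrow> pos z a = n \<and> (\<forall>k<a. pos z k \<noteq> n)"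

definition unit_steps :: "(nat \<Rightarrow> int) \<Rightarrow> bool" where
  "unit_steps z \<longleftrightarrow> (\<forall>j. z j = 1 \<or> z j = -1)"

lemma pos_0 [simp]: "pos z 0 = 0"
  and pos_Suc: "pos z (Suc k) = pos z k + z k"
  by (simp_all add: pos_def)

lemma pos_case_nat: "pos (case_nat a z) (Suc k) = a + pos z k"
  unfolding pos_def by (subst sum.lessThan_Suc_shift) simp

lemma pos_comb_seq_le: "k \<le> a \<Longrightarrow> pos (comb_seq a z z') k = pos z k"
  unfolding pos_def by (intro sum.cong) (auto simp: comb_seq_def)

lemma pos_comb_seq_add: "pos (comb_seq a z z') (a + k) = pos z a + pos z' k"
proof (induction k)
  case (Suc k)
  then show ?case by (simp add: pos_Suc comb_seq_def)
qed (simp add: pos_comb_seq_le)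

lemma hits_at_passage: "hits_at z n a \<Longrightarrow> passage z n = a"
  unfolding hits_at_def passage_def
  by (intro Least_equality) (auto simp: not_less[symmetric])

lemma hits_at_iff: "(\<exists>k. pos z k = n) \<Longrightarrow> hits_at z n a \<longleftrightarrow> passage z n = a"
proof
  assume ex: "\<exists>k. pos z k = n" and a: "passage z n = a"
  show "hits_at z n a"
    unfolding hits_at_def a[symmetric] passage_def
    using LeastI_ex[OF ex] not_less_Least[of _ "\<lambda>k. pos z k = n"] by blast
qed (rule hits_at_passage)

lemma pos_passage: "\<exists>k. pos z k = n \<Longrightarrow> pos z (passage z n) = n"
  unfolding passage_def by (rule LeastI_ex)

lemma not_pos_before_passage: "k < passage z n \<Longrightarrow> pos z k \<noteq> n"
  unfolding passage_def by (rule not_less_Least)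

lemma unit_steps_ivt:
  assumes "unit_steps z" "0 \<le> n" "n \<le> pos z k"
  shows "\<exists>i\<le>k. pos z i = n"
  using assms(3)
proof (induction k)
  case (Suc k)
  show ?case
  proof (cases "n \<le> pos z k")
    case False
    have "z k = 1 \<or> z k = -1" using assms(1) by (simp add: unit_steps_def)
    with False Suc.prems have "pos z (Suc k) = n" by (auto simp: pos_Suc)
    then show ?thesis by blast
  next
    case True
    then obtain i where "i \<le> k" "pos z i = n" using Suc.IH by blast
    then show ?thesis by (intro exI[of _ i]) simp
  qed
qed (use assms in auto)

lemma pos_before_passage:
  assumes "unit_steps z" "0 \<le> n" "k < passage z n"
  shows "pos z k < n"
  using unit_steps_ivt[OF assms(1,2), of k] not_pos_before_passage[of _ z n] assms(3)
  by (metis le_less_trans not_less)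

lemma passage_comb_seq:
  assumes z: "unit_steps z" "\<exists>k. pos z k = n" and z': "unit_steps z'" "\<exists>k. pos z' k = 1" and n: "0 \<le> n"
  shows "passage (comb_seq (passage z n) z z') (n + 1) = passage z n + passage z' 1"
proof (rule hits_at_passage)
  let ?c = "comb_seq (passage z n) z z'"
  have a: "pos z (passage z n) = n" using z by (intro pos_passage)
  show "hits_at ?c (n + 1) (passage z n + passage z' 1)"
    unfolding hits_at_def
  proof (intro conjI allI impI)
    show "pos ?c (passage z n + passage z' 1) = n + 1"
      using a pos_passage[OF z'(2)] by (simp add: pos_comb_seq_add)
    fix k assume k: "k < passage z n + passage z' 1"
    show "pos ?c k \<noteq> n + 1"
    proof (cases "k < passage z n")
      case True
      then show ?thesis using pos_before_passage[OF z(1) n True] by (simp add: pos_comb_seq_le)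
    next
      case False
      then obtain j where "k = passage z n + j" using le_Suc_ex not_less by blast
      then show ?thesis using k a not_pos_before_passage[of j z' 1] by (simp add: pos_comb_seq_add)
    qed
  qed
qed

text \<open>The law of the increments alone. The constants \<open>\<gamma>\<close> and \<open>\<rho>\<close> come from the
  exponential moment \<open>E (\<gamma> powr pos z k) = \<rho> ^ k\<close>. The choice \<open>\<gamma> = 1 /
  sqrt \<beta>\<close> minimises \<open>\<rho>\<close> and makes it less than 1.\<close>

locale biased_walk =
  fixes \<beta> :: real
  assumes beta: "1 < \<beta>"
begin

abbreviation W :: "(nat \<Rightarrow> int) measure" where
  "W \<equiv> \<Pi>\<^sub>M j\<in>UNIV. measure_pmf (step_pmf \<beta>)"

sublocale W: sequence_space "measure_pmf (step_pmf \<beta>)" ..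

definition \<gamma> :: real where "\<gamma> = 1 / sqrt \<beta>"
definition \<rho> :: real where "\<rho> = 2 * sqrt \<beta> / (\<beta> + 1)"

lemma gamma: "0 < \<gamma>" "\<gamma> < 1"
  using beta unfolding \<gamma>_def by (auto simp: field_simps)

lemma rho: "0 < \<rho>" "\<rho> < 1"
proof -
  have "1 < sqrt \<beta>" using beta by simp
  then have "0 < (sqrt \<beta> - 1)\<^sup>2" by simp
  also have "(sqrt \<beta> - 1)\<^sup>2 = \<beta> + 1 - 2 * sqrt \<beta>" using beta by (simp add: power2_diff)
  finally show "\<rho> < 1" using beta unfolding \<rho>_def by (simp add: field_simps)
  show "0 < \<rho>" using beta unfolding \<rho>_def by auto
qed

lemma measurable_coord [measurable]: "(\<lambda>z. z j) \<in> W \<rightarrow>\<^sub>M count_space UNIV"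
  using measurable_component_singleton[of j UNIV "\<lambda>_. measure_pmf (step_pmf \<beta>)"] by simp

lemma measurable_pos [measurable]: "(\<lambda>z. pos z k) \<in> W \<rightarrow>\<^sub>M count_space UNIV"
proof (induction k)
  case (Suc k)
  have "(\<lambda>z. pos z k + i) \<in> W \<rightarrow>\<^sub>M count_space UNIV" for i
    by (rule measurable_compose[OF Suc]) simp
  then show ?case unfolding pos_Suc
    by (rule measurable_compose_countable[where f="\<lambda>i z. pos z k + i"]) measurable
qed simp

lemma measurable_passage [measurable]: "(\<lambda>z. passage z n) \<in> W \<rightarrow>\<^sub>M count_space UNIV"
  unfolding passage_def by measurable

lemma measurable_hits_at [measurable]: "Measurable.pred W (\<lambda>z. hits_at z n a)"
  unfolding hits_at_def by measurable

lemma nn_integral_step: "(\<integral>\<^sup>+a. f a \<partial>measure_pmf (step_pmf \<beta>)) = ennreal (1 / (\<beta> + 1)) * f (-1) + ennreal (\<beta> / (\<beta> + 1)) * f 1"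
proof -
  have p: "0 \<le> 1 / (\<beta> + 1)" "1 / (\<beta> + 1) \<le> 1" "1 - 1 / (\<beta> + 1) = \<beta> / (\<beta> + 1)"
    using beta by (auto simp: field_simps)
  show ?thesis
    using p by (simp add: step_pmf_def nn_integral_bernoulli_pmf mult.commute)
qed

lemma nn_integral_first_step:
  assumes [measurable]: "F \<in> borel_measurable W"
  shows "(\<integral>\<^sup>+z. F z \<partial>W) = ennreal (1 / (\<beta> + 1)) * (\<integral>\<^sup>+z. F (case_nat (-1) z) \<partial>W)
    + ennreal (\<beta> / (\<beta> + 1)) * (\<integral>\<^sup>+z. F (case_nat 1 z) \<partial>W)"
proof -
  let ?m = "measure_pmf (step_pmf \<beta>)"
  have "(\<integral>\<^sup>+z. F z \<partial>W) = (\<integral>\<^sup>+z. F z \<partial>distr (?m \<Otimes>\<^sub>M W) W (\<lambda>(a, \<omega>). case_nat a \<omega>))"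
    by (simp add: W.PiM_iter)
  also have "\<dots> = (\<integral>\<^sup>+(a, z). F (case_nat a z) \<partial>(?m \<Otimes>\<^sub>M W))"
    by (subst nn_integral_distr) (auto simp: split_beta')
  also have "\<dots> = (\<integral>\<^sup>+a. \<integral>\<^sup>+z. F (case_nat a z) \<partial>W \<partial>?m)"
    by (subst W.P.nn_integral_fst[symmetric]) auto
  finally show ?thesis by (simp add: nn_integral_step)
qed

lemma AE_unit_steps: "AE z in W. unit_steps z"
  unfolding unit_steps_def AE_all_countable
proof
  fix j
  show "AE z in W. z j = 1 \<or> z j = -1"
    by (rule AE_PiM_component) (auto simp: prob_space_measure_pmf AE_measure_pmf_iff step_pmf_def)
qed

lemma nn_integral_exp_pos: "(\<integral>\<^sup>+z. ennreal (\<gamma> powr (pos z k)) \<partial>W) = ennreal (\<rho> ^ k)"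
proof (induction k)
  case (Suc k)
  have "(\<integral>\<^sup>+z. ennreal (\<gamma> powr (pos z (Suc k))) \<partial>W) =
    ennreal (1 / (\<beta> + 1)) * (\<integral>\<^sup>+z. ennreal (\<gamma> powr (-1)) * ennreal (\<gamma> powr (pos z k)) \<partial>W) +
    ennreal (\<beta> / (\<beta> + 1)) * (\<integral>\<^sup>+z. ennreal \<gamma> * ennreal (\<gamma> powr (pos z k)) \<partial>W)"
  proof -
    have "ennreal (\<gamma> powr (a + pos z k)) = ennreal (\<gamma> powr a) * ennreal (\<gamma> powr (pos z k))" for a z
      by (simp add: powr_add ennreal_mult)
    from this[of "-1"] this[of 1] show ?thesis
      using gamma by (subst nn_integral_first_step) (simp_all add: pos_case_nat)
  qed
  also have "\<dots> = ennreal ((1 / (\<beta> + 1) * \<gamma> powr (-1) + \<beta> / (\<beta> + 1) * \<gamma>) * \<rho> ^ k)"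
  proof -
    have "(\<integral>\<^sup>+z. ennreal c * ennreal (\<gamma> powr (pos z k)) \<partial>W) = ennreal c * ennreal (\<rho> ^ k)" for c
      by (simp only: Suc[symmetric]) (rule nn_integral_cmult, measurable)
    note eq = this[of "\<gamma> powr (-1)"] this[of \<gamma>]
    show ?thesis
      unfolding eq
      using gamma beta rho by (simp add: ennreal_mult[symmetric] ennreal_plus[symmetric] algebra_simps del: ennreal_plus)
  qed
  also have "1 / (\<beta> + 1) * \<gamma> powr (-1) + \<beta> / (\<beta> + 1) * \<gamma> = \<rho>"
  proof -
    have "\<beta> * \<gamma> = sqrt \<beta>" "\<gamma> powr (-1) = sqrt \<beta>"
      using beta unfolding \<gamma>_def by (simp_all add: real_div_sqrt powr_minus)
    then show ?thesis using beta unfolding \<rho>_def by (simp add: add_divide_distrib[symmetric])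
  qed
  finally show ?case by simp
qed (use gamma W.emeasure_space_1 in auto)

lemma emeasure_pos_le: "emeasure W {z \<in> space W. pos z k \<le> a} \<le> ennreal (\<gamma> powr (- a) * \<rho> ^ k)"
proof -
  have "emeasure W {z \<in> space W. pos z k \<le> a} = (\<integral>\<^sup>+z. indicator {z \<in> space W. pos z k \<le> a} z \<partial>W)"
    by (subst nn_integral_indicator) auto
  also have "\<dots> \<le> (\<integral>\<^sup>+z. ennreal (\<gamma> powr (- a)) * ennreal (\<gamma> powr (pos z k)) \<partial>W)"
  proof (rule nn_integral_mono)
    fix z
    have "1 \<le> \<gamma> powr (- a + pos z k)" if "pos z k \<le> a"
      using that gamma powr_mono'[of "- a + pos z k" 0 \<gamma>] by simp
    then show "indicator {z \<in> space W. pos z k \<le> a} z \<le> ennreal (\<gamma> powr (- a)) * ennreal (\<gamma> powr (pos z k))"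
      by (auto simp: indicator_def ennreal_mult[symmetric] powr_add[symmetric])
  qed
  also have "\<dots> = ennreal (\<gamma> powr (- a) * \<rho> ^ k)"
    using rho by (simp add: nn_integral_cmult nn_integral_exp_pos ennreal_mult)
  finally show ?thesis .
qed

text \<open>The walk exceeds every level by the exponential bound, and it cannot jump over \<open>n\<close>.\<close>

lemma AE_hits:
  assumes "0 \<le> n" shows "AE z in W. \<exists>k. pos z k = n"
proof -
  have "emeasure W {z \<in> space W. \<forall>k. pos z k \<le> n} \<le> ennreal (\<gamma> powr (- n) * \<rho> ^ k)" for k
    by (rule order_trans[OF emeasure_mono emeasure_pos_le]) auto
  moreover have "(\<lambda>k. ennreal (\<gamma> powr (- n) * \<rho> ^ k)) \<longlonglongrightarrow> ennreal (\<gamma> powr (- n) * 0)"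
    using rho by (intro tendsto_intros LIMSEQ_realpow_zero) auto
  ultimately have "emeasure W {z \<in> space W. \<forall>k. pos z k \<le> n} \<le> 0"
    by (intro LIMSEQ_le_const[where X="\<lambda>k. ennreal (\<gamma> powr (- n) * \<rho> ^ k)"]) auto
  then have "{z \<in> space W. \<forall>k. pos z k \<le> n} \<in> null_sets W" by (auto intro!: null_setsI)
  then have "AE z in W. z \<notin> {z \<in> space W. \<forall>k. pos z k \<le> n}" by (rule AE_not_in)
  then show ?thesis
    using AE_unit_steps AE_space
  proof eventually_elim
    case (elim z)
    then obtain k where "n < pos z k" by (auto simp: not_le)
    then show ?case using unit_steps_ivt[OF elim(2) assms, of k] by auto
  qed
qed

lemma AE_good:
  "AE z in W. unit_steps z \<and> (\<forall>n::nat. \<exists>k. pos z k = int n)"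
  using AE_unit_steps AE_hits by (auto simp: AE_all_countable)

lemma measurable_comb_passage [measurable]:
  "(\<lambda>(z, z'). comb_seq (passage z n) z z') \<in> W \<Otimes>\<^sub>M W \<rightarrow>\<^sub>M W"
proof -
  have "(\<lambda>p. comb_seq (passage (fst p) n) (fst p) (snd p)) \<in> W \<Otimes>\<^sub>M W \<rightarrow>\<^sub>M W"
  proof (rule measurable_compose_countable[where f="\<lambda>a p. comb_seq a (fst p) (snd p)"])
    show "(\<lambda>x. passage (fst x) n) \<in> W \<Otimes>\<^sub>M W \<rightarrow>\<^sub>M count_space UNIV"
      by (rule measurable_compose[OF measurable_fst measurable_passage])
  qed measurable
  then show ?thesis by (simp add: split_beta')
qed

lemma nn_integral_comb_seq:
  assumes [measurable]: "F \<in> borel_measurable W"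
  shows "(\<integral>\<^sup>+z. F z \<partial>W) = (\<integral>\<^sup>+z. \<integral>\<^sup>+z'. F (comb_seq a z z') \<partial>W \<partial>W)"
proof -
  have "(\<integral>\<^sup>+z. F z \<partial>W) = (\<integral>\<^sup>+z. F z \<partial>distr (W \<Otimes>\<^sub>M W) W (\<lambda>(z, z'). comb_seq a z z'))"
    by (simp add: W.PiM_comb_seq)
  also have "\<dots> = (\<integral>\<^sup>+(z, z'). F (comb_seq a z z') \<partial>(W \<Otimes>\<^sub>M W))"
    by (subst nn_integral_distr) (auto simp: split_beta')
  also have "\<dots> = (\<integral>\<^sup>+z. \<integral>\<^sup>+z'. F (comb_seq a z z') \<partial>W \<partial>W)"
    by (subst W.P.nn_integral_fst[symmetric]) auto
  finally show ?thesis .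
qed

text \<open>The strong Markov property at the first passage through \<open>n\<close>: replacing all increments after that
  time by an independent copy does not change the law. On the event that the passage happens at time
  \<open>a\<close>, this is the same statement for the fixed time \<open>a\<close>, since the event depends on
  the first \<open>a\<close> increments only.\<close>

lemma nn_integral_strong_markov:
  assumes F[measurable]: "F \<in> borel_measurable W" and n: "0 \<le> n"
  shows "(\<integral>\<^sup>+z. F z \<partial>W) = (\<integral>\<^sup>+z. \<integral>\<^sup>+z'. F (comb_seq (passage z n) z z') \<partial>W \<partial>W)"
proof -
  let ?I = "\<lambda>a z. indicator {z. hits_at z n a} z :: ennreal"
  have one: "(\<Sum>a. ?I a z) = 1" if "\<exists>k. pos z k = n" for z
  proof -
    have "?I a z = (if passage z n = a then 1 else 0)" for a
      using hits_at_iff[OF that, of a] by (auto simp: indicator_def)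
    then have "(\<Sum>a. ?I a z) = (\<Sum>a\<in>{passage z n}. ?I a z)"
      by (intro suminf_finite) auto
    then show ?thesis using hits_at_iff[OF that, of "passage z n"] by simp
  qed
  have [measurable]: "?I a \<in> borel_measurable W" for a by measurable
  let ?c = "\<lambda>z. \<integral>\<^sup>+z'. F (comb_seq (passage z n) z z') \<partial>W"
  have [measurable]: "(\<lambda>(z, z'). F (comb_seq (passage z n) z z')) \<in> borel_measurable (W \<Otimes>\<^sub>M W)"
    using measurable_compose[OF measurable_comb_passage F] by (simp add: split_beta')
  have "(\<integral>\<^sup>+z. F z \<partial>W) = (\<integral>\<^sup>+z. (\<Sum>a. F z * ?I a z) \<partial>W)"
    by (rule nn_integral_cong_AE) (use AE_hits[OF n] in eventually_elim, simp add: one)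
  also have "\<dots> = (\<Sum>a. \<integral>\<^sup>+z. F z * ?I a z \<partial>W)"
    by (rule nn_integral_suminf) measurable
  also have "\<dots> = (\<Sum>a. \<integral>\<^sup>+z. ?c z * ?I a z \<partial>W)"
  proof (rule suminf_cong)
    fix a
    have hits: "hits_at (comb_seq a z z') n a = hits_at z n a" for z z'
      unfolding hits_at_def by (simp add: pos_comb_seq_le)
    have "(\<integral>\<^sup>+z. F z * ?I a z \<partial>W) =
      (\<integral>\<^sup>+z. \<integral>\<^sup>+z'. F (comb_seq a z z') * ?I a (comb_seq a z z') \<partial>W \<partial>W)"
      by (rule nn_integral_comb_seq) measurable
    also have "\<dots> = (\<integral>\<^sup>+z. \<integral>\<^sup>+z'. F (comb_seq (passage z n) z z') * ?I a z \<partial>W \<partial>W)"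
      by (intro nn_integral_cong) (auto simp: indicator_def hits dest: hits_at_passage)
    also have "\<dots> = (\<integral>\<^sup>+z. ?c z * ?I a z \<partial>W)"
    proof (intro nn_integral_cong nn_integral_multc)
      fix z assume "z \<in> space W"
      have "(\<lambda>z'. comb_seq (passage z n) z z') \<in> W \<rightarrow>\<^sub>M W"
        using \<open>z \<in> space W\<close> by (intro measurable_comb_seq') auto
      then show "(\<lambda>z'. F (comb_seq (passage z n) z z')) \<in> borel_measurable W"
        by (rule measurable_compose) (simp_all add: F)
    qed
    finally show "(\<integral>\<^sup>+z. F z * ?I a z \<partial>W) = (\<integral>\<^sup>+z. ?c z * ?I a z \<partial>W)" .
  qed
  also have "\<dots> = (\<integral>\<^sup>+z. (\<Sum>a. ?c z * ?I a z) \<partial>W)"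
    by (rule nn_integral_suminf[symmetric]) measurable
  also have "\<dots> = (\<integral>\<^sup>+z. ?c z \<partial>W)"
    by (rule nn_integral_cong_AE) (use AE_hits[OF n] in eventually_elim, simp add: one)
  finally show ?thesis .
qed

lemma strong_markov:
  assumes n: "0 \<le> n"
  shows "distr (W \<Otimes>\<^sub>M W) W (\<lambda>(z, z'). comb_seq (passage z n) z z') = W"
proof (rule measure_eqI)
  fix A assume "A \<in> sets (distr (W \<Otimes>\<^sub>M W) W (\<lambda>(z, z'). comb_seq (passage z n) z z'))"
  then have A: "A \<in> sets W" by simp
  have "emeasure W A = (\<integral>\<^sup>+z. \<integral>\<^sup>+z'. indicator A (comb_seq (passage z n) z z') \<partial>W \<partial>W)"
    using A n by (subst nn_integral_indicator[symmetric, OF A], subst nn_integral_strong_markov[of _ n]) auto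
  also have "\<dots> = (\<integral>\<^sup>+p. indicator A (case p of (z, z') \<Rightarrow> comb_seq (passage z n) z z') \<partial>(W \<Otimes>\<^sub>M W))"
    using measurable_compose[OF measurable_comb_passage borel_measurable_indicator[OF A]]
    by (subst W.P.nn_integral_fst[symmetric]) (auto simp: split_beta')
  also have "\<dots> = emeasure (distr (W \<Otimes>\<^sub>M W) W (\<lambda>(z, z'). comb_seq (passage z n) z z')) A"
    using A nn_integral_distr[OF measurable_comb_passage[of n], of "indicator A"]
    by (simp add: nn_integral_indicator)
  finally show "emeasure (distr (W \<Otimes>\<^sub>M W) W (\<lambda>(z, z'). comb_seq (passage z n) z z')) A = emeasure W A" ..
qed simp

text \<open>Before its first passage through 1 the walk is at or below 0, an event of exponentially small probability. The
  square \<open>m\<^sup>2\<close> is summed by parts, as \<open>\<Sum>k<m. 2 k + 1\<close>.\<close>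

lemma nn_integral_passage_squared: "(\<integral>\<^sup>+z. ennreal ((real (passage z 1))\<^sup>2) \<partial>W) < \<infinity>"
proof -
  have sq: "(real m)\<^sup>2 = (\<Sum>k<m. 2 * real k + 1)" for m
    by (induction m) (auto simp: power2_eq_square algebra_simps)
  let ?I = "\<lambda>k z. ennreal (2 * real (Suc k)) * indicator {z \<in> space W. pos z k \<le> 0} z"
  have "(\<integral>\<^sup>+z. ennreal ((real (passage z 1))\<^sup>2) \<partial>W) \<le> (\<integral>\<^sup>+z. (\<Sum>k. ?I k z) \<partial>W)"
  proof (rule nn_integral_mono_AE)
    show "AE z in W. ennreal ((real (passage z 1))\<^sup>2) \<le> (\<Sum>k. ?I k z)"
      using AE_unit_steps AE_space
    proof eventually_elim
      case (elim z)
      have "ennreal ((real (passage z 1))\<^sup>2) = (\<Sum>k<passage z 1. ennreal (2 * real k + 1))"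
        unfolding sq by (rule sum_ennreal[symmetric]) simp
      also have "\<dots> \<le> (\<Sum>k<passage z 1. ?I k z)"
      proof (rule sum_mono)
        fix k assume "k \<in> {..<passage z 1}"
        then have "pos z k \<le> 0" using pos_before_passage[OF elim(1), of 1 k] by simp
        then show "ennreal (2 * real k + 1) \<le> ?I k z"
          using elim by (simp add: indicator_def ennreal_leI del: ennreal_plus)
      qed
      also have "\<dots> \<le> (\<Sum>k. ?I k z)" by (rule sum_le_suminf) auto
      finally show ?case .
    qed
  qed
  also have "\<dots> = (\<Sum>k. \<integral>\<^sup>+z. ?I k z \<partial>W)"
    by (rule nn_integral_suminf) measurable
  also have "\<dots> \<le> (\<Sum>k. ennreal (2 * (real (Suc k) * \<rho> ^ k)))"
  proof (intro suminf_le)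
    fix k
    have "(\<integral>\<^sup>+z. ?I k z \<partial>W) = ennreal (2 * real (Suc k)) * emeasure W {z \<in> space W. pos z k \<le> 0}"
      by (subst nn_integral_cmult_indicator) auto
    also have "\<dots> \<le> ennreal (2 * real (Suc k)) * ennreal (\<gamma> powr (- real_of_int 0) * \<rho> ^ k)"
      using emeasure_pos_le[of k 0] by (intro mult_left_mono) auto
    also have "\<dots> = ennreal (2 * (real (Suc k) * \<rho> ^ k))"
      using rho gamma by (simp add: ennreal_mult[symmetric] del: of_nat_Suc)
    finally show "(\<integral>\<^sup>+z. ?I k z \<partial>W) \<le> ennreal (2 * (real (Suc k) * \<rho> ^ k))" .
  qed auto
  also have "\<dots> < \<infinity>"
  proof -
    have "summable (\<lambda>k. 2 * (real (Suc k) * \<rho> ^ k))"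
      using rho by (intro summable_mult sums_summable[OF geometric_deriv_sums]) auto
    then have "(\<Sum>k. ennreal (2 * (real (Suc k) * \<rho> ^ k))) \<noteq> \<infinity>"
      using rho by (subst suminf_ennreal2) (auto simp del: of_nat_Suc)
    then show ?thesis by (simp add: less_top)
  qed
  finally show ?thesis .
qed

text \<open>A union bound over time; the exact value \<open>\<beta> powr (- r)\<close> is replaced by a weaker geometric
  rate.\<close>

lemma prob_ever_below:
  "W.prob {z \<in> space W. \<exists>k. pos z k \<le> - int r} \<le> \<gamma> ^ r / (1 - \<rho>)"
proof -
  have sums: "(\<lambda>k. \<gamma> ^ r * \<rho> ^ k) sums (\<gamma> ^ r * (1 / (1 - \<rho>)))"
    using rho by (intro sums_mult geometric_sums) auto
  have "emeasure W {z \<in> space W. \<exists>k. pos z k \<le> - int r} = emeasure W (\<Union>k. {z \<in> space W. pos z k \<le> - int r})"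
    by (intro arg_cong2[where f=emeasure]) auto
  also have "\<dots> \<le> (\<Sum>k. emeasure W {z \<in> space W. pos z k \<le> - int r})"
    by (rule emeasure_subadditive_countably) auto
  also have "\<dots> \<le> (\<Sum>k. ennreal (\<gamma> ^ r * \<rho> ^ k))"
    using emeasure_pos_le[of _ "- int r"] gamma by (intro suminf_le) (auto simp: powr_realpow)
  also have "\<dots> = ennreal (\<gamma> ^ r * (1 / (1 - \<rho>)))"
    using sums gamma rho by (subst suminf_ennreal2) (auto simp: sums_iff)
  finally show ?thesis
    using gamma rho by (simp add: W.emeasure_eq_measure)
qed

end

section \<open>Measurability of the path functionals\<close>

abbreviation sample_space :: "sample measure" where
  "sample_space \<equiv> (\<Pi>\<^sub>M j\<in>UNIV. count_space UNIV) \<Otimes>\<^sub>M (\<Pi>\<^sub>M p\<in>UNIV. pos_borel)"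

definition steps :: "sample \<Rightarrow> nat \<Rightarrow> int" where
  "steps s = (\<lambda>j. fst s (Suc j))"

lemma walk_eq_pos: "walk s k = pos (steps s) k"
  unfolding walk_def pos_def steps_def by (simp add: sum.atLeast1_atMost_eq)

lemma walk_0 [simp]: "walk s 0 = 0"
  by (simp add: walk_def)

lemma walk_Suc: "walk s (Suc k) = walk s k + fst s (Suc k)"
  by (simp add: walk_def)

lemma local_time_Suc: "local_time s x (Suc n) = local_time s x n + of_bool (walk s (Suc n) = x)"
  by (simp add: local_time_def)

lemma measurable_step [measurable]: "(\<lambda>s. fst s j) \<in> sample_space \<rightarrow>\<^sub>M count_space UNIV"
  by (rule measurable_compose[OF measurable_fst measurable_component_singleton]) simp

lemma measurable_walk [measurable]: "(\<lambda>s. walk s k) \<in> sample_space \<rightarrow>\<^sub>M count_space UNIV"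
proof (induction k)
  case (Suc k)
  have "(\<lambda>s. walk s k + i) \<in> sample_space \<rightarrow>\<^sub>M count_space UNIV" for i
    by (rule measurable_compose[OF Suc]) simp
  then show ?case unfolding walk_Suc
    by (rule measurable_compose_countable[where f="\<lambda>i s. walk s k + i"]) (rule measurable_step)
qed simp

lemma measurable_local_time [measurable]:
  "(\<lambda>s. local_time s x n) \<in> sample_space \<rightarrow>\<^sub>M count_space UNIV"
proof (induction n)
  case 0
  have "(\<lambda>s. of_bool (walk s 0 = x)) \<in> sample_space \<rightarrow>\<^sub>M (count_space UNIV :: nat measure)"
    by (rule measurable_compose[OF measurable_walk]) simp
  then show ?case by (simp add: local_time_def)
next
  case (Suc n)
  have "(\<lambda>s. i + of_bool (walk s (Suc n) = x)) \<in> sample_space \<rightarrow>\<^sub>M (count_space UNIV :: nat measure)" for i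
    by (rule measurable_compose[OF measurable_walk]) simp
  then show ?case unfolding local_time_Suc
    by (rule measurable_compose_countable[where f="\<lambda>i s. i + of_bool (walk s (Suc n) = x)"]) (rule Suc)
qed

lemma measurable_coord_pos_borel:
  "(\<lambda>h. h p) \<in> (\<Pi>\<^sub>M p\<in>UNIV. pos_borel) \<rightarrow>\<^sub>M borel"
  by (rule measurable_compose[OF measurable_component_singleton])
    (auto intro: measurable_restrict_space1)

lemma measurable_site_time [measurable]: "(\<lambda>s. site_time x i s) \<in> borel_measurable sample_space"
  unfolding site_time_def by (rule measurable_compose[OF measurable_snd measurable_coord_pos_borel])

lemma measurable_holding_time [measurable]: "(\<lambda>s. holding_time k s) \<in> borel_measurable sample_space"
  unfolding holding_time_def
proof (rule measurable_compose_countable[where f="\<lambda>x s. site_time x (local_time s x k) s"])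
  show "(\<lambda>s. site_time x (local_time s x k) s) \<in> borel_measurable sample_space" for x
    by (rule measurable_compose_countable[where f="\<lambda>i s. site_time x i s"]) measurable
qed measurable

lemma measurable_clock [measurable]: "(\<lambda>s. clock s n) \<in> borel_measurable sample_space"
  unfolding clock_def by measurable

lemma measurable_clock_inv [measurable]: "(\<lambda>s. clock_inv s t) \<in> sample_space \<rightarrow>\<^sub>M count_space UNIV"
  unfolding clock_inv_def by measurable

lemma measurable_trapped_walk [measurable]:
  "(\<lambda>s. trapped_walk s t) \<in> sample_space \<rightarrow>\<^sub>M count_space UNIV"
  unfolding trapped_walk_def
  by (rule measurable_compose_countable[where f="\<lambda>i s. walk s i"]) measurable

lemma sample_pos: "s \<in> space sample_space \<Longrightarrow> 0 < snd s p"
  by (auto simp: space_pair_measure space_PiM PiE_iff space_restrict_space)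

lemma holding_time_pos: "(\<And>p. 0 < snd s p) \<Longrightarrow> 0 < holding_time k s"
  by (simp add: holding_time_def site_time_def)

lemma strict_mono_clock: "(\<And>p. 0 < snd s p) \<Longrightarrow> strict_mono (clock s)"
  by (intro strict_monoI_Suc) (simp add: clock_def holding_time_pos)

lemma clock_less_iff: "(\<And>p. 0 < snd s p) \<Longrightarrow> clock s j < clock s k \<longleftrightarrow> j < k"
  and clock_le_iff: "(\<And>p. 0 < snd s p) \<Longrightarrow> clock s j \<le> clock s k \<longleftrightarrow> j \<le> k"
  using strict_mono_less[OF strict_mono_clock] strict_mono_less_eq[OF strict_mono_clock] by blast+

lemma clock_inv_bounds:
  assumes pos: "\<And>p. 0 < snd s p" and t: "0 \<le> t" "t < clock s T"
  shows "clock_inv s t < T" "clock s (clock_inv s t) \<le> t" "t < clock s (Suc (clock_inv s t))"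
proof -
  let ?A = "{k. clock s k \<le> t}"
  have sub: "?A \<subseteq> {..<T}"
    using clock_le_iff[OF pos, of T] t by (force simp: not_less[symmetric])
  have fin: "finite ?A" by (rule finite_subset[OF sub]) simp
  have "0 \<in> ?A" using t by (simp add: clock_def)
  then have mem: "Max ?A \<in> ?A" using fin by (intro Max_in) auto
  then show "clock s (clock_inv s t) \<le> t" "clock_inv s t < T"
    using sub unfolding clock_inv_def by auto
  show "t < clock s (Suc (clock_inv s t))"
    using Max_ge[OF fin, of "Suc (clock_inv s t)"] unfolding clock_inv_def by (force simp: not_le[symmetric])
qed

text \<open>With positive holding times the clock is strictly increasing, so the level is hit at the value of the clock at
  the first passage, even if the clock is bounded and \<^const>\<open>trapped_walk\<close> takes arbitrary
  values later. Thus the formula holds wherever the level is hit, and not just almost surely.\<close>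

lemma hitting_time_eq:
  assumes pos: "\<And>p. 0 < snd s p" and hit: "\<exists>k. walk s k = n"
  shows "hitting_time n s = clock s (LEAST k. walk s k = n)"
proof -
  define T where "T = (LEAST k. walk s k = n)"
  have T: "walk s T = n" unfolding T_def using hit by (rule LeastI_ex)
  have "clock s 0 \<le> clock s T" by (simp add: clock_le_iff[OF pos])
  then have T0: "0 \<le> clock s T" by (simp add: clock_def)
  have "{k. clock s k \<le> clock s T} = {..T}" using clock_le_iff[OF pos] by auto
  then have "clock_inv s (clock s T) = T" unfolding clock_inv_def by (simp add: Max_eq_iff)
  then have "clock s T \<in> {t. 0 \<le> t \<and> trapped_walk s t = n}"
    using T T0 by (simp add: trapped_walk_def)
  moreover have "clock s T \<le> t" if "t \<in> {t. 0 \<le> t \<and> trapped_walk s t = n}" for t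
  proof (rule ccontr)
    assume "\<not> clock s T \<le> t"
    with that have "clock_inv s t < T" by (intro clock_inv_bounds[OF pos]) auto
    then have "walk s (clock_inv s t) \<noteq> n" unfolding T_def by (rule not_less_Least)
    then show False using that by (simp add: trapped_walk_def)
  qed
  ultimately show ?thesis unfolding hitting_time_def T_def[symmetric] by (rule cInf_eq_minimum)
qed

lemma hitting_time_never: "\<nexists>k. walk s k = n \<Longrightarrow> hitting_time n s = Inf {}"
  unfolding hitting_time_def trapped_walk_def by (rule arg_cong[where f=Inf]) auto

text \<open>Measurability is required with respect to the product \<open>\<sigma>\<close>-algebra, which is not complete; a
  description up to null sets would not do.\<close>

lemma measurable_hitting_time [measurable]: "hitting_time n \<in> borel_measurable sample_space"
proof -
  have "(\<lambda>s. if \<exists>k. walk s k = n then clock s (LEAST k. walk s k = n) else Inf {}) \<in> borel_measurable sample_space"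
  proof (rule measurable_If)
    show "(\<lambda>s. clock s (LEAST k. walk s k = n)) \<in> borel_measurable sample_space"
      by (rule measurable_compose_countable[where f="\<lambda>i s. clock s i"]) measurable
  qed measurable
  then show ?thesis
    by (rule measurable_cong[THEN iffD1, rotated])
      (auto simp: hitting_time_eq hitting_time_never sample_pos)
qed

section \<open>Holding times along a path in a fixed environment\<close>

text \<open>The index (site, number of visits so far) of the \<open>k\<close>-th holding time, as a function of the
  increments \<open>c\<close> alone.\<close>

definition idx :: "(nat \<Rightarrow> int) \<Rightarrow> nat \<Rightarrow> int \<times> nat" where
  "idx c k = (let s = (c, undefined) in (walk s k, local_time s (walk s k) k))"

lemma holding_time_idx: "holding_time k (c, h) = h (idx c k)"
  by (simp add: holding_time_def site_time_def idx_def Let_def walk_def local_time_def)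

lemma fst_idx: "fst (idx c k) = walk (c, h) k"
  by (simp add: idx_def Let_def walk_def)

text \<open>Every return to a site increases its local time. So the holding times along a fixed path are read off at
  distinct indices and are independent.\<close>

lemma inj_idx: "inj (idx c)"
proof (rule linorder_injI)
  fix j k :: nat assume "j < k"
  show "idx c j \<noteq> idx c k"
  proof
    assume eq: "idx c j = idx c k"
    let ?s = "(c, undefined) :: sample"
    let ?x = "walk ?s k"
    have x: "walk ?s j = ?x" "local_time ?s ?x j = local_time ?s ?x k"
      using eq by (auto simp: idx_def Let_def)
    have "local_time ?s ?x j < local_time ?s ?x j + 1" by simp
    also have "\<dots> \<le> local_time ?s ?x (k - 1) + 1"
      using \<open>j < k\<close> unfolding local_time_def by (intro add_right_mono sum_mono2) auto
    also have "\<dots> = local_time ?s ?x k"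
      using \<open>j < k\<close> local_time_Suc[of ?s ?x "k - 1"] by simp
    finally show False using x by simp
  qed
qed

locale trap_environment = biased_walk +
  fixes \<omega> :: environment
  assumes prob_site: "prob_space (\<omega> x)" and sets_site [measurable_cong]: "sets (\<omega> x) = sets pos_borel"
begin

abbreviation H :: "(int \<times> nat \<Rightarrow> real) measure" where
  "H \<equiv> \<Pi>\<^sub>M p\<in>UNIV. \<omega> (fst p)"

abbreviation Q :: "sample measure" where
  "Q \<equiv> quenched \<beta> \<omega>"

lemma Q_eq: "Q = W \<Otimes>\<^sub>M H"
  by (simp add: quenched_def)

sublocale H: product_prob_space "\<lambda>p :: int \<times> nat. \<omega> (fst p)" UNIV
  by (intro product_prob_spaceI prob_site)

sublocale WH: pair_prob_space W H ..

lemma prob_Q: "prob_space Q"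
  unfolding Q_eq by (rule WH.prob_space_axioms)

sublocale Q: prob_space Q by (rule prob_Q)

lemma sets_Q [measurable_cong]: "sets Q = sets sample_space"
proof -
  have "sets W = sets (\<Pi>\<^sub>M j\<in>UNIV. count_space UNIV)" by (intro sets_PiM_cong) auto
  moreover have "sets H = sets (\<Pi>\<^sub>M p\<in>UNIV. pos_borel)" by (intro sets_PiM_cong refl sets_site)
  ultimately show ?thesis unfolding Q_eq by (rule sets_pair_measure_cong)
qed

lemma space_Q: "space Q = space sample_space"
  by (rule sets_eq_imp_space_eq[OF sets_Q])

lemma space_site: "space (\<omega> x) = {0<..}"
  using sets_eq_imp_space_eq[OF sets_site, of x] by (simp add: space_restrict_space)

lemma borel_site: "f \<in> borel_measurable borel \<Longrightarrow> f \<in> borel_measurable (\<omega> x)"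
  by (subst measurable_cong_sets[OF sets_site refl]) (rule measurable_restrict_space1)

lemma distr_steps: "distr W W (\<lambda>c j. c (Suc j)) = W"
proof -
  have "distr W W (\<lambda>c. \<lambda>n\<in>UNIV. c (Suc n)) = W"
    by (rule distr_PiM_reindex[where f=Suc and M="\<lambda>_. measure_pmf (step_pmf \<beta>)"])
      (auto simp: prob_space_measure_pmf)
  moreover have "(\<lambda>c. \<lambda>n\<in>UNIV. c (Suc n)) = (\<lambda>(c :: nat \<Rightarrow> int) j. c (Suc j))"
    by (simp add: fun_eq_iff)
  ultimately show ?thesis by metis
qed

lemma measurable_steps_fst [measurable]: "(\<lambda>c j. c (Suc j)) \<in> W \<rightarrow>\<^sub>M W"
  by (rule measurable_PiM_single') (auto simp: space_PiM)

lemma measurable_steps [measurable]: "steps \<in> Q \<rightarrow>\<^sub>M W"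
  unfolding steps_def[abs_def] Q_eq by measurable

lemma AE_steps: "AE z in W. R z \<Longrightarrow> AE s in Q. R (steps s)"
proof -
  assume R: "AE z in W. R z"
  have "AE c in W. R (\<lambda>j. c (Suc j))"
    by (rule AE_distrD[OF measurable_steps_fst, where P=R], unfold distr_steps, rule R)
  then have "AE c in distr (W \<Otimes>\<^sub>M H) W fst. R (\<lambda>j. c (Suc j))"
    by (subst H.P.distr_pair_fst)
  then show ?thesis unfolding Q_eq steps_def by (rule AE_distrD[OF measurable_fst, where P="\<lambda>c. R (\<lambda>j. c (Suc j))"])
qed

lemma AE_hitting_time:
  "AE s in Q. \<forall>n::nat. hitting_time (int n) s = clock s (passage (steps s) (int n))"
  using AE_steps[OF AE_good] AE_space
proof eventually_elim
  case (elim s)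
  then show ?case
    using hitting_time_eq[of s] sample_pos[of s] unfolding space_Q by (simp add: walk_eq_pos passage_def)
qed

lemma measurable_Q: "Q \<rightarrow>\<^sub>M N = sample_space \<rightarrow>\<^sub>M N"
  by (rule measurable_cong_sets[OF sets_Q refl])

lemma nn_integral_Q:
  assumes F: "F \<in> borel_measurable sample_space"
  shows "(\<integral>\<^sup>+s. F s \<partial>Q) = (\<integral>\<^sup>+c. \<integral>\<^sup>+h. F (c, h) \<partial>H \<partial>W)"
proof -
  have "F \<in> borel_measurable (W \<Otimes>\<^sub>M H)"
    using F unfolding measurable_Q[symmetric] Q_eq .
  from H.P.nn_integral_fst[OF this] show ?thesis unfolding Q_eq by (rule sym)
qed

lemma measurable_H_coord [measurable]: "(\<lambda>h. h p) \<in> borel_measurable H"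
proof -
  have "(\<lambda>h. h p) \<in> H \<rightarrow>\<^sub>M \<omega> (fst p)" by (rule measurable_component_singleton) simp
  moreover have "(\<lambda>x. x) \<in> borel_measurable (\<omega> (fst p))" by (rule borel_site) simp
  ultimately show ?thesis by (rule measurable_compose)
qed

lemma nn_integral_H_coord:
  assumes f: "f \<in> borel_measurable borel"
  shows "(\<integral>\<^sup>+h. f (h p) \<partial>H) = (\<integral>\<^sup>+x. f x \<partial>\<omega> (fst p))"
proof -
  have "(\<integral>\<^sup>+x. f x \<partial>\<omega> (fst p)) = (\<integral>\<^sup>+x. f x \<partial>distr H (\<omega> (fst p)) (\<lambda>h. h p))"
    by (simp add: H.PiM_component)
  also have "\<dots> = (\<integral>\<^sup>+h. f (h p) \<partial>H)"
    by (rule nn_integral_distr) (simp_all add: borel_site f)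
  finally show ?thesis ..
qed

lemma nn_integral_steps:
  assumes "F \<in> borel_measurable W"
  shows "(\<integral>\<^sup>+c. F (\<lambda>j. c (Suc j)) \<partial>W) = (\<integral>\<^sup>+z. F z \<partial>W)"
  using nn_integral_distr[OF measurable_steps_fst, of F] assms unfolding distr_steps by presburger

abbreviation mom1 :: "int \<Rightarrow> ennreal" where
  "mom1 x \<equiv> \<integral>\<^sup>+h. ennreal h \<partial>\<omega> x"

abbreviation mom2 :: "int \<Rightarrow> ennreal" where
  "mom2 x \<equiv> \<integral>\<^sup>+h. ennreal (h\<^sup>2) \<partial>\<omega> x"

definition sum_along :: "(int \<Rightarrow> ennreal) \<Rightarrow> (nat \<Rightarrow> int) \<Rightarrow> int \<Rightarrow> ennreal" where
  "sum_along f z n = (\<Sum>k<passage z n. f (pos z k))"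

lemma measurable_sum_along [measurable]: "(\<lambda>z. sum_along f z n) \<in> borel_measurable W"
proof -
  have f: "(\<lambda>z. f (pos z k)) \<in> borel_measurable W" for k
    by (rule measurable_compose[OF measurable_pos]) simp
  show ?thesis unfolding sum_along_def
    by (rule measurable_compose_countable[where f="\<lambda>i z. \<Sum>k<i. f (pos z k)"])
      (rule borel_measurable_sum, rule f, rule measurable_passage)
qed

lemma nn_integral_hitting_time_eq:
  "(\<integral>\<^sup>+s. ennreal (hitting_time (int n) s) \<partial>Q) = (\<integral>\<^sup>+z. sum_along mom1 z (int n) \<partial>W)"
proof -
  let ?T = "\<lambda>c. passage (\<lambda>j. c (Suc j)) (int n)"
  have "(\<integral>\<^sup>+s. ennreal (hitting_time (int n) s) \<partial>Q) = (\<integral>\<^sup>+s. ennreal (clock s (passage (steps s) (int n))) \<partial>Q)"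
    by (rule nn_integral_cong_AE) (use AE_hitting_time in eventually_elim, simp)
  also have "\<dots> = (\<integral>\<^sup>+s. (\<Sum>k<passage (steps s) (int n). ennreal (holding_time k s)) \<partial>Q)"
    unfolding clock_def
    by (intro nn_integral_cong sum_ennreal[symmetric] less_imp_le[OF holding_time_pos] sample_pos) (simp add: space_Q)
  also have "\<dots> = (\<integral>\<^sup>+c. \<integral>\<^sup>+h. (\<Sum>k<?T c. ennreal (h (idx c k))) \<partial>H \<partial>W)"
  proof (subst nn_integral_Q)
    have "(\<lambda>s. passage (steps s) (int n)) \<in> sample_space \<rightarrow>\<^sub>M count_space UNIV"
      using measurable_compose[OF measurable_steps measurable_passage[of "int n"]] unfolding measurable_Q .
    then show "(\<lambda>s. \<Sum>k<passage (steps s) (int n). ennreal (holding_time k s)) \<in> borel_measurable sample_space"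
      by (rule measurable_compose_countable[where f="\<lambda>i s. \<Sum>k<i. ennreal (holding_time k s)", rotated]) measurable
  qed (simp add: holding_time_idx steps_def)
  also have "\<dots> = (\<integral>\<^sup>+c. sum_along mom1 (\<lambda>j. c (Suc j)) (int n) \<partial>W)"
  proof (intro nn_integral_cong)
    fix c
    have "(\<integral>\<^sup>+h. (\<Sum>k<?T c. ennreal (h (idx c k))) \<partial>H) = (\<Sum>k<?T c. \<integral>\<^sup>+h. ennreal (h (idx c k)) \<partial>H)"
      by (rule nn_integral_sum) measurable
    also have "\<dots> = sum_along mom1 (\<lambda>j. c (Suc j)) (int n)"
      unfolding sum_along_def
      by (intro sum.cong refl) (simp add: nn_integral_H_coord fst_idx[of c _ undefined] walk_eq_pos steps_def)
    finally show "(\<integral>\<^sup>+h. (\<Sum>k<?T c. ennreal (h (idx c k))) \<partial>H) = sum_along mom1 (\<lambda>j. c (Suc j)) (int n)" .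
  qed
  also have "\<dots> = (\<integral>\<^sup>+z. sum_along mom1 z (int n) \<partial>W)"
    by (rule nn_integral_steps) (rule measurable_sum_along)
  finally show ?thesis .
qed

text \<open>The Cauchy--Schwarz inequality separates the number of steps from the squares of the holding times.\<close>

lemma nn_integral_hitting_time_sq_le:
  "(\<integral>\<^sup>+s. ennreal ((hitting_time 1 s)\<^sup>2) \<partial>Q) \<le> (\<integral>\<^sup>+z. ennreal (passage z 1) * sum_along mom2 z 1 \<partial>W)"
proof -
  let ?T = "\<lambda>c. passage (\<lambda>j. c (Suc j)) 1"
  have "(\<integral>\<^sup>+s. ennreal ((hitting_time 1 s)\<^sup>2) \<partial>Q) = (\<integral>\<^sup>+s. ennreal ((clock s (passage (steps s) 1))\<^sup>2) \<partial>Q)"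
  proof (rule nn_integral_cong_AE)
    show "AE s in Q. ennreal ((hitting_time 1 s)\<^sup>2) = ennreal ((clock s (passage (steps s) 1))\<^sup>2)"
      using AE_hitting_time
    proof eventually_elim
      case (elim s)
      from elim[rule_format, of 1] show ?case by simp
    qed
  qed
  also have "\<dots> \<le> (\<integral>\<^sup>+s. (\<Sum>k<passage (steps s) 1. ennreal (passage (steps s) 1) * ennreal ((holding_time k s)\<^sup>2)) \<partial>Q)"
  proof (rule nn_integral_mono)
    fix s
    let ?n = "passage (steps s) 1"
    have "(\<Sum>k<?n. 1 * holding_time k s)\<^sup>2 \<le> (\<Sum>k<?n. 1\<^sup>2) * (\<Sum>k<?n. (holding_time k s)\<^sup>2)"
      by (rule Cauchy_Schwarz_ineq_sum)
    then have "ennreal ((clock s ?n)\<^sup>2) \<le> ennreal (real ?n * (\<Sum>k<?n. (holding_time k s)\<^sup>2))"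
      by (intro ennreal_leI) (simp add: clock_def)
    also have "\<dots> = (\<Sum>k<?n. ennreal ?n * ennreal ((holding_time k s)\<^sup>2))"
      by (subst sum_distrib_left, subst sum_ennreal[symmetric]) (auto simp: ennreal_mult)
    finally show "ennreal ((clock s ?n)\<^sup>2) \<le> (\<Sum>k<?n. ennreal ?n * ennreal ((holding_time k s)\<^sup>2))" .
  qed
  also have "\<dots> = (\<integral>\<^sup>+c. \<integral>\<^sup>+h. (\<Sum>k<?T c. ennreal (?T c) * ennreal ((h (idx c k))\<^sup>2)) \<partial>H \<partial>W)"
  proof (subst nn_integral_Q)
    have "(\<lambda>s. passage (steps s) 1) \<in> sample_space \<rightarrow>\<^sub>M count_space UNIV"
      using measurable_compose[OF measurable_steps measurable_passage[of 1]] unfolding measurable_Q .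
    then show "(\<lambda>s. \<Sum>k<passage (steps s) 1. ennreal (passage (steps s) 1) * ennreal ((holding_time k s)\<^sup>2)) \<in> borel_measurable sample_space"
      by (rule measurable_compose_countable[where f="\<lambda>i s. \<Sum>k<i. ennreal (real i) * ennreal ((holding_time k s)\<^sup>2)", rotated]) measurable
  qed (simp add: holding_time_idx steps_def)
  also have "\<dots> = (\<integral>\<^sup>+c. ennreal (?T c) * sum_along mom2 (\<lambda>j. c (Suc j)) 1 \<partial>W)"
  proof (intro nn_integral_cong)
    fix c
    have "(\<integral>\<^sup>+h. (\<Sum>k<?T c. ennreal (?T c) * ennreal ((h (idx c k))\<^sup>2)) \<partial>H) =
       (\<Sum>k<?T c. ennreal (?T c) * (\<integral>\<^sup>+h. ennreal ((h (idx c k))\<^sup>2) \<partial>H))"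
      by (subst nn_integral_sum) (auto intro!: sum.cong nn_integral_cmult)
    also have "\<dots> = ennreal (?T c) * sum_along mom2 (\<lambda>j. c (Suc j)) 1"
      unfolding sum_along_def sum_distrib_left
      by (intro sum.cong refl arg_cong2[where f="(*)"])
        (simp add: nn_integral_H_coord[where f="\<lambda>x. ennreal (x\<^sup>2)"] fst_idx[of c _ undefined] walk_eq_pos steps_def)
    finally show "(\<integral>\<^sup>+h. (\<Sum>k<?T c. ennreal (?T c) * ennreal ((h (idx c k))\<^sup>2)) \<partial>H) =
      ennreal (?T c) * sum_along mom2 (\<lambda>j. c (Suc j)) 1" .
  qed
  also have "\<dots> = (\<integral>\<^sup>+z. ennreal (passage z 1) * sum_along mom2 z 1 \<partial>W)"
  proof (rule nn_integral_steps)
    have "(\<lambda>z. ennreal (passage z 1)) \<in> borel_measurable W"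
      by (rule measurable_compose[OF measurable_passage]) simp
    then show "(\<lambda>z. ennreal (passage z 1) * sum_along mom2 z 1) \<in> borel_measurable W"
      using measurable_sum_along[of mom2 1] by (rule borel_measurable_times_ennreal)
  qed
  finally show ?thesis .
qed

definition prod_along :: "(int \<Rightarrow> complex) \<Rightarrow> (nat \<Rightarrow> int) \<Rightarrow> int \<Rightarrow> complex" where
  "prod_along f z n = (\<Prod>k<passage z n. f (pos z k))"

lemma measurable_prod_along [measurable]: "(\<lambda>z. prod_along f z n) \<in> borel_measurable W"
proof -
  have f: "(\<lambda>z. f (pos z k)) \<in> borel_measurable W" for k
    by (rule measurable_compose[OF measurable_pos]) simp
  show ?thesis unfolding prod_along_def
    by (rule measurable_compose_countable[where f="\<lambda>i z. \<Prod>k<i. f (pos z k)"])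
      (rule borel_measurable_prod, rule f, rule measurable_passage)
qed

lemma norm_char_site: "norm (char (\<omega> x) u) \<le> 1"
proof -
  interpret prob_space "\<omega> x" by (rule prob_site)
  have "norm (char (\<omega> x) u) \<le> (\<integral>h. norm (iexp (u * h)) \<partial>\<omega> x)"
    unfolding char_def by (rule integral_norm_bound)
  also have "\<dots> = 1" by (simp add: prob_space)
  finally show ?thesis .
qed

text \<open>Given the path, the holding times are independent, so their sum has the product of their characteristic
  functions.\<close>

lemma char_hitting_time:
  "(\<integral>s. iexp (u * hitting_time (int n) s) \<partial>Q) = (\<integral>z. prod_along (\<lambda>x. char (\<omega> x) u) z (int n) \<partial>W)"
proof -
  let ?T = "\<lambda>c. passage (\<lambda>j. c (Suc j)) (int n)"
  have mT: "(\<lambda>s. passage (steps s) (int n)) \<in> Q \<rightarrow>\<^sub>M count_space UNIV"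
    using measurable_compose[OF measurable_steps measurable_passage[of "int n"]] .
  have mF: "(\<lambda>s. iexp (u * clock s (passage (steps s) (int n)))) \<in> borel_measurable Q"
    using mT by (rule measurable_compose_countable[where f="\<lambda>i s. iexp (u * clock s i)", rotated]) measurable
  have mT': "(\<lambda>s. passage (steps s) (int n)) \<in> W \<Otimes>\<^sub>M H \<rightarrow>\<^sub>M count_space UNIV"
    using mT by (simp add: Q_eq)
  have "(\<integral>s. iexp (u * hitting_time (int n) s) \<partial>Q) = (\<integral>s. iexp (u * clock s (passage (steps s) (int n))) \<partial>Q)"
    by (rule integral_cong_AE[OF _ mF]) (measurable, use AE_hitting_time in eventually_elim, simp)
  also have "\<dots> = (\<integral>c. \<integral>h. iexp (u * clock (c, h) (passage (steps (c, h)) (int n))) \<partial>H \<partial>W)"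
    unfolding Q_eq
    by (rule WH.integral_fst'[symmetric], rule WH.integrable_const_bound[where B=1])
      (use mF in \<open>auto simp: Q_eq\<close>)
  also have "\<dots> = (\<integral>c. prod_along (\<lambda>x. char (\<omega> x) u) (\<lambda>j. c (Suc j)) (int n) \<partial>W)"
  proof (rule Bochner_Integration.integral_cong[OF refl])
    fix c
    let ?J = "idx c ` {..<?T c}"
    have "(\<integral>h. iexp (u * clock (c, h) (passage (steps (c, h)) (int n))) \<partial>H) =
      (\<integral>h. (\<Prod>p\<in>?J. iexp (u * h p)) \<partial>H)"
    proof (rule Bochner_Integration.integral_cong[OF refl])
      fix h
      have "iexp (u * clock (c, h) (passage (steps (c, h)) (int n))) = (\<Prod>k<?T c. iexp (u * h (idx c k)))"
        by (simp add: clock_def holding_time_idx steps_def sum_distrib_left exp_sum)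
      also have "\<dots> = (\<Prod>p\<in>?J. iexp (u * h p))"
        by (subst prod.reindex) (auto intro: inj_on_subset[OF inj_idx])
      finally show "iexp (u * clock (c, h) (passage (steps (c, h)) (int n))) = (\<Prod>p\<in>?J. iexp (u * h p))" .
    qed
    also have "\<dots> = (\<Prod>p\<in>?J. char (\<omega> (fst p)) u)"
      unfolding char_def
    proof (rule H.integral_PiM_prod)
      fix p
      interpret prob_space "\<omega> (fst p)" by (rule prob_site)
      show "integrable (\<omega> (fst p)) (\<lambda>x. iexp (u * x))"
        by (rule integrable_const_bound[where B=1], simp, rule borel_site, measurable)
    qed simp_all
    also have "\<dots> = (\<Prod>k<?T c. char (\<omega> (fst (idx c k))) u)"
      by (subst prod.reindex) (auto intro: inj_on_subset[OF inj_idx])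
    also have "\<dots> = prod_along (\<lambda>x. char (\<omega> x) u) (\<lambda>j. c (Suc j)) (int n)"
      unfolding prod_along_def by (simp add: fst_idx[of c _ undefined] walk_eq_pos steps_def)
    finally show "(\<integral>h. iexp (u * clock (c, h) (passage (steps (c, h)) (int n))) \<partial>H) =
      prod_along (\<lambda>x. char (\<omega> x) u) (\<lambda>j. c (Suc j)) (int n)" .
  qed
  also have "\<dots> = (\<integral>z. prod_along (\<lambda>x. char (\<omega> x) u) z (int n) \<partial>W)"
    using integral_distr[OF measurable_steps_fst measurable_prod_along] by (simp add: distr_steps)
  finally show ?thesis .
qed

end

section \<open>Decomposition at first passages\<close>

context trap_environment
begin

text \<open>Cutting at the first passage through \<open>n\<close>: the second piece is a path from \<open>n\<close> to
  \<open>n + 1\<close>, that is, a path from 0 to 1 in shifted coordinates.\<close>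

lemma sum_along_comb_seq:
  assumes z: "unit_steps z" "\<exists>k. pos z k = n" and z': "unit_steps z'" "\<exists>k. pos z' k = 1" and n: "0 \<le> n"
  shows "sum_along f (comb_seq (passage z n) z z') (n + 1) = sum_along f z n + sum_along (\<lambda>x. f (x + n)) z' 1"
  unfolding sum_along_def passage_comb_seq[OF assms] sum_lessThan_split
  using pos_passage[OF z(2)]
  by (intro arg_cong2[where f="(+)"] sum.cong refl) (simp_all add: pos_comb_seq_le pos_comb_seq_add, simp_all add: add.commute)

lemma prod_along_comb_seq:
  assumes z: "unit_steps z" "\<exists>k. pos z k = n" and z': "unit_steps z'" "\<exists>k. pos z' k = 1" and n: "0 \<le> n"
  shows "prod_along f (comb_seq (passage z n) z z') (n + 1) = prod_along f z n * prod_along (\<lambda>x. f (x + n)) z' 1"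
  unfolding prod_along_def passage_comb_seq[OF assms] prod_lessThan_split
  using pos_passage[OF z(2)]
  by (intro arg_cong2[where f="(*)"] prod.cong refl) (simp_all add: pos_comb_seq_le pos_comb_seq_add, simp_all add: add.commute)

lemma AE_good_at: "AE z in W. unit_steps z \<and> (\<exists>k. pos z k = int n)"
  using AE_good by eventually_elim blast

lemma AE_good_1: "AE z in W. unit_steps z \<and> (\<exists>k. pos z k = 1)"
  using AE_good_at[of 1] by simp

definition walk_sum :: "(int \<Rightarrow> ennreal) \<Rightarrow> int \<Rightarrow> ennreal" where
  "walk_sum f n = (\<integral>\<^sup>+z. sum_along f z n \<partial>W)"

lemma walk_sum_add:
  "walk_sum f (int n + 1) = walk_sum f (int n) + walk_sum (\<lambda>x. f (x + int n)) 1"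
proof -
  have "walk_sum f (int n + 1) =
    (\<integral>\<^sup>+z. \<integral>\<^sup>+z'. sum_along f (comb_seq (passage z (int n)) z z') (int n + 1) \<partial>W \<partial>W)"
    unfolding walk_sum_def by (rule nn_integral_strong_markov) simp_all
  also have "\<dots> = (\<integral>\<^sup>+z. sum_along f z (int n) + walk_sum (\<lambda>x. f (x + int n)) 1 \<partial>W)"
  proof (rule nn_integral_cong_AE)
    show "AE z in W. (\<integral>\<^sup>+z'. sum_along f (comb_seq (passage z (int n)) z z') (int n + 1) \<partial>W) =
      sum_along f z (int n) + walk_sum (\<lambda>x. f (x + int n)) 1"
      using AE_good_at[of n]
    proof eventually_elim
      case (elim z)
      have "(\<integral>\<^sup>+z'. sum_along f (comb_seq (passage z (int n)) z z') (int n + 1) \<partial>W) =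
        (\<integral>\<^sup>+z'. sum_along f z (int n) + sum_along (\<lambda>x. f (x + int n)) z' 1 \<partial>W)"
        by (rule nn_integral_cong_AE) (use AE_good_1 in eventually_elim, use elim in \<open>simp add: sum_along_comb_seq\<close>)
      also have "\<dots> = sum_along f z (int n) + walk_sum (\<lambda>x. f (x + int n)) 1"
        by (simp add: nn_integral_add W.P.emeasure_space_1 walk_sum_def)
      finally show ?case .
    qed
  qed
  also have "\<dots> = walk_sum f (int n) + walk_sum (\<lambda>x. f (x + int n)) 1"
    by (subst nn_integral_add) (simp_all add: walk_sum_def W.P.emeasure_space_1)
  finally show ?thesis .
qed

text \<open>First-step analysis. A step to the right completes the crossing; after a step to the left it has to pass from
  \<open>-1\<close> to \<open>1\<close>, which takes a crossing to 0 and a crossing to 1.\<close>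

lemma walk_sum_1: "walk_sum f 1 = f 0 + ennreal (1 / (\<beta> + 1)) * (walk_sum (\<lambda>x. f (x - 1)) 1 + walk_sum f 1)"
proof -
  have up: "sum_along f (case_nat 1 z) 1 = f 0" for z
  proof -
    have "hits_at (case_nat 1 z) 1 1"
      using pos_case_nat[of 1 z 0] by (simp add: hits_at_def)
    then show ?thesis unfolding sum_along_def by (simp add: hits_at_passage)
  qed
  have down: "sum_along f (case_nat (-1) z) 1 = f 0 + sum_along (\<lambda>x. f (x - 1)) z 2" if "\<exists>k. pos z k = 2" for z
  proof -
    have "hits_at (case_nat (-1) z) 1 (Suc (passage z 2))"
      unfolding hits_at_def
    proof (intro conjI allI impI)
      show "pos (case_nat (- 1) z) (Suc (passage z 2)) = 1" using pos_passage[OF that] by (simp add: pos_case_nat)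
      fix k assume "k < Suc (passage z 2)"
      then show "pos (case_nat (- 1) z) k \<noteq> 1"
        using not_pos_before_passage[of _ z 2] by (cases k) (auto simp: pos_case_nat)
    qed
    then have "passage (case_nat (-1) z) 1 = Suc (passage z 2)" by (rule hits_at_passage)
    then show ?thesis
      unfolding sum_along_def by (simp only: sum.lessThan_Suc_shift pos_case_nat pos_0) (simp add: add.commute)
  qed
  have two: "walk_sum (\<lambda>x. f (x - 1)) 2 = walk_sum (\<lambda>x. f (x - 1)) 1 + walk_sum f 1"
    using walk_sum_add[of "\<lambda>x. f (x - 1)" 1] by simp
  have "walk_sum f 1 = ennreal (1 / (\<beta> + 1)) * (\<integral>\<^sup>+z. sum_along f (case_nat (-1) z) 1 \<partial>W)
    + ennreal (\<beta> / (\<beta> + 1)) * (\<integral>\<^sup>+z. sum_along f (case_nat 1 z) 1 \<partial>W)"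
    unfolding walk_sum_def by (rule nn_integral_first_step) simp
  also have "(\<integral>\<^sup>+z. sum_along f (case_nat 1 z) 1 \<partial>W) = f 0"
    by (simp add: up W.P.emeasure_space_1)
  also have "(\<integral>\<^sup>+z. sum_along f (case_nat (-1) z) 1 \<partial>W) = (\<integral>\<^sup>+z. f 0 + sum_along (\<lambda>x. f (x - 1)) z 2 \<partial>W)"
    by (rule nn_integral_cong_AE) (use AE_hits[of 2, simplified] in eventually_elim, simp only: down)
  also have "\<dots> = f 0 + walk_sum (\<lambda>x. f (x - 1)) 2"
    by (simp add: nn_integral_add W.P.emeasure_space_1 walk_sum_def)
  also have "ennreal (1 / (\<beta> + 1)) * (f 0 + walk_sum (\<lambda>x. f (x - 1)) 2) + ennreal (\<beta> / (\<beta> + 1)) * f 0 =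
    (ennreal (1 / (\<beta> + 1)) + ennreal (\<beta> / (\<beta> + 1))) * f 0 + ennreal (1 / (\<beta> + 1)) * walk_sum (\<lambda>x. f (x - 1)) 2"
    by (simp only: distrib_left distrib_right ac_simps)
  also have "ennreal (1 / (\<beta> + 1)) + ennreal (\<beta> / (\<beta> + 1)) = 1"
    using beta by (subst ennreal_plus[symmetric]) (auto simp: add_divide_distrib[symmetric])
  finally show ?thesis unfolding two mult_1 .
qed

lemma integral_prod_along_add:
  assumes f: "\<And>x. norm (f x) \<le> 1"
  shows "(\<integral>z. prod_along f z (int n + 1) \<partial>W) =
    (\<integral>z. prod_along f z (int n) \<partial>W) * (\<integral>z. prod_along (\<lambda>x. f (x + int n)) z 1 \<partial>W)"
proof -
  let ?c = "\<lambda>z z'. comb_seq (passage z (int n)) z z'"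
  let ?g = "\<lambda>z. prod_along f z (int n + 1)"
  interpret WW: pair_prob_space W W ..
  have meas: "(\<lambda>p. ?g (?c (fst p) (snd p))) \<in> borel_measurable (W \<Otimes>\<^sub>M W)"
    using measurable_compose[OF measurable_comb_passage[of "int n"] measurable_prod_along[of f "int n + 1"]]
    by (simp add: split_beta')
  have bound: "norm (?g z) \<le> 1" for z
  proof -
    have "norm (?g z) = (\<Prod>k<passage z (int n + 1). norm (f (pos z k)))"
      unfolding prod_along_def by (rule prod_norm[symmetric])
    also have "\<dots> \<le> 1" by (rule prod_le_1) (use f in auto)
    finally show ?thesis .
  qed
  have int: "integrable (W \<Otimes>\<^sub>M W) (\<lambda>p. ?g (?c (fst p) (snd p)))"
    by (rule WW.P.integrable_const_bound[where B=1]) (use bound meas in auto)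
  have "(\<integral>z. ?g z \<partial>W) = (\<integral>z. ?g z \<partial>distr (W \<Otimes>\<^sub>M W) W (\<lambda>(z, z'). ?c z z'))"
    by (subst strong_markov) simp_all
  also have "\<dots> = (\<integral>p. ?g (?c (fst p) (snd p)) \<partial>(W \<Otimes>\<^sub>M W))"
    by (subst integral_distr[OF measurable_comb_passage measurable_prod_along]) (simp add: split_beta')
  also have "\<dots> = (\<integral>z. \<integral>z'. ?g (?c z z') \<partial>W \<partial>W)"
    using WW.integral_fst'[OF int] by simp
  also have "\<dots> = (\<integral>z. prod_along f z (int n) * (\<integral>z. prod_along (\<lambda>x. f (x + int n)) z 1 \<partial>W) \<partial>W)"
  proof (rule integral_cong_AE)
    show "(\<lambda>z. \<integral>z'. ?g (?c z z') \<partial>W) \<in> borel_measurable W"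
      using WW.integrable_fst'[OF int] by simp
    show "AE z in W. (\<integral>z'. ?g (?c z z') \<partial>W) = prod_along f z (int n) * (\<integral>z. prod_along (\<lambda>x. f (x + int n)) z 1 \<partial>W)"
      using AE_good_at[of n] AE_space
    proof eventually_elim
      case (elim z)
      have "(\<integral>z'. ?g (?c z z') \<partial>W) = (\<integral>z'. prod_along f z (int n) * prod_along (\<lambda>x. f (x + int n)) z' 1 \<partial>W)"
      proof (rule integral_cong_AE)
        have "(\<lambda>z'. ?c z z') \<in> W \<rightarrow>\<^sub>M W"
          using elim by (intro measurable_comb_seq') auto
        then show "(\<lambda>z'. ?g (?c z z')) \<in> borel_measurable W"
          by (rule measurable_compose) (rule measurable_prod_along)
        show "AE z' in W. ?g (?c z z') = prod_along f z (int n) * prod_along (\<lambda>x. f (x + int n)) z' 1"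
          using AE_good_1 by eventually_elim (use elim in \<open>simp add: prod_along_comb_seq\<close>)
      qed measurable
      then show ?case by simp
    qed
  qed measurable
  also have "\<dots> = (\<integral>z. prod_along f z (int n) \<partial>W) * (\<integral>z. prod_along (\<lambda>x. f (x + int n)) z 1 \<partial>W)"
    by (rule integral_mult_left_zero)
  finally show ?thesis .
qed

lemma integral_prod_along:
  assumes f: "\<And>x. norm (f x) \<le> 1"
  shows "(\<integral>z. prod_along f z (int n) \<partial>W) = (\<Prod>k<n. \<integral>z. prod_along (\<lambda>x. f (x + int k)) z 1 \<partial>W)"
proof (induction n)
  case 0
  have "passage z 0 = 0" for z by (rule hits_at_passage) (simp add: hits_at_def)
  then show ?case by (simp add: prod_along_def W.P.prob_space)
next
  case (Suc n)
  have "int (Suc n) = int n + 1" by simp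
  then show ?case
    using integral_prod_along_add[OF f, where n=n] Suc by (simp only: prod.lessThan_Suc)
qed

lemma trap_environment_shift: "trap_environment \<beta> (env_shift k \<omega>)"
  by (intro trap_environment.intro biased_walk_axioms trap_environment_axioms.intro, unfold env_shift_apply)
    (rule prob_site, rule sets_site)

lemma char_hitting_time_shift:
  "(\<integral>s. iexp (u * hitting_time 1 s) \<partial>quenched \<beta> (env_shift k \<omega>)) = (\<integral>z. prod_along (\<lambda>x. char (\<omega> (x + k)) u) z 1 \<partial>W)"
proof -
  interpret E: trap_environment \<beta> "env_shift k \<omega>" by (rule trap_environment_shift)
  show ?thesis
    using E.char_hitting_time[where n=1 and u=u]
    unfolding env_shift_apply E.prod_along_def prod_along_def of_nat_1 .
qed

lemma char_hitting_time_prod: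
  "(\<integral>s. iexp (u * hitting_time (int n) s) \<partial>Q) =
    (\<Prod>k<n. \<integral>s. iexp (u * hitting_time 1 s) \<partial>quenched \<beta> (env_shift (int k) \<omega>))"
  unfolding char_hitting_time char_hitting_time_shift
  by (rule integral_prod_along) (rule norm_char_site)

lemma mean_hitting_time_shift:
  "(\<integral>\<^sup>+s. ennreal (hitting_time 1 s) \<partial>quenched \<beta> (env_shift k \<omega>)) = walk_sum (\<lambda>x. mom1 (x + k)) 1"
proof -
  interpret E: trap_environment \<beta> "env_shift k \<omega>" by (rule trap_environment_shift)
  show ?thesis
    using E.nn_integral_hitting_time_eq[of 1]
    unfolding env_shift_apply walk_sum_def E.sum_along_def sum_along_def of_nat_1 .
qed

lemma mean_hitting_time_recursion:
  fixes k :: int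
  defines "M \<equiv> \<lambda>k. \<integral>\<^sup>+s. ennreal (hitting_time 1 s) \<partial>quenched \<beta> (env_shift k \<omega>)"
  shows "M k = mom1 k + ennreal (1 / (\<beta> + 1)) * (M (k - 1) + M k)"
proof -
  have "mom1 (0 + k) = mom1 k" "(\<lambda>x. mom1 (x - 1 + k)) = (\<lambda>x. mom1 (x + (k - 1)))"
    by (simp_all add: algebra_simps)
  then show ?thesis
    using walk_sum_1[of "\<lambda>x. mom1 (x + k)"] unfolding M_def mean_hitting_time_shift by presburger
qed

lemma distr_Q_steps: "distr Q W steps = W"
proof -
  have "distr Q W steps = distr (distr (W \<Otimes>\<^sub>M H) W fst) W (\<lambda>c j. c (Suc j))"
    unfolding Q_eq steps_def[abs_def]
    by (subst distr_distr[OF measurable_steps_fst measurable_fst]) (simp add: comp_def)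
  then show ?thesis unfolding H.P.distr_pair_fst distr_steps .
qed

lemma measurable_pos_after_passage: "(\<lambda>z. pos z (passage z m + j)) \<in> W \<rightarrow>\<^sub>M count_space UNIV"
proof -
  have f: "(\<lambda>z. pos z (i + j)) \<in> W \<rightarrow>\<^sub>M count_space UNIV" for i by (rule measurable_pos)
  have g: "(\<lambda>z. passage z m) \<in> W \<rightarrow>\<^sub>M count_space UNIV" by (rule measurable_passage)
  show ?thesis
    by (rule measurable_compose_countable[where f="\<lambda>i z. pos z (i + j)" and g="\<lambda>z. passage z m", OF f g])
qed

text \<open>By the strong Markov property, the probability that the walk ever falls below its starting point by
  \<open>r\<close>.\<close>

lemma prob_backtrack:
  "Q.prob {s \<in> space Q. \<exists>j. pos (steps s) (passage (steps s) (int n) + j) \<le> int n - int r} \<le> \<gamma> ^ r / (1 - \<rho>)"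
proof -
  let ?A = "{z \<in> space W. \<exists>j. pos z (passage z (int n) + j) \<le> int n - int r}"
  note pos_after = measurable_pos_after_passage[of "int n"]
  have A: "?A \<in> sets W"
  proof -
    have "?A = (\<Union>j. (\<lambda>z. pos z (passage z (int n) + j)) -` {..int n - int r} \<inter> space W)" by blast
    also have "\<dots> \<in> sets W"
      by (rule sets.countable_UN, rule image_subsetI, rule measurable_sets[OF pos_after]) simp
    finally show ?thesis .
  qed
  have "Q.prob {s \<in> space Q. \<exists>j. pos (steps s) (passage (steps s) (int n) + j) \<le> int n - int r} =
    measure (distr Q W steps) ?A"
  proof -
    have "steps s \<in> space W" if "s \<in> space Q" for s
      using that by (rule measurable_space[OF measurable_steps])
    then have eq: "{s \<in> space Q. \<exists>j. pos (steps s) (passage (steps s) (int n) + j) \<le> int n - int r} = steps -` ?A \<inter> space Q"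
      by blast
    show ?thesis unfolding measure_distr[OF measurable_steps A] eq ..
  qed
  also have "\<dots> = W.prob ?A" unfolding distr_Q_steps ..
  also have "\<dots> = W.prob {z \<in> space W. \<exists>k. pos z k \<le> - int r}"
  proof -
    have "emeasure W ?A = (\<integral>\<^sup>+z. \<integral>\<^sup>+z'. indicator ?A (comb_seq (passage z (int n)) z z') \<partial>W \<partial>W)"
      unfolding nn_integral_indicator[symmetric, OF A]
      by (rule nn_integral_strong_markov[OF borel_measurable_indicator[OF A]]) simp
    also have "\<dots> = (\<integral>\<^sup>+z. \<integral>\<^sup>+z'. indicator {z \<in> space W. \<exists>k. pos z k \<le> - int r} z' \<partial>W \<partial>W)"
    proof (rule nn_integral_cong_AE)
      show "AE z in W. (\<integral>\<^sup>+z'. indicator ?A (comb_seq (passage z (int n)) z z') \<partial>W) =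
        (\<integral>\<^sup>+z'. indicator {z \<in> space W. \<exists>k. pos z k \<le> - int r} z' \<partial>W)"
        using AE_good_at[of n]
      proof eventually_elim
        case (elim z)
        then have p: "pos z (passage z (int n)) = int n" by (intro pos_passage) auto
        show ?case
        proof (rule nn_integral_cong)
          fix z' assume "z' \<in> space W"
          let ?c = "comb_seq (passage z (int n)) z z'"
          have "hits_at ?c (int n) (passage z (int n))"
            unfolding hits_at_def
            using p not_pos_before_passage[of _ z "int n"] by (simp add: pos_comb_seq_le)
          then have "passage ?c (int n) = passage z (int n)" by (rule hits_at_passage)
          then have "?c \<in> ?A \<longleftrightarrow> z' \<in> {z \<in> space W. \<exists>k. pos z k \<le> - int r}"
            using p by (simp only: mem_Collect_eq pos_comb_seq_add) (simp add: space_PiM)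
          then show "indicator ?A ?c = (indicator {z \<in> space W. \<exists>k. pos z k \<le> - int r} z' :: ennreal)"
            by (simp only: indicator_def)
        qed
      qed
    qed
    also have "\<dots> = emeasure W {z \<in> space W. \<exists>k. pos z k \<le> - int r}"
    proof -
      have "{z \<in> space W. \<exists>k. pos z k \<le> - int r} = (\<Union>k. (\<lambda>z. pos z k) -` {..- int r} \<inter> space W)" by blast
      also have "\<dots> \<in> sets W"
        by (rule sets.countable_UN, rule image_subsetI, rule measurable_sets[OF measurable_pos]) simp
      finally have "{z \<in> space W. \<exists>k. pos z k \<le> - int r} \<in> sets W" .
      then show ?thesis by (simp only: nn_integral_indicator nn_integral_const W.P.emeasure_space_1 mult_1_right)
    qed
    finally show ?thesis by (simp only: measure_def)
  qed
  also have "\<dots> \<le> \<gamma> ^ r / (1 - \<rho>)" by (rule prob_ever_below)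
  finally show ?thesis .
qed

text \<open>If \<open>X\<^sub>t \<ge> n\<close>, then \<open>n\<close> has been hit by time \<open>t\<close>. Conversely, if
  \<open>n + r\<close> has been hit by time \<open>t\<close> although \<open>X\<^sub>t < n\<close>, then the
  walk has stepped back by more than \<open>r\<close> after hitting \<open>n + r\<close>.\<close>

lemma prob_trapped_walk_bounds:
  assumes unb: "AE s in Q. \<forall>t. \<exists>k. t < clock s k" and t: "0 \<le> t"
  shows "Q.prob {s \<in> space Q. int n \<le> trapped_walk s t} \<le> Q.prob {s \<in> space Q. hitting_time (int n) s \<le> t}"
    and "Q.prob {s \<in> space Q. hitting_time (int (n + r)) s \<le> t} - \<gamma> ^ r / (1 - \<rho>) \<le>
      Q.prob {s \<in> space Q. int n \<le> trapped_walk s t}"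
proof -
  have tw [measurable]: "(\<lambda>s. trapped_walk s t) \<in> Q \<rightarrow>\<^sub>M count_space UNIV"
    unfolding measurable_Q by measurable
  have ht [measurable]: "hitting_time m \<in> borel_measurable Q" for m
    unfolding measurable_Q by measurable
  have st: "(\<lambda>s. pos (steps s) (passage (steps s) m + j)) \<in> Q \<rightarrow>\<^sub>M count_space UNIV" for m j
    by (rule measurable_compose[OF measurable_steps measurable_pos_after_passage])
  let ?B = "{s \<in> space Q. \<exists>j. pos (steps s) (passage (steps s) (int (n + r)) + j) \<le> int (n + r) - int (r + 1)}"
  have AE: "AE s in Q. (int n \<le> trapped_walk s t \<longrightarrow> hitting_time (int n) s \<le> t) \<and>
    (hitting_time (int (n + r)) s \<le> t \<longrightarrow> int n \<le> trapped_walk s t \<or> s \<in> ?B)"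
    using unb AE_hitting_time AE_steps[OF AE_good] AE_space
  proof eventually_elim
    case (elim s)
    then have p: "\<And>p. 0 < snd s p" using sample_pos space_Q by auto
    obtain T where T: "t < clock s T" using elim by blast
    define k where "k = clock_inv s t"
    have k: "clock s k \<le> t" "t < clock s (Suc k)" unfolding k_def using clock_inv_bounds[OF p t T] by auto
    have X: "trapped_walk s t = pos (steps s) k" by (simp add: trapped_walk_def k_def walk_eq_pos)
    show ?case
    proof (intro conjI impI)
      assume "int n \<le> trapped_walk s t"
      then obtain i where i: "i \<le> k" "pos (steps s) i = int n"
        using unit_steps_ivt[of "steps s" "int n" k] elim X by auto
      then have "passage (steps s) (int n) \<le> k"
        unfolding passage_def by (intro order_trans[OF Least_le]) auto
      then have "clock s (passage (steps s) (int n)) \<le> clock s k" by (simp add: clock_le_iff[OF p])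
      then show "hitting_time (int n) s \<le> t" unfolding elim(2)[rule_format, of n] using k(1) by (rule order_trans)
    next
      assume "hitting_time (int (n + r)) s \<le> t"
      then have "clock s (passage (steps s) (int (n + r))) \<le> t" unfolding elim(2)[rule_format, of "n + r"] .
      also have "t < clock s (Suc k)" by (rule k)
      finally have "passage (steps s) (int (n + r)) \<le> k" by (simp add: clock_less_iff[OF p])
      then obtain j where j: "k = passage (steps s) (int (n + r)) + j" using le_Suc_ex by blast
      show "int n \<le> trapped_walk s t \<or> s \<in> ?B"
      proof (cases "int n \<le> trapped_walk s t")
        case False
        then have "pos (steps s) (passage (steps s) (int (n + r)) + j) \<le> int (n + r) - int (r + 1)"
          using X j by simp
        then show ?thesis using elim by blast
      qed simp
    qed
  qed
  show "Q.prob {s \<in> space Q. int n \<le> trapped_walk s t} \<le> Q.prob {s \<in> space Q. hitting_time (int n) s \<le> t}"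
    by (rule Q.finite_measure_mono_AE) (use AE in eventually_elim, auto)
  have B: "?B \<in> sets Q"
  proof -
    have "?B = (\<Union>j. (\<lambda>s. pos (steps s) (passage (steps s) (int (n + r)) + j)) -` {..int (n + r) - int (r + 1)} \<inter> space Q)" by blast
    also have "\<dots> \<in> sets Q"
      by (rule sets.countable_UN, rule image_subsetI, rule measurable_sets[OF st]) simp
    finally show ?thesis .
  qed
  have "Q.prob {s \<in> space Q. hitting_time (int (n + r)) s \<le> t} \<le> Q.prob ({s \<in> space Q. int n \<le> trapped_walk s t} \<union> ?B)"
  proof (rule Q.finite_measure_mono_AE)
    show "AE s in Q. s \<in> {s \<in> space Q. hitting_time (int (n + r)) s \<le> t} \<longrightarrow>
      s \<in> {s \<in> space Q. int n \<le> trapped_walk s t} \<union> ?B"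
      using AE by eventually_elim blast
    have "{s \<in> space Q. int n \<le> trapped_walk s t} \<in> sets Q" by measurable
    then show "{s \<in> space Q. int n \<le> trapped_walk s t} \<union> ?B \<in> sets Q" using B by (rule sets.Un)
  qed
  also have "\<dots> \<le> Q.prob {s \<in> space Q. int n \<le> trapped_walk s t} + Q.prob ?B"
    by (rule measure_Un_le[OF _ B]) measurable
  also have "Q.prob ?B \<le> \<gamma> ^ (r + 1) / (1 - \<rho>)" by (rule prob_backtrack)
  also have "\<dots> \<le> \<gamma> ^ r / (1 - \<rho>)"
    using gamma rho by (intro divide_right_mono power_decreasing) auto
  finally show "Q.prob {s \<in> space Q. hitting_time (int (n + r)) s \<le> t} - \<gamma> ^ r / (1 - \<rho>) \<le>
      Q.prob {s \<in> space Q. int n \<le> trapped_walk s t}" by simp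
qed

end

section \<open>Site times and the variance of a crossing\<close>

context trap_environment
begin

lemma nn_integral_site_time:
  assumes f: "f \<in> borel_measurable borel"
  shows "(\<integral>\<^sup>+s. f (site_time x i s) \<partial>Q) = (\<integral>\<^sup>+h. f h \<partial>\<omega> x)"
proof -
  have "(\<integral>\<^sup>+s. f (site_time x i s) \<partial>Q) = (\<integral>\<^sup>+c. \<integral>\<^sup>+h. f (h (x, i)) \<partial>H \<partial>W)"
    by (subst nn_integral_Q) (rule measurable_compose[OF measurable_site_time f], simp add: site_time_def)
  also have "\<dots> = (\<integral>\<^sup>+h. f h \<partial>\<omega> x)"
    by (simp add: nn_integral_H_coord[OF f] W.P.emeasure_space_1)
  finally show ?thesis .
qed

lemma expectation_site_time: "Q.expectation (site_time x i) = enn2real (mom1 x)"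
proof -
  have "AE s in Q. 0 \<le> site_time x i s"
    using AE_space by eventually_elim (auto simp: space_Q site_time_def intro: less_imp_le[OF sample_pos])
  moreover have "site_time x i \<in> borel_measurable Q"
    unfolding measurable_Q by (rule measurable_site_time)
  ultimately have "Q.expectation (site_time x i) = enn2real (\<integral>\<^sup>+s. ennreal (site_time x i s) \<partial>Q)"
    by (intro integral_eq_nn_integral)
  then show ?thesis by (simp add: nn_integral_site_time[where f=ennreal])
qed

lemma holding_time_0: "holding_time 0 = site_time 0 1"
  by (simp add: fun_eq_iff holding_time_def local_time_def)

lemma hitting_time_nonneg: "AE s in Q. 0 \<le> hitting_time (int n) s"
  using AE_hitting_time AE_space
proof eventually_elim
  case (elim s)
  have "0 \<le> clock s k" for k
    unfolding clock_def
    by (intro sum_nonneg less_imp_le[OF holding_time_pos] sample_pos) (use elim space_Q in simp)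
  then show ?case using elim(1)[rule_format, of n] by simp
qed

lemma measurable_hitting_time_Q: "hitting_time m \<in> borel_measurable Q"
  unfolding measurable_Q by (rule measurable_hitting_time)

lemma prob_steps_pos: "W.P.prob {c \<in> space W. c 1 = 1} > 0"
  "W.P.prob {c \<in> space W. c 1 = -1 \<and> c 2 = 1 \<and> c 3 = 1} > 0"
proof -
  have p: "pmf (step_pmf \<beta>) 1 > 0" "pmf (step_pmf \<beta>) (-1) > 0"
    using beta by (auto simp: pmf_positive_iff step_pmf_def)
  have "W.P.prob {c \<in> space W. \<forall>i\<in>J. c i \<in> {a i}} = (\<Prod>i\<in>J. pmf (step_pmf \<beta>) (a i))" if "finite J" for J a
  proof -
    have "emeasure W {c \<in> space W. \<forall>i\<in>J. c i \<in> {a i}} = (\<Prod>i\<in>J. emeasure (measure_pmf (step_pmf \<beta>)) {a i})"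
      by (rule W.emeasure_PiM_Collect) (use that in auto)
    then show ?thesis
      by (simp add: W.P.emeasure_eq_measure emeasure_pmf_single prod_ennreal prod_nonneg)
  qed
  from this[of "{1}" "\<lambda>_. 1"] this[of "{1,2,3}" "\<lambda>i. if i = 1 then -1 else 1"] show
    "W.P.prob {c \<in> space W. c 1 = 1} > 0"
    "W.P.prob {c \<in> space W. c 1 = -1 \<and> c 2 = 1 \<and> c 3 = 1} > 0"
    using p by auto
qed

text \<open>If \<open>\<tau>\<^sub>1\<close> were constant, then, comparing the path that steps to 1 at once with the path
  through \<open>0, -1, 0, 1\<close>, the holding times after the first one on the longer path would vanish.\<close>

lemma hitting_time_not_constant: "\<not> (AE s in Q. hitting_time 1 s = a)"
proof
  assume "AE s in Q. hitting_time 1 s = a"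
  then have AE: "AE c in W. AE h in H. hitting_time 1 (c, h) = a"
    unfolding Q_eq by (rule WH.AE_pair)
  have ex: "\<exists>c\<in>A. AE h in H. hitting_time 1 (c, h) = a" if A: "W.P.prob A > 0" for A
  proof (rule ccontr)
    assume none: "\<not> ?thesis"
    have "AE c in W. c \<notin> A"
      using AE by eventually_elim (use none in blast)
    moreover have "A \<in> sets W" using A by (metis measure_notin_sets less_irrefl)
    ultimately have "W.P.prob A = 0" by (simp add: W.P.prob_eq_0)
    with A show False by simp
  qed
  from ex[OF prob_steps_pos(1)] obtain c where c: "c 1 = 1" "AE h in H. hitting_time 1 (c, h) = a" by blast
  from ex[OF prob_steps_pos(2)] obtain d where d: "d 1 = -1" "d 2 = 1" "d 3 = 1" "AE h in H. hitting_time 1 (d, h) = a" by blast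
  have "AE h in H. False"
    using c(2) d(4) AE_space
  proof eventually_elim
    case (elim h)
    have h: "0 < h p" for p
      using elim by (cases p) (auto simp: space_PiM PiE_iff space_site)
    then have pos: "0 < snd (c', h) p" for c' :: "nat \<Rightarrow> int" and p by simp
    have "walk (c, h) 1 = 1" using c by (simp add: walk_def)
    then have "(LEAST k. walk (c, h) k = 1) = 1"
      by (intro Least_equality) (auto simp: Suc_le_eq intro: Nat.gr0I)
    then have "a = clock (c, h) 1"
      using hitting_time_eq[of "(c, h)" 1, OF pos] \<open>walk (c, h) 1 = 1\<close> elim by auto
    then have a1: "a = h (0, 1)"
      using holding_time_0 by (simp add: clock_def site_time_def)
    have w: "walk (d, h) 0 = 0" "walk (d, h) 1 = -1" "walk (d, h) 2 = 0" "walk (d, h) 3 = 1"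
      using d by (simp_all add: walk_def numeral_2_eq_2 numeral_3_eq_3)
    have "(LEAST k. walk (d, h) k = 1) = 3"
    proof (rule Least_equality)
      fix k assume "walk (d, h) k = 1"
      then show "3 \<le> k" using w by (cases "k = 0"; cases "k = 1"; cases "k = 2") auto
    qed (use w in simp)
    then have "a = clock (d, h) 3"
      using hitting_time_eq[of "(d, h)" 1, OF pos] w(4) elim by auto
    also have "\<dots> > clock (d, h) 1" by (simp add: clock_less_iff[OF pos])
    also have "clock (d, h) 1 = h (0, 1)"
      using holding_time_0 by (simp add: clock_def site_time_def)
    finally show False using a1 by simp
  qed
  then show False by (simp add: H.P.AE_False)
qed

lemma variance_hitting_time_pos:
  assumes sq: "integrable Q (\<lambda>s. (hitting_time 1 s)\<^sup>2)"
  shows "0 < Q.variance (hitting_time 1)"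
proof -
  let ?m = "Q.expectation (hitting_time 1)"
  have int: "integrable Q (hitting_time 1)"
    by (rule Q.square_integrable_imp_integrable[OF measurable_hitting_time_Q sq])
  have int': "integrable Q (\<lambda>s. (hitting_time 1 s - ?m)\<^sup>2)"
    unfolding power2_diff using int sq by (intro Bochner_Integration.integrable_add Bochner_Integration.integrable_diff) auto
  have "0 \<noteq> Q.variance (hitting_time 1)"
  proof
    assume "0 = Q.variance (hitting_time 1)"
    then have "AE s in Q. (hitting_time 1 s - ?m)\<^sup>2 = 0"
      using integral_nonneg_eq_0_iff_AE[OF int'] by simp
    then have "AE s in Q. hitting_time 1 s = ?m" by simp
    then show False using hitting_time_not_constant by blast
  qed
  moreover have "0 \<le> Q.variance (hitting_time 1)" by simp
  ultimately show ?thesis by linarith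
qed

end

section \<open>Annealed moments\<close>

locale trapped_walk_model = biased_walk +
  fixes \<pi> :: "real measure measure"
  assumes pi: "\<pi> \<in> space (prob_algebra (prob_algebra pos_borel))"
    and second_moment: "integrable (annealed \<beta> \<pi>) (\<lambda>s. (holding_time 0 s)\<^sup>2)"
begin

abbreviation E :: "environment measure" where "E \<equiv> env_law \<pi>"

sublocale iid_field \<pi>
  using pi by (simp add: iid_field_def space_prob_algebra)

lemma E_eq: "E = P"
  by (simp add: env_law_def)

lemma prob_E: "prob_space E"
  unfolding E_eq by (rule P.prob_space_axioms)

sublocale E: prob_space E by (rule prob_E)

lemma sets_pi: "sets \<pi> = sets (prob_algebra pos_borel)"
  using pi by (simp add: space_prob_algebra)

lemma measurable_env_coord: "(\<lambda>\<omega>. \<omega> x) \<in> E \<rightarrow>\<^sub>M prob_algebra pos_borel"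
proof -
  have "(\<lambda>\<omega>. \<omega> x) \<in> E \<rightarrow>\<^sub>M \<pi>" unfolding E_eq by (rule measurable_component_singleton) simp
  then show ?thesis unfolding measurable_cong_sets[OF refl sets_pi] .
qed

lemma env_trap_environment: "\<omega> \<in> space E \<Longrightarrow> trap_environment \<beta> \<omega>"
proof (intro trap_environment.intro biased_walk_axioms trap_environment_axioms.intro)
  fix x assume "\<omega> \<in> space E"
  then have "\<omega> x \<in> space (prob_algebra pos_borel)" by (rule measurable_space[OF measurable_env_coord])
  then show "prob_space (\<omega> x)" "sets (\<omega> x) = sets pos_borel" by (simp_all add: space_prob_algebra)
qed

lemma quenched_measurable: "quenched \<beta> \<in> E \<rightarrow>\<^sub>M subprob_algebra sample_space"
  by (rule measurable_prob_algebraD[OF quenched_kernel[OF pi]])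

lemma nn_integral_annealed:
  "f \<in> borel_measurable sample_space \<Longrightarrow> (\<integral>\<^sup>+s. f s \<partial>annealed \<beta> \<pi>) = (\<integral>\<^sup>+\<omega>. \<integral>\<^sup>+s. f s \<partial>quenched \<beta> \<omega> \<partial>E)"
  unfolding annealed_def by (rule nn_integral_bind[OF _ quenched_measurable])

lemma sets_annealed: "sets (annealed \<beta> \<pi>) = sets sample_space"
  unfolding annealed_def
  by (rule sets_bind[OF _ E.not_empty]) (rule trap_environment.sets_Q[OF env_trap_environment])

definition site_mom :: "nat \<Rightarrow> real measure \<Rightarrow> ennreal" where
  "site_mom i \<mu> = (\<integral>\<^sup>+h. ennreal (h ^ i) \<partial>\<mu>)"

lemma measurable_site_mom: "site_mom i \<in> borel_measurable \<pi>"
proof -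
  have "(\<lambda>h. ennreal (h ^ i)) \<in> borel_measurable pos_borel"
    by (rule measurable_restrict_space1) measurable
  then have "site_mom i \<in> borel_measurable (subprob_algebra pos_borel)"
    unfolding site_mom_def[abs_def] by (rule nn_integral_measurable_subprob_algebra)
  then have "site_mom i \<in> borel_measurable (prob_algebra pos_borel)"
    unfolding prob_algebra_def by (rule measurable_restrict_space1)
  then show ?thesis unfolding measurable_cong_sets[OF sets_pi refl] .
qed

lemma measurable_site_mom_coord: "(\<lambda>\<omega>. site_mom i (\<omega> x)) \<in> borel_measurable E"
proof -
  have "(\<lambda>\<omega>. \<omega> x) \<in> P \<rightarrow>\<^sub>M \<pi>" by (rule measurable_component_singleton) simp
  from measurable_compose[OF this measurable_site_mom] show ?thesis unfolding E_eq .
qed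

lemma nn_integral_coord:
  assumes "f \<in> borel_measurable \<pi>"
  shows "(\<integral>\<^sup>+\<omega>. f (\<omega> x) \<partial>E) = (\<integral>\<^sup>+\<mu>. f \<mu> \<partial>\<pi>)"
proof -
  have "(\<integral>\<^sup>+\<mu>. f \<mu> \<partial>\<pi>) = (\<integral>\<^sup>+\<mu>. f \<mu> \<partial>distr P \<pi> (\<lambda>\<omega>. \<omega> x))"
    by (simp add: P.PiM_component)
  also have "\<dots> = (\<integral>\<^sup>+\<omega>. f (\<omega> x) \<partial>P)"
    by (rule nn_integral_distr) (use assms in simp_all)
  finally show ?thesis unfolding E_eq ..
qed

definition annealed_sq :: ennreal where "annealed_sq = (\<integral>\<^sup>+\<mu>. site_mom 2 \<mu> \<partial>\<pi>)"

lemma annealed_sq_finite: "annealed_sq < \<infinity>"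
proof -
  have "annealed_sq = (\<integral>\<^sup>+\<omega>. site_mom 2 (\<omega> 0) \<partial>E)"
    unfolding annealed_sq_def by (rule nn_integral_coord[symmetric, OF measurable_site_mom])
  also have "\<dots> = (\<integral>\<^sup>+\<omega>. \<integral>\<^sup>+s. ennreal ((holding_time 0 s)\<^sup>2) \<partial>quenched \<beta> \<omega> \<partial>E)"
  proof (rule nn_integral_cong)
    fix \<omega> assume "\<omega> \<in> space E"
    then interpret trap_environment \<beta> \<omega> by (rule env_trap_environment)
    show "site_mom 2 (\<omega> 0) = (\<integral>\<^sup>+s. ennreal ((holding_time 0 s)\<^sup>2) \<partial>quenched \<beta> \<omega>)"
      by (simp add: site_mom_def holding_time_0 nn_integral_site_time[where f="\<lambda>x. ennreal (x\<^sup>2)"])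
  qed
  also have "\<dots> = (\<integral>\<^sup>+s. ennreal ((holding_time 0 s)\<^sup>2) \<partial>annealed \<beta> \<pi>)"
    by (rule nn_integral_annealed[symmetric]) measurable
  also have "\<dots> < \<infinity>"
    using second_moment unfolding integrable_iff_bounded by simp
  finally show ?thesis .
qed

text \<open>After the Cauchy--Schwarz inequality has separated the factors, averaging over the environment first leaves the
  second moment of the number of steps times that of a holding time.\<close>

lemma annealed_crossing_sq: "(\<integral>\<^sup>+\<omega>. \<integral>\<^sup>+s. ennreal ((hitting_time 1 s)\<^sup>2) \<partial>quenched \<beta> \<omega> \<partial>E) < \<infinity>"
proof -
  let ?T = "\<lambda>z. passage z 1"
  let ?f = "\<lambda>(\<omega>, z). ennreal (?T z) * (\<Sum>k<?T z. site_mom 2 (\<omega> (pos z k)))"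
  interpret EW: pair_sigma_finite E W ..
  have T: "(\<lambda>p. ?T (snd p)) \<in> E \<Otimes>\<^sub>M W \<rightarrow>\<^sub>M count_space UNIV"
    by (rule measurable_compose[OF measurable_snd measurable_passage])
  have pos: "(\<lambda>p. pos (snd p) k) \<in> E \<Otimes>\<^sub>M W \<rightarrow>\<^sub>M count_space UNIV" for k
    by (rule measurable_compose[OF measurable_snd measurable_pos])
  have m1: "(\<lambda>p. site_mom 2 (fst p x)) \<in> borel_measurable (E \<Otimes>\<^sub>M W)" for x
    by (rule measurable_compose[OF measurable_fst measurable_site_mom_coord])
  have m2: "(\<lambda>p. site_mom 2 (fst p (pos (snd p) k))) \<in> borel_measurable (E \<Otimes>\<^sub>M W)" for k
    by (rule measurable_compose_countable[where f="\<lambda>x p. site_mom 2 (fst p x)" and g="\<lambda>p. pos (snd p) k", OF m1 pos])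
  have m3: "(\<lambda>p. ennreal (real i) * (\<Sum>k<i. site_mom 2 (fst p (pos (snd p) k)))) \<in> borel_measurable (E \<Otimes>\<^sub>M W)" for i
    using m2 by measurable
  have f: "?f \<in> borel_measurable (E \<Otimes>\<^sub>M W)"
    using measurable_compose_countable[where f="\<lambda>i p. ennreal (real i) * (\<Sum>k<i. site_mom 2 (fst p (pos (snd p) k)))"
      and g="\<lambda>p. ?T (snd p)", OF m3 T] by (simp add: split_beta')
  have "(\<integral>\<^sup>+\<omega>. \<integral>\<^sup>+s. ennreal ((hitting_time 1 s)\<^sup>2) \<partial>quenched \<beta> \<omega> \<partial>E) \<le> (\<integral>\<^sup>+\<omega>. \<integral>\<^sup>+z. ?f (\<omega>, z) \<partial>W \<partial>E)"
  proof (rule nn_integral_mono)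
    fix \<omega> assume "\<omega> \<in> space E"
    then interpret trap_environment \<beta> \<omega> by (rule env_trap_environment)
    show "(\<integral>\<^sup>+s. ennreal ((hitting_time 1 s)\<^sup>2) \<partial>quenched \<beta> \<omega>) \<le> (\<integral>\<^sup>+z. ?f (\<omega>, z) \<partial>W)"
      using nn_integral_hitting_time_sq_le by (simp add: sum_along_def site_mom_def)
  qed
  also have "\<dots> = (\<integral>\<^sup>+z. \<integral>\<^sup>+\<omega>. ?f (\<omega>, z) \<partial>E \<partial>W)"
    by (rule EW.Fubini[OF f, symmetric])
  also have "\<dots> = (\<integral>\<^sup>+z. annealed_sq * ennreal ((real (?T z))\<^sup>2) \<partial>W)"
  proof (rule nn_integral_cong)
    fix z
    have "(\<integral>\<^sup>+\<omega>. ?f (\<omega>, z) \<partial>E) = ennreal (?T z) * (\<Sum>k<?T z. \<integral>\<^sup>+\<omega>. site_mom 2 (\<omega> (pos z k)) \<partial>E)"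
      using measurable_site_mom_coord
      by (simp add: nn_integral_cmult nn_integral_sum borel_measurable_sum)
    also have "\<dots> = ennreal (?T z) * (of_nat (?T z) * annealed_sq)"
      by (simp add: nn_integral_coord measurable_site_mom annealed_sq_def)
    also have "\<dots> = annealed_sq * ennreal ((real (?T z))\<^sup>2)"
      by (simp add: power2_eq_square ennreal_mult ac_simps flip: ennreal_of_nat_eq_real_of_nat)
    finally show "(\<integral>\<^sup>+\<omega>. ?f (\<omega>, z) \<partial>E) = annealed_sq * ennreal ((real (?T z))\<^sup>2)" .
  qed
  also have "\<dots> = annealed_sq * (\<integral>\<^sup>+z. ennreal ((real (?T z))\<^sup>2) \<partial>W)"
    by (rule nn_integral_cmult) (rule measurable_compose[OF measurable_passage], simp)
  also have "\<dots> < \<infinity>"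
    using annealed_sq_finite nn_integral_passage_squared by (simp add: ennreal_mult_less_top less_top)
  finally show ?thesis .
qed

end

context trapped_walk_model
begin

definition mean_time :: "environment \<Rightarrow> real" where
  "mean_time \<omega> = (\<integral>s. hitting_time 1 s \<partial>quenched \<beta> \<omega>)"

text \<open>Quenched expectation of \<open>g\<close> at the centred crossing time: the variance for \<open>g x =
  x\<^sup>2\<close>, the Lindeberg term for \<open>g = lindeberg_fun j\<close>.\<close>

definition centred_mean :: "(real \<Rightarrow> real) \<Rightarrow> environment \<Rightarrow> real" where
  "centred_mean g \<omega> = (\<integral>s. g (hitting_time 1 s - mean_time \<omega>) \<partial>quenched \<beta> \<omega>)"

definition sq_integrable :: "environment \<Rightarrow> bool" where
  "sq_integrable \<omega> \<longleftrightarrow> \<omega> \<in> space E \<and> integrable (quenched \<beta> \<omega>) (\<lambda>s. (hitting_time 1 s)\<^sup>2)"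

lemma measurable_mean_time: "mean_time \<in> borel_measurable E"
  unfolding mean_time_def[abs_def]
  by (rule measurable_compose[OF quenched_measurable integral_measurable_subprob_algebra[OF measurable_hitting_time]])

lemma measurable_hit_quenched: "\<omega> \<in> space E \<Longrightarrow> hitting_time n \<in> borel_measurable (quenched \<beta> \<omega>)"
  by (rule trap_environment.measurable_hitting_time_Q[OF env_trap_environment])

lemma measurable_centred_mean:
  assumes g: "g \<in> borel_measurable borel" "\<And>x. 0 \<le> g x"
  shows "centred_mean g \<in> borel_measurable E"
proof -
  have 1: "(\<lambda>p. hitting_time 1 (snd p)) \<in> borel_measurable (E \<Otimes>\<^sub>M sample_space)"
    by (rule measurable_compose[OF measurable_snd measurable_hitting_time])
  have 2: "(\<lambda>p. mean_time (fst p)) \<in> borel_measurable (E \<Otimes>\<^sub>M sample_space)"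
    by (rule measurable_compose[OF measurable_fst measurable_mean_time])
  have "(\<lambda>p. hitting_time 1 (snd p) - mean_time (fst p)) \<in> borel_measurable (E \<Otimes>\<^sub>M sample_space)"
    using 1 2 by (rule borel_measurable_diff)
  then have "(\<lambda>p. ennreal (g (hitting_time 1 (snd p) - mean_time (fst p)))) \<in> borel_measurable (E \<Otimes>\<^sub>M sample_space)"
    by (rule measurable_compose) (use g(1) in measurable)
  then have "(\<lambda>\<omega>. \<integral>\<^sup>+s. ennreal (g (hitting_time 1 s - mean_time \<omega>)) \<partial>quenched \<beta> \<omega>) \<in> borel_measurable E"
    by (intro nn_integral_measurable_subprob_algebra2[OF _ quenched_measurable]) (simp add: split_beta')
  then have "(\<lambda>\<omega>. enn2real (\<integral>\<^sup>+s. ennreal (g (hitting_time 1 s - mean_time \<omega>)) \<partial>quenched \<beta> \<omega>)) \<in> borel_measurable E"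
    by (rule measurable_compose) (rule borel_measurable_enn2real, simp)
  then show ?thesis
  proof (rule measurable_cong[THEN iffD1, rotated])
    fix \<omega> assume w: "\<omega> \<in> space E"
    show "enn2real (\<integral>\<^sup>+s. ennreal (g (hitting_time 1 s - mean_time \<omega>)) \<partial>quenched \<beta> \<omega>) = centred_mean g \<omega>"
      unfolding centred_mean_def using measurable_hit_quenched[OF w, of 1] g
      by (intro integral_eq_nn_integral[symmetric] measurable_compose[OF _ g(1)] borel_measurable_diff) auto
  qed
qed

lemma AE_sq_integrable: "AE \<omega> in E. sq_integrable \<omega>"
proof -
  have "(\<lambda>\<omega>. \<integral>\<^sup>+s. ennreal ((hitting_time 1 s)\<^sup>2) \<partial>quenched \<beta> \<omega>) \<in> borel_measurable E"
    by (rule measurable_compose[OF quenched_measurable nn_integral_measurable_subprob_algebra]) measurable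
  then have "AE \<omega> in E. (\<integral>\<^sup>+s. ennreal ((hitting_time 1 s)\<^sup>2) \<partial>quenched \<beta> \<omega>) \<noteq> \<infinity>"
    using annealed_crossing_sq by (intro nn_integral_PInf_AE) auto
  then show ?thesis
    using AE_space
  proof eventually_elim
    case (elim \<omega>)
    then show ?case
      using measurable_hit_quenched[of \<omega> 1] by (auto simp: sq_integrable_def integrable_iff_bounded less_top)
  qed
qed

lemma sq_integrable_moments:
  assumes "sq_integrable \<omega>"
  shows "integrable (quenched \<beta> \<omega>) (hitting_time 1)"
    and "integrable (quenched \<beta> \<omega>) (\<lambda>s. (hitting_time 1 s - mean_time \<omega>)\<^sup>2)"
    and "centred_mean (\<lambda>x. x\<^sup>2) \<omega> = (\<integral>s. (hitting_time 1 s)\<^sup>2 \<partial>quenched \<beta> \<omega>) - (mean_time \<omega>)\<^sup>2"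
proof -
  have w: "\<omega> \<in> space E" and sq: "integrable (quenched \<beta> \<omega>) (\<lambda>s. (hitting_time 1 s)\<^sup>2)"
    using assms by (auto simp: sq_integrable_def)
  interpret trap_environment \<beta> \<omega> by (rule env_trap_environment[OF w])
  show int: "integrable Q (hitting_time 1)"
    by (rule Q.square_integrable_imp_integrable[OF measurable_hitting_time_Q sq])
  show "integrable Q (\<lambda>s. (hitting_time 1 s - mean_time \<omega>)\<^sup>2)"
    unfolding power2_diff using int sq by (intro Bochner_Integration.integrable_add Bochner_Integration.integrable_diff) auto
  show "centred_mean (\<lambda>x. x\<^sup>2) \<omega> = (\<integral>s. (hitting_time 1 s)\<^sup>2 \<partial>Q) - (mean_time \<omega>)\<^sup>2"
    unfolding centred_mean_def mean_time_def by (rule Q.variance_eq[OF int sq])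
qed

lemma variance_mean_le:
  assumes "\<omega> \<in> space E"
  shows "ennreal (centred_mean (\<lambda>x. x\<^sup>2) \<omega>) \<le> (\<integral>\<^sup>+s. ennreal ((hitting_time 1 s)\<^sup>2) \<partial>quenched \<beta> \<omega>)"
    and "ennreal ((mean_time \<omega>)\<^sup>2) \<le> (\<integral>\<^sup>+s. ennreal ((hitting_time 1 s)\<^sup>2) \<partial>quenched \<beta> \<omega>)"
proof -
  interpret trap_environment \<beta> \<omega> by (rule env_trap_environment[OF assms])
  have *: "ennreal (centred_mean (\<lambda>x. x\<^sup>2) \<omega>) \<le> (\<integral>\<^sup>+s. ennreal ((hitting_time 1 s)\<^sup>2) \<partial>Q) \<and>
    ennreal ((mean_time \<omega>)\<^sup>2) \<le> (\<integral>\<^sup>+s. ennreal ((hitting_time 1 s)\<^sup>2) \<partial>Q)"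
  proof (cases "sq_integrable \<omega>")
    case True
    have "(\<integral>\<^sup>+s. ennreal ((hitting_time 1 s)\<^sup>2) \<partial>Q) = ennreal (\<integral>s. (hitting_time 1 s)\<^sup>2 \<partial>Q)"
      using True by (intro nn_integral_eq_integral) (auto simp: sq_integrable_def)
    moreover have "0 \<le> centred_mean (\<lambda>x. x\<^sup>2) \<omega>" unfolding centred_mean_def by simp
    ultimately show ?thesis using sq_integrable_moments(3)[OF True] by (auto intro!: ennreal_leI)
  next
    case False
    then have "\<not> (\<integral>\<^sup>+s. ennreal ((hitting_time 1 s)\<^sup>2) \<partial>Q) < \<infinity>"
      using assms measurable_hit_quenched[OF assms, of 1]
      by (auto simp: sq_integrable_def integrable_iff_bounded)
    then have "(\<integral>\<^sup>+s. ennreal ((hitting_time 1 s)\<^sup>2) \<partial>Q) = \<infinity>" by (simp add: less_top[symmetric])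
    then show ?thesis by simp
  qed
  from * show "ennreal (centred_mean (\<lambda>x. x\<^sup>2) \<omega>) \<le> (\<integral>\<^sup>+s. ennreal ((hitting_time 1 s)\<^sup>2) \<partial>Q)"
    "ennreal ((mean_time \<omega>)\<^sup>2) \<le> (\<integral>\<^sup>+s. ennreal ((hitting_time 1 s)\<^sup>2) \<partial>Q)" by auto
qed

lemma centred_mean_nonneg: "(\<And>x. 0 \<le> g x) \<Longrightarrow> 0 \<le> centred_mean g \<omega>"
  unfolding centred_mean_def by simp

lemma integrable_variance: "integrable E (centred_mean (\<lambda>x. x\<^sup>2))"
proof (rule integrableI_bounded)
  show "centred_mean (\<lambda>x. x\<^sup>2) \<in> borel_measurable E" by (rule measurable_centred_mean) auto
  have "(\<integral>\<^sup>+\<omega>. ennreal (norm (centred_mean (\<lambda>x. x\<^sup>2) \<omega>)) \<partial>E) \<le> (\<integral>\<^sup>+\<omega>. \<integral>\<^sup>+s. ennreal ((hitting_time 1 s)\<^sup>2) \<partial>quenched \<beta> \<omega> \<partial>E)"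
    using variance_mean_le(1) by (intro nn_integral_mono) (simp add: centred_mean_nonneg)
  then show "(\<integral>\<^sup>+\<omega>. ennreal (norm (centred_mean (\<lambda>x. x\<^sup>2) \<omega>)) \<partial>E) < \<infinity>"
    using annealed_crossing_sq by (rule le_less_trans)
qed

lemma integrable_mean_time_sq: "integrable E (\<lambda>\<omega>. (mean_time \<omega>)\<^sup>2)"
proof (rule integrableI_bounded)
  show "(\<lambda>\<omega>. (mean_time \<omega>)\<^sup>2) \<in> borel_measurable E" using measurable_mean_time by measurable
  have "(\<integral>\<^sup>+\<omega>. ennreal (norm ((mean_time \<omega>)\<^sup>2)) \<partial>E) \<le> (\<integral>\<^sup>+\<omega>. \<integral>\<^sup>+s. ennreal ((hitting_time 1 s)\<^sup>2) \<partial>quenched \<beta> \<omega> \<partial>E)"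
    using variance_mean_le(2) by (intro nn_integral_mono) simp
  then show "(\<integral>\<^sup>+\<omega>. ennreal (norm ((mean_time \<omega>)\<^sup>2)) \<partial>E) < \<infinity>"
    using annealed_crossing_sq by (rule le_less_trans)
qed

text \<open>The error term in the second-order expansion of a characteristic function at \<open>u\<close> is bounded by the
  expectation of \<open>min (6 x\<^sup>2) (\<bar>u\<bar> \<bar>x\<bar>\<^sup>3)\<close>. Bounding
  \<open>\<bar>u\<bar>\<close> by the fixed number \<open>1 / (j + 1)\<close> gives a function to which the
  ergodic theorem applies.\<close>

definition lindeberg_fun :: "nat \<Rightarrow> real \<Rightarrow> real" where
  "lindeberg_fun j x = min (6 * x\<^sup>2) (inverse (real (Suc j)) * \<bar>x\<bar> ^ 3)"

lemma lindeberg_fun_nonneg: "0 \<le> lindeberg_fun j x" and lindeberg_fun_le: "lindeberg_fun j x \<le> 6 * x\<^sup>2"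
  unfolding lindeberg_fun_def by auto

lemma measurable_lindeberg_fun [measurable]: "lindeberg_fun j \<in> borel_measurable borel"
  unfolding lindeberg_fun_def[abs_def] by measurable

lemma lindeberg_fun_tendsto: "(\<lambda>j. lindeberg_fun j x) \<longlonglongrightarrow> 0"
proof -
  have "(\<lambda>j. min (6 * x\<^sup>2) (inverse (real (Suc j)) * \<bar>x\<bar> ^ 3)) \<longlonglongrightarrow> min (6 * x\<^sup>2) (0 * \<bar>x\<bar> ^ 3)"
    by (intro tendsto_intros LIMSEQ_inverse_real_of_nat)
  moreover have "min (6 * x\<^sup>2) (0 * \<bar>x\<bar> ^ 3) = 0" by simp
  ultimately show ?thesis unfolding lindeberg_fun_def by (simp only:)
qed

lemma centred_mean_lindeberg_le: "sq_integrable \<omega> \<Longrightarrow> centred_mean (lindeberg_fun j) \<omega> \<le> 6 * centred_mean (\<lambda>x. x\<^sup>2) \<omega>"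
proof -
  assume sq: "sq_integrable \<omega>"
  then have "\<omega> \<in> space E" by (simp add: sq_integrable_def)
  then interpret trap_environment \<beta> \<omega> by (rule env_trap_environment)
  note int = sq_integrable_moments(2)[OF sq]
  have "centred_mean (lindeberg_fun j) \<omega> \<le> (\<integral>s. 6 * (hitting_time 1 s - mean_time \<omega>)\<^sup>2 \<partial>Q)"
    unfolding centred_mean_def
  proof (rule integral_mono)
    show "integrable Q (\<lambda>s. lindeberg_fun j (hitting_time 1 s - mean_time \<omega>))"
    proof (rule Bochner_Integration.integrable_bound[where f="\<lambda>s. 6 * (hitting_time 1 s - mean_time \<omega>)\<^sup>2"])
      show "(\<lambda>s. lindeberg_fun j (hitting_time 1 s - mean_time \<omega>)) \<in> borel_measurable Q"
        using measurable_hitting_time_Q[of 1] by measurable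
    qed (use int lindeberg_fun_le lindeberg_fun_nonneg in auto)
  qed (use int lindeberg_fun_le in auto)
  then show ?thesis unfolding centred_mean_def by simp
qed

lemma integrable_centred_mean_lindeberg: "integrable E (centred_mean (lindeberg_fun j))"
proof (rule Bochner_Integration.integrable_bound[where f="\<lambda>\<omega>. 6 * centred_mean (\<lambda>x. x\<^sup>2) \<omega>"])
  show "centred_mean (lindeberg_fun j) \<in> borel_measurable E" by (rule measurable_centred_mean) (auto simp: lindeberg_fun_nonneg)
  show "AE \<omega> in E. norm (centred_mean (lindeberg_fun j) \<omega>) \<le> norm (6 * centred_mean (\<lambda>x. x\<^sup>2) \<omega>)"
    using AE_sq_integrable by eventually_elim (use centred_mean_lindeberg_le in \<open>simp add: centred_mean_nonneg lindeberg_fun_nonneg\<close>)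
qed (use integrable_variance in auto)

lemma lindeberg_fun_limit: "(\<lambda>j. \<integral>\<omega>. centred_mean (lindeberg_fun j) \<omega> \<partial>E) \<longlonglongrightarrow> 0"
proof -
  have "(\<lambda>j. \<integral>\<omega>. centred_mean (lindeberg_fun j) \<omega> \<partial>E) \<longlonglongrightarrow> (\<integral>\<omega>. 0 \<partial>E)"
  proof (rule integral_dominated_convergence[where w="\<lambda>\<omega>. 6 * centred_mean (\<lambda>x. x\<^sup>2) \<omega>"])
    show "centred_mean (lindeberg_fun j) \<in> borel_measurable E" for j by (rule measurable_centred_mean) (auto simp: lindeberg_fun_nonneg)
    show "AE \<omega> in E. norm (centred_mean (lindeberg_fun j) \<omega>) \<le> 6 * centred_mean (\<lambda>x. x\<^sup>2) \<omega>" for j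
      using AE_sq_integrable by eventually_elim (use centred_mean_lindeberg_le in \<open>simp add: centred_mean_nonneg lindeberg_fun_nonneg\<close>)
    show "AE \<omega> in E. (\<lambda>j. centred_mean (lindeberg_fun j) \<omega>) \<longlonglongrightarrow> 0"
      using AE_sq_integrable
    proof eventually_elim
      case (elim \<omega>)
      then have "\<omega> \<in> space E" by (simp add: sq_integrable_def)
      then interpret trap_environment \<beta> \<omega> by (rule env_trap_environment)
      have "(\<lambda>j. \<integral>s. lindeberg_fun j (hitting_time 1 s - mean_time \<omega>) \<partial>Q) \<longlonglongrightarrow> (\<integral>s. 0 \<partial>Q)"
      proof (rule integral_dominated_convergence[where w="\<lambda>s. 6 * (hitting_time 1 s - mean_time \<omega>)\<^sup>2"])
        show "(\<lambda>s. lindeberg_fun j (hitting_time 1 s - mean_time \<omega>)) \<in> borel_measurable Q" for j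
          using measurable_hitting_time_Q[of 1] by measurable
      qed (use sq_integrable_moments(2)[OF elim] lindeberg_fun_tendsto lindeberg_fun_le lindeberg_fun_nonneg in auto)
      then show ?case unfolding centred_mean_def by simp
    qed
  qed (use integrable_variance in auto)
  then show ?thesis by simp
qed

definition crossing_sd :: real where "crossing_sd = sqrt (\<integral>\<omega>. centred_mean (\<lambda>x. x\<^sup>2) \<omega> \<partial>E)"

lemma crossing_sd_pos: "0 < crossing_sd" and crossing_sd_sq: "crossing_sd\<^sup>2 = (\<integral>\<omega>. centred_mean (\<lambda>x. x\<^sup>2) \<omega> \<partial>E)"
proof -
  have pos: "AE \<omega> in E. 0 < centred_mean (\<lambda>x. x\<^sup>2) \<omega>"
    using AE_sq_integrable
  proof eventually_elim
    case (elim \<omega>)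
    then have w: "\<omega> \<in> space E" and sq: "integrable (quenched \<beta> \<omega>) (\<lambda>s. (hitting_time 1 s)\<^sup>2)"
      by (auto simp: sq_integrable_def)
    interpret trap_environment \<beta> \<omega> by (rule env_trap_environment[OF w])
    show ?case using variance_hitting_time_pos[OF sq] unfolding centred_mean_def mean_time_def .
  qed
  have nn: "0 \<le> (\<integral>\<omega>. centred_mean (\<lambda>x. x\<^sup>2) \<omega> \<partial>E)" by (intro integral_nonneg_AE) (simp add: centred_mean_nonneg)
  have "(\<integral>\<omega>. centred_mean (\<lambda>x. x\<^sup>2) \<omega> \<partial>E) \<noteq> 0"
  proof
    assume "(\<integral>\<omega>. centred_mean (\<lambda>x. x\<^sup>2) \<omega> \<partial>E) = 0"
    then have "AE \<omega> in E. centred_mean (\<lambda>x. x\<^sup>2) \<omega> = 0"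
      using integral_nonneg_eq_0_iff_AE[OF integrable_variance] by (simp add: centred_mean_nonneg)
    with pos have "AE \<omega> in E. False" by eventually_elim simp
    then show False by (simp add: E.AE_False)
  qed
  with nn show "0 < crossing_sd" "crossing_sd\<^sup>2 = (\<integral>\<omega>. centred_mean (\<lambda>x. x\<^sup>2) \<omega> \<partial>E)" unfolding crossing_sd_def by auto
qed

end

section \<open>Quenched central limit theorem for hitting times\<close>

context trapped_walk_model
begin

abbreviation mean_at :: "environment \<Rightarrow> int \<Rightarrow> real" where
  "mean_at \<omega> k \<equiv> mean_time (env_shift k \<omega>)"

definition site_mean :: "environment \<Rightarrow> int \<Rightarrow> real" where
  "site_mean \<omega> k = enn2real (site_mom 1 (\<omega> k))"

lemma AE_all_shifts:
  assumes "AE \<omega> in E. R \<omega>" shows "AE \<omega> in E. \<forall>k. R (env_shift k \<omega>)"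
  unfolding AE_all_countable using AE_shift[of R] assms unfolding E_eq by blast

text \<open>The characteristic function of the centred hitting time is the product of those of the centred crossing times.
  The ergodic theorem provides the hypotheses of \<open>lindeberg_product\<close>.\<close>

lemma hitting_time_clt:
  "AE \<omega> in E. \<forall>x. (\<lambda>n. measure (quenched \<beta> \<omega>) {s \<in> space (quenched \<beta> \<omega>).
      (hitting_time (int n) s - (\<Sum>k<n. mean_at \<omega> (int k))) / (crossing_sd * sqrt (real n)) \<le> x})
    \<longlonglongrightarrow> cdf std_normal_distribution x"
proof -
  have int_V: "integrable P (centred_mean (\<lambda>x. x\<^sup>2))" and int_L: "integrable P (centred_mean (lindeberg_fun j))" for j
    using integrable_variance integrable_centred_mean_lindeberg unfolding E_eq by auto
  have "AE \<omega> in E. \<forall>j. (\<lambda>n. (\<Sum>k<n. centred_mean (lindeberg_fun j) (env_shift (int k) \<omega>)) / real n) \<longlonglongrightarrow> (\<integral>\<omega>. centred_mean (lindeberg_fun j) \<omega> \<partial>E)"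
    unfolding AE_all_countable E_eq using shift_ergodic[OF int_L] by blast
  moreover have "AE \<omega> in E. (\<lambda>n. (\<Sum>k<n. centred_mean (\<lambda>x. x\<^sup>2) (env_shift (int k) \<omega>)) / real n) \<longlonglongrightarrow> crossing_sd\<^sup>2"
    unfolding crossing_sd_sq E_eq by (rule shift_ergodic[OF int_V])
  moreover have "AE \<omega> in E. (\<lambda>n. centred_mean (\<lambda>x. x\<^sup>2) (env_shift (int n) \<omega>) / real n) \<longlonglongrightarrow> 0"
    unfolding E_eq by (rule shift_sublinear[OF int_V])
  ultimately show ?thesis
    using AE_all_shifts[OF AE_sq_integrable] AE_space
  proof eventually_elim
    case (elim \<omega>)
    interpret trap_environment \<beta> \<omega> by (rule env_trap_environment[OF elim(5)])
    define \<theta> where "\<theta> k u = (\<integral>s. iexp (u * (hitting_time 1 s - mean_at \<omega> (int k))) \<partial>quenched \<beta> (env_shift (int k) \<omega>))" for k :: nat and u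
    define C where "C n = (\<Sum>k<n. mean_at \<omega> (int k))" for n
    define X where "X n s = (hitting_time (int n) s - C n) / (crossing_sd * sqrt (real n))" for n s
    have X: "X n \<in> borel_measurable Q" for n
      unfolding X_def[abs_def] using measurable_hitting_time_Q[of "int n"] by measurable
    have good: "sq_integrable (env_shift (int k) \<omega>)" for k using elim(4) by blast
    have prod_lim: "(\<lambda>n. \<Prod>k<n. \<theta> k (t / (crossing_sd * sqrt (real n)))) \<longlonglongrightarrow> exp (- (t\<^sup>2) / 2)" for t
    proof (rule lindeberg_product[OF _ elim(2) crossing_sd_pos elim(3) elim(1)[rule_format] lindeberg_fun_limit])
      show "0 \<le> centred_mean (\<lambda>x. x\<^sup>2) (env_shift (int k) \<omega>)" for k by (simp add: centred_mean_nonneg)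
      fix k u
      let ?w = "env_shift (int k) \<omega>"
      interpret Ek: trap_environment \<beta> ?w by (rule trap_environment_shift)
      have mk: "(\<lambda>s. hitting_time 1 s - mean_time ?w) \<in> borel_measurable Ek.Q"
        using Ek.measurable_hitting_time_Q[of 1] by measurable
      have "norm (\<theta> k u) \<le> (\<integral>s. norm (iexp (u * (hitting_time 1 s - mean_time ?w))) \<partial>Ek.Q)"
        unfolding \<theta>_def by (rule integral_norm_bound)
      also have "\<dots> = 1" by (simp add: Ek.Q.prob_space)
      finally show "norm (\<theta> k u) \<le> 1" .
      fix j assume u: "\<bar>u\<bar> \<le> inverse (real (Suc j))"
      let ?X = "\<lambda>s. hitting_time 1 s - mean_time ?w"
      let ?mu = "distr Ek.Q borel ?X"
      note sq = sq_integrable_moments[OF good[of k]]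
      have mean0: "Ek.Q.expectation ?X = 0"
        using sq(1) by (simp add: mean_time_def Ek.Q.prob_space)
      have int1: "integrable Ek.Q ?X" using sq(1) by simp
      have "\<theta> k u = char ?mu u"
        unfolding \<theta>_def char_def by (rule integral_distr[symmetric, OF mk]) measurable
      then have "norm (\<theta> k u - (1 - u\<^sup>2 * centred_mean (\<lambda>x. x\<^sup>2) ?w / 2)) = norm (char ?mu u - (1 - u\<^sup>2 * centred_mean (\<lambda>x. x\<^sup>2) ?w / 2))"
        by simp
      also have "\<dots> \<le> u\<^sup>2 / 6 * Ek.Q.expectation (\<lambda>s. min (6 * (?X s)\<^sup>2) (\<bar>u\<bar> * \<bar>?X s\<bar> ^ 3))"
        using Ek.Q.char_approx3'[OF mk int1 sq(2) mean0 _ refl, of "centred_mean (\<lambda>x. x\<^sup>2) ?w" u]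
        unfolding mean0 by (simp add: centred_mean_def)
      also have "\<dots> \<le> u\<^sup>2 / 6 * centred_mean (lindeberg_fun j) ?w"
        unfolding centred_mean_def
      proof (intro mult_left_mono integral_mono)
        show "integrable Ek.Q (\<lambda>s. min (6 * (?X s)\<^sup>2) (\<bar>u\<bar> * \<bar>?X s\<bar> ^ 3))"
        proof (rule Bochner_Integration.integrable_bound[where f="\<lambda>s. 6 * (?X s)\<^sup>2"])
          show "(\<lambda>s. min (6 * (?X s)\<^sup>2) (\<bar>u\<bar> * \<bar>?X s\<bar> ^ 3)) \<in> borel_measurable Ek.Q" using mk by measurable
        qed (use sq(2) in auto)
        show "integrable Ek.Q (\<lambda>s. lindeberg_fun j (?X s))"
        proof (rule Bochner_Integration.integrable_bound[where f="\<lambda>s. 6 * (?X s)\<^sup>2"])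
          show "(\<lambda>s. lindeberg_fun j (?X s)) \<in> borel_measurable Ek.Q" using mk by measurable
        qed (use sq(2) lindeberg_fun_le lindeberg_fun_nonneg in auto)
        show "min (6 * (?X s)\<^sup>2) (\<bar>u\<bar> * \<bar>?X s\<bar> ^ 3) \<le> lindeberg_fun j (?X s)" for s
          unfolding lindeberg_fun_def using u by (intro min.mono mult_right_mono) auto
      qed simp
      finally show "norm (\<theta> k u - (1 - u\<^sup>2 * centred_mean (\<lambda>x. x\<^sup>2) ?w / 2)) \<le> u\<^sup>2 / 6 * centred_mean (lindeberg_fun j) ?w" .
    qed
    have char_eq: "char (distr Q borel (X n)) t = (\<Prod>k<n. \<theta> k (t / (crossing_sd * sqrt (real n))))" for n t
    proof -
      define u where "u = t / (crossing_sd * sqrt (real n))"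
      have "char (distr Q borel (X n)) t = (\<integral>s. iexp (t * X n s) \<partial>Q)"
        unfolding char_def by (rule integral_distr[OF X]) measurable
      also have "\<dots> = (\<integral>s. iexp (u * hitting_time (int n) s) * iexp (- (u * C n)) \<partial>Q)"
        by (intro Bochner_Integration.integral_cong refl)
          (simp add: X_def u_def exp_add[symmetric] algebra_simps diff_divide_distrib)
      also have "\<dots> = (\<integral>s. iexp (u * hitting_time (int n) s) \<partial>Q) * iexp (- (u * C n))"
        by (rule integral_mult_left_zero)
      also have "(\<integral>s. iexp (u * hitting_time (int n) s) \<partial>Q) =
          (\<Prod>k<n. \<integral>s. iexp (u * hitting_time 1 s) \<partial>quenched \<beta> (env_shift (int k) \<omega>))"
        by (rule char_hitting_time_prod)
      also have "iexp (- (u * C n)) = (\<Prod>k<n. iexp (- (u * mean_at \<omega> (int k))))"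
        unfolding C_def by (simp add: exp_sum[symmetric] sum_distrib_left sum_negf)
      also have "(\<Prod>k<n. \<integral>s. iexp (u * hitting_time 1 s) \<partial>quenched \<beta> (env_shift (int k) \<omega>)) * \<dots> =
        (\<Prod>k<n. \<theta> k u)"
        unfolding prod.distrib[symmetric]
      proof (rule prod.cong[OF refl])
        fix k
        have "\<theta> k u = (\<integral>s. iexp (u * hitting_time 1 s) * iexp (- (u * mean_at \<omega> (int k))) \<partial>quenched \<beta> (env_shift (int k) \<omega>))"
          unfolding \<theta>_def
          by (intro Bochner_Integration.integral_cong refl) (simp add: exp_add[symmetric] algebra_simps)
        also have "\<dots> = (\<integral>s. iexp (u * hitting_time 1 s) \<partial>quenched \<beta> (env_shift (int k) \<omega>)) * iexp (- (u * mean_at \<omega> (int k)))"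
          by (rule integral_mult_left_zero)
        finally show "(\<integral>s. iexp (u * hitting_time 1 s) \<partial>quenched \<beta> (env_shift (int k) \<omega>)) * iexp (- (u * mean_at \<omega> (int k))) = \<theta> k u" ..
      qed
      finally show ?thesis unfolding u_def .
    qed
    have "weak_conv_m (\<lambda>n. distr Q borel (X n)) std_normal_distribution"
    proof (rule levy_continuity)
      show "real_distribution (distr Q borel (X n))" for n
        by (rule Q.real_distribution_distr[OF X])
      show "(\<lambda>n. char (distr Q borel (X n)) t) \<longlonglongrightarrow> char std_normal_distribution t" for t
        unfolding char_eq char_std_normal_distribution by (rule prod_lim)
    qed (rule real_dist_normal_dist)
    then have cdf: "(\<lambda>n. cdf (distr Q borel (X n)) x) \<longlonglongrightarrow> cdf std_normal_distribution x" for x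
      unfolding weak_conv_m_def weak_conv_def using cdf_normal_isCont by blast
    have "cdf (distr Q borel (X n)) x = Q.prob {s \<in> space Q. X n s \<le> x}" for n x
      unfolding cdf_def by (subst measure_distr[OF X]) (auto intro!: arg_cong[where f=Q.prob])
    with cdf show ?case unfolding X_def C_def by simp
  qed
qed

text \<open>First-step analysis reads \<open>\<beta> M\<^sub>k = (\<beta> + 1) m\<^sub>k +
  M\<^sub>k\<^sub>-\<^sub>1\<close>, where \<open>M\<^sub>k\<close> is the mean crossing time from
  \<open>k\<close> to \<open>k + 1\<close>. Summation over \<open>k\<close> telescopes.\<close>

lemma mean_time_telescope:
  assumes all: "\<forall>k. sq_integrable (env_shift k \<omega>)" and w: "\<omega> \<in> space E"
  shows "(\<beta> - 1) * (\<Sum>k<n. mean_at \<omega> (int k)) =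
    (\<beta> + 1) * (\<Sum>k<n. site_mean \<omega> (int k)) + mean_at \<omega> (-1) - mean_at \<omega> (int n - 1)"
proof -
  interpret trap_environment \<beta> \<omega> by (rule env_trap_environment[OF w])
  have nn: "(\<integral>\<^sup>+s. ennreal (hitting_time 1 s) \<partial>quenched \<beta> (env_shift k \<omega>)) = ennreal (mean_at \<omega> k)"
    and pos: "0 \<le> mean_at \<omega> k" for k
  proof -
    interpret Ek: trap_environment \<beta> "env_shift k \<omega>" by (rule trap_environment_shift)
    have nonneg: "AE s in Ek.Q. 0 \<le> hitting_time 1 s" using Ek.hitting_time_nonneg[of 1] by simp
    show "(\<integral>\<^sup>+s. ennreal (hitting_time 1 s) \<partial>Ek.Q) = ennreal (mean_at \<omega> k)"
      unfolding mean_time_def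
      using sq_integrable_moments(1)[of "env_shift k \<omega>"] all nonneg by (intro nn_integral_eq_integral) auto
    show "0 \<le> mean_at \<omega> k" unfolding mean_time_def by (rule integral_nonneg_AE[OF nonneg])
  qed
  have rec: "\<beta> * mean_at \<omega> k = (\<beta> + 1) * site_mean \<omega> k + mean_at \<omega> (k - 1)" for k
  proof -
    have m: "ennreal (mean_at \<omega> k) = mom1 k + ennreal (1 / (\<beta> + 1)) * (ennreal (mean_at \<omega> (k - 1)) + ennreal (mean_at \<omega> k))"
      using mean_hitting_time_recursion[of k] unfolding nn .
    then have "mom1 k \<le> ennreal (mean_at \<omega> k)" by (metis le_iff_add)
    then have fin: "mom1 k = ennreal (site_mean \<omega> k)"
      unfolding site_mean_def site_mom_def power_one_right
      by (subst ennreal_enn2real) (auto intro: le_less_trans)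
    have "ennreal (mean_at \<omega> k) = ennreal (site_mean \<omega> k + 1 / (\<beta> + 1) * (mean_at \<omega> (k - 1) + mean_at \<omega> k))"
    proof -
      have sum: "ennreal (mean_at \<omega> (k - 1)) + ennreal (mean_at \<omega> k) = ennreal (mean_at \<omega> (k - 1) + mean_at \<omega> k)"
        using pos by simp
      have prod: "ennreal (1 / (\<beta> + 1)) * ennreal (mean_at \<omega> (k - 1) + mean_at \<omega> k) =
        ennreal (1 / (\<beta> + 1) * (mean_at \<omega> (k - 1) + mean_at \<omega> k))"
        using pos beta by (intro ennreal_mult[symmetric]) auto
      have "ennreal (site_mean \<omega> k) + ennreal (1 / (\<beta> + 1) * (mean_at \<omega> (k - 1) + mean_at \<omega> k)) =
        ennreal (site_mean \<omega> k + 1 / (\<beta> + 1) * (mean_at \<omega> (k - 1) + mean_at \<omega> k))"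
        using pos beta by (intro ennreal_plus[symmetric]) (auto simp: site_mean_def)
      then show ?thesis using m unfolding fin sum prod by presburger
    qed
    then have "mean_at \<omega> k = site_mean \<omega> k + 1 / (\<beta> + 1) * (mean_at \<omega> (k - 1) + mean_at \<omega> k)"
      using pos[of k] pos[of "k - 1"] beta
      by (subst (asm) ennreal_inj) (auto simp: site_mean_def intro!: add_nonneg_nonneg)
    then show ?thesis using beta by (simp add: field_simps)
  qed
  show ?thesis
  proof (induction n)
    case (Suc n)
    have "(\<beta> - 1) * (\<Sum>k<Suc n. mean_at \<omega> (int k)) = (\<beta> - 1) * (\<Sum>k<n. mean_at \<omega> (int k)) + (\<beta> - 1) * mean_at \<omega> (int n)"
      by (simp add: distrib_left)
    also have "\<dots> = (\<beta> + 1) * (\<Sum>k<Suc n. site_mean \<omega> (int k)) + mean_at \<omega> (- 1) - mean_at \<omega> (int (Suc n) - 1)"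
      unfolding Suc using rec[of "int n"] by (simp add: algebra_simps)
    finally show ?case .
  qed simp
qed

text \<open>The boundary term \<open>M\<^sub>n\<^sub>-\<^sub>1\<close> is \<open>o(sqrt n)\<close> since
  \<open>M\<^sup>2\<close> is integrable over environments.\<close>

lemma mean_time_centering:
  "AE \<omega> in E. (\<lambda>n. ((\<Sum>k<n. mean_at \<omega> (int k)) - (\<beta> + 1) / (\<beta> - 1) * (\<Sum>k<n. site_mean \<omega> (int k))) / sqrt (real n)) \<longlonglongrightarrow> 0"
proof -
  have "AE \<omega> in E. (\<lambda>n. (mean_at \<omega> (int n))\<^sup>2 / real n) \<longlonglongrightarrow> 0"
    unfolding E_eq by (rule shift_sublinear) (use integrable_mean_time_sq in \<open>simp add: E_eq\<close>)
  then show ?thesis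
    using AE_all_shifts[OF AE_sq_integrable] AE_space
  proof eventually_elim
    case (elim \<omega>)
    have "(\<lambda>n. sqrt ((mean_at \<omega> (int n))\<^sup>2 / real n)) \<longlonglongrightarrow> sqrt 0"
      by (intro tendsto_intros elim)
    then have "(\<lambda>n. \<bar>mean_at \<omega> (int n)\<bar> / sqrt (real n)) \<longlonglongrightarrow> 0"
      by (simp add: real_sqrt_divide)
    then have "(\<lambda>n. mean_at \<omega> (int n) / sqrt (real (Suc n))) \<longlonglongrightarrow> 0"
    proof (rule Lim_null_comparison[rotated])
      show "\<forall>\<^sub>F n in sequentially. norm (mean_at \<omega> (int n) / sqrt (real (Suc n))) \<le> \<bar>mean_at \<omega> (int n)\<bar> / sqrt (real n)"
        using eventually_gt_at_top[of 0] by eventually_elim (auto intro!: divide_left_mono)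
    qed
    then have "(\<lambda>n. mean_at \<omega> (int (Suc n) - 1) / sqrt (real (Suc n))) \<longlonglongrightarrow> 0" by simp
    then have lim1: "(\<lambda>n. mean_at \<omega> (int n - 1) / sqrt (real n)) \<longlonglongrightarrow> 0"
      by (rule LIMSEQ_imp_Suc)
    have lim2: "(\<lambda>n. mean_at \<omega> (-1) * (1 / sqrt (real n))) \<longlonglongrightarrow> mean_at \<omega> (-1) * 0"
      by (intro tendsto_intros) real_asymp
    have "(\<lambda>n. (mean_at \<omega> (-1) * (1 / sqrt (real n)) - mean_at \<omega> (int n - 1) / sqrt (real n)) / (\<beta> - 1)) \<longlonglongrightarrow>
      (mean_at \<omega> (-1) * 0 - 0) / (\<beta> - 1)"
      using beta by (intro tendsto_intros lim1 lim2) auto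
    moreover have "((\<Sum>k<n. mean_at \<omega> (int k)) - (\<beta> + 1) / (\<beta> - 1) * (\<Sum>k<n. site_mean \<omega> (int k))) / sqrt (real n) =
       (mean_at \<omega> (-1) * (1 / sqrt (real n)) - mean_at \<omega> (int n - 1) / sqrt (real n)) / (\<beta> - 1)" for n
    proof -
      have "(\<Sum>k<n. mean_at \<omega> (int k)) - (\<beta> + 1) / (\<beta> - 1) * (\<Sum>k<n. site_mean \<omega> (int k)) =
        ((\<beta> - 1) * (\<Sum>k<n. mean_at \<omega> (int k)) - (\<beta> + 1) * (\<Sum>k<n. site_mean \<omega> (int k))) / (\<beta> - 1)"
        using beta by (simp add: field_simps)
      also have "\<dots> = (mean_at \<omega> (-1) - mean_at \<omega> (int n - 1)) / (\<beta> - 1)"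
        unfolding mean_time_telescope[OF elim(2,3)] by simp
      finally show ?thesis by (simp add: diff_divide_distrib mult.commute)
    qed
    ultimately show ?case by simp
  qed
qed

end

section \<open>From hitting times to the walk\<close>

text \<open>The fluctuation \<open>D\<close> is sublinear, so the centring grows like \<open>\<nu> t\<close>.\<close>

lemma center_eventually_nonneg:
  fixes D :: "nat \<Rightarrow> real" and B \<nu> y d :: real
  assumes nu: "0 < \<nu>" and d: "0 < d" "d \<le> 1 / 20" and B: "0 < B"
    and w1: "\<forall>\<^sub>F n in sequentially. \<bar>D n\<bar> \<le> real n powr (1 / 2 + 2 * d)"
  shows "\<forall>\<^sub>F t in at_top. 0 \<le> \<nu> * t - \<nu> * B * D (nat \<lfloor>\<nu> * t\<rfloor>) + y * sqrt t"
proof -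
  have lim: "filterlim (\<lambda>t. nat \<lfloor>\<nu> * t\<rfloor>) sequentially at_top" using nu by real_asymp
  have "\<forall>\<^sub>F t in at_top. \<nu> * B * (\<nu> * t) powr (1 / 2 + 2 * d) + \<bar>y\<bar> * sqrt t \<le> \<nu> * t"
    using nu d B by real_asymp
  then show ?thesis
    using eventually_compose_filterlim[OF w1 lim] eventually_ge_at_top[of 0]
  proof eventually_elim
    case (elim t)
    have "0 \<le> \<nu> * t" using nu elim by simp
    then have "real (nat \<lfloor>\<nu> * t\<rfloor>) \<le> \<nu> * t" by (simp add: of_nat_floor)
    then have "real (nat \<lfloor>\<nu> * t\<rfloor>) powr (1 / 2 + 2 * d) \<le> (\<nu> * t) powr (1 / 2 + 2 * d)"
      using d by (intro powr_mono2) auto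
    then have "\<bar>D (nat \<lfloor>\<nu> * t\<rfloor>)\<bar> \<le> (\<nu> * t) powr (1 / 2 + 2 * d)"
      using elim(2) by linarith
    then have "\<bar>\<nu> * B * D (nat \<lfloor>\<nu> * t\<rfloor>)\<bar> \<le> \<nu> * B * (\<nu> * t) powr (1 / 2 + 2 * d)"
      using nu B by (simp add: abs_mult)
    moreover have "\<bar>y * sqrt t\<bar> = \<bar>y\<bar> * sqrt t" using elim by (simp add: abs_mult)
    ultimately show ?case using elim(1) by linarith
  qed
qed

text \<open>Here \<open>C n\<close> is the quenched mean of \<open>\<tau>\<^sub>n\<close>, and \<open>N t\<close> is within
  bounded distance of the centring plus \<open>x \<theta> sqrt t\<close>. Inserting the latter into
  \<open>C\<close> cancels the linear terms and leaves \<open>B (D\<^sub>\<nu>\<^sub>t - D\<^sub>N)\<close>, the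
  deterministic shift \<open>x \<theta> sqrt t / \<nu>\<close>, and \<open>o(sqrt t)\<close>. As \<open>\<bar>N
  - \<nu> t\<bar>\<close> is of the order of \<open>D\<close> and \<open>sqrt t\<close>, the window bound makes
  the first term \<open>o(sqrt t)\<close> as well.\<close>

lemma moving_window:
  fixes D C e :: "nat \<Rightarrow> real" and N :: "real \<Rightarrow> nat" and B \<nu> \<theta> x R \<sigma> d :: real
  assumes nu: "0 < \<nu>" and sigma: "0 < \<sigma>" and d: "0 < d" "d \<le> 1 / 20" and B: "0 < B"
    and C: "\<And>n. C n = real n / \<nu> + B * D n + e n * sqrt (real n)" and e: "e \<longlonglongrightarrow> 0"
    and w1: "\<forall>\<^sub>F n in sequentially. \<bar>D n\<bar> \<le> real n powr (1 / 2 + 2 * d)"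
    and w2: "\<forall>\<^sub>F n in sequentially. \<forall>l\<le>n. real l \<le> real n powr (1 / 2 + 3 * d) \<longrightarrow>
      \<bar>D n - D (n - l)\<bar> \<le> real n powr (1 / 2 - d / 2)"
    and N: "\<forall>\<^sub>F t in at_top. \<bar>real (N t) - (\<nu> * t - \<nu> * B * D (nat \<lfloor>\<nu> * t\<rfloor>) + x * \<theta> * sqrt t)\<bar> \<le> R"
  shows "((\<lambda>t. (t - C (N t)) / (\<sigma> * sqrt (real (N t)))) \<longlongrightarrow> - (x * \<theta> / (\<nu> * \<sigma> * sqrt \<nu>))) at_top"
    and "filterlim N sequentially at_top"
proof -
  define n0 where "n0 t = nat \<lfloor>\<nu> * t\<rfloor>" for t
  have n0_lim: "filterlim n0 sequentially at_top"
    unfolding n0_def using nu by real_asymp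
  have n0_bounds: "\<forall>\<^sub>F t in at_top. \<nu> * t - 1 \<le> real (n0 t) \<and> real (n0 t) \<le> \<nu> * t"
    using eventually_ge_at_top[of 0]
  proof eventually_elim
    case (elim t)
    then have "0 \<le> \<nu> * t" using nu by simp
    then show ?case unfolding n0_def by (simp add: of_nat_floor)
  qed
  \<comment> \<open>A bound for the distance of \<open>N t\<close> from \<open>\<nu> t\<close>; it is \<open>o(t)\<close>, and it is shorter than the windows in \<open>w2\<close>.\<close>
  define h where "h t = \<nu> * B * (\<nu> * t) powr (1 / 2 + 2 * d) + \<bar>x * \<theta>\<bar> * sqrt t + \<bar>R\<bar> + 1" for t
  have close: "\<forall>\<^sub>F t in at_top. \<bar>real (N t) - real (n0 t)\<bar> \<le> h t"
    using N n0_bounds eventually_compose_filterlim[OF w1 n0_lim] eventually_ge_at_top[of 0]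
  proof eventually_elim
    case (elim t)
    have D: "\<bar>D (n0 t)\<bar> \<le> (\<nu> * t) powr (1 / 2 + 2 * d)"
    proof (rule order_trans[OF elim(3)])
      show "real (n0 t) powr (1 / 2 + 2 * d) \<le> (\<nu> * t) powr (1 / 2 + 2 * d)"
        using elim d by (intro powr_mono2) auto
    qed
    have 1: "\<bar>\<nu> * B * D (n0 t)\<bar> \<le> \<nu> * B * (\<nu> * t) powr (1 / 2 + 2 * d)"
      using D nu B by (simp add: abs_mult)
    have 2: "\<bar>x * \<theta> * sqrt t\<bar> = \<bar>x * \<theta>\<bar> * sqrt t" using elim by (simp add: abs_mult)
    show ?case using elim(1,2) 1 2 unfolding h_def n0_def[symmetric] by linarith
  qed
  have h_small: "((\<lambda>t. h t / t) \<longlongrightarrow> 0) at_top"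
    unfolding h_def using nu d by real_asymp
  have h_win: "\<forall>\<^sub>F t in at_top. h t \<le> (\<nu> * t - 1) powr (1 / 2 + 3 * d)"
    unfolding h_def using nu d by real_asymp
  have N_ratio: "((\<lambda>t. real (N t) / t) \<longlongrightarrow> \<nu>) at_top"
  proof -
    have "((\<lambda>t. (real (N t) - real (n0 t)) / t) \<longlongrightarrow> 0) at_top"
    proof (rule Lim_null_comparison[OF _ h_small])
      show "\<forall>\<^sub>F t in at_top. norm ((real (N t) - real (n0 t)) / t) \<le> h t / t"
        using close eventually_gt_at_top[of 0] by eventually_elim (simp add: divide_right_mono)
    qed
    moreover have "((\<lambda>t. real (n0 t) / t) \<longlongrightarrow> \<nu>) at_top"
      unfolding n0_def using nu by real_asymp
    ultimately have "((\<lambda>t. (real (N t) - real (n0 t)) / t + real (n0 t) / t) \<longlongrightarrow> 0 + \<nu>) at_top"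
      by (rule tendsto_add)
    then show ?thesis by (simp add: add_divide_distrib[symmetric])
  qed
  have N_real: "filterlim (\<lambda>t. real (N t)) at_top at_top"
  proof -
    have "filterlim (\<lambda>t. real (N t) / t * t) at_top at_top"
      by (rule filterlim_tendsto_pos_mult_at_top[OF N_ratio nu filterlim_ident])
    then show ?thesis
      by (rule filterlim_cong[OF refl refl, THEN iffD1, rotated])
        (use eventually_gt_at_top[of 0] in eventually_elim, simp)
  qed
  show N_lim: "filterlim N sequentially at_top"
    using N_real by (simp add: filterlim_sequentially_iff_filterlim_real)
  have window: "((\<lambda>t. (D (n0 t) - D (N t)) / sqrt t) \<longlongrightarrow> 0) at_top"
  proof (rule Lim_null_comparison)
    show "((\<lambda>t. (\<nu> * t + h t) powr (1 / 2 - d / 2) / sqrt t) \<longlongrightarrow> 0) at_top"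
      unfolding h_def using nu d by real_asymp
    show "\<forall>\<^sub>F t in at_top. norm ((D (n0 t) - D (N t)) / sqrt t) \<le> (\<nu> * t + h t) powr (1 / 2 - d / 2) / sqrt t"
      using close n0_bounds h_win eventually_compose_filterlim[OF w2 n0_lim]
        eventually_compose_filterlim[OF w2 N_lim] eventually_gt_at_top[of "1 / \<nu>"]
    proof eventually_elim
      case (elim t)
      have "0 < 1 / \<nu>" using nu by simp
      then have t: "0 < t" using elim(6) by linarith
      have t1: "0 < \<nu> * t - 1" using elim(6) nu by (simp add: field_simps)
      have pos: "\<bar>D (n0 t) - D (N t)\<bar> \<le> (\<nu> * t + h t) powr (1 / 2 - d / 2)"
      proof (cases "N t \<le> n0 t")
        case True
        have "real (n0 t - N t) \<le> (\<nu> * t - 1) powr (1 / 2 + 3 * d)" using elim(1,3) True by (simp add: of_nat_diff)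
        also have "\<dots> \<le> real (n0 t) powr (1 / 2 + 3 * d)" using elim t1 d by (intro powr_mono2) auto
        finally have "\<bar>D (n0 t) - D (n0 t - (n0 t - N t))\<bar> \<le> real (n0 t) powr (1 / 2 - d / 2)"
          using elim(4) by simp
        also have "\<dots> \<le> (\<nu> * t + h t) powr (1 / 2 - d / 2)" using elim d by (intro powr_mono2) auto
        finally show ?thesis using True by simp
      next
        case False
        have "real (N t - n0 t) \<le> (\<nu> * t - 1) powr (1 / 2 + 3 * d)" using elim(1,3) False by (simp add: of_nat_diff)
        also have "\<dots> \<le> real (N t) powr (1 / 2 + 3 * d)" using elim t1 d False by (intro powr_mono2) auto
        finally have "\<bar>D (N t) - D (N t - (N t - n0 t))\<bar> \<le> real (N t) powr (1 / 2 - d / 2)"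
          using elim(5) by simp
        also have "\<dots> \<le> (\<nu> * t + h t) powr (1 / 2 - d / 2)" using elim d by (intro powr_mono2) auto
        finally show ?thesis using False by (simp add: abs_minus_commute)
      qed
      then show ?case using t by (simp add: divide_right_mono)
    qed
  qed
  define rem where "rem t = real (N t) - (\<nu> * t - \<nu> * B * D (n0 t) + x * \<theta> * sqrt t)" for t
  have rem: "((\<lambda>t. rem t / sqrt t) \<longlongrightarrow> 0) at_top"
  proof (rule Lim_null_comparison)
    show "((\<lambda>t. R / sqrt t) \<longlongrightarrow> 0) at_top" by real_asymp
    show "\<forall>\<^sub>F t in at_top. norm (rem t / sqrt t) \<le> R / sqrt t"
      using N eventually_gt_at_top[of 0]
      by eventually_elim (simp add: rem_def n0_def divide_right_mono)
  qed
  have eN: "((\<lambda>t. e (N t)) \<longlongrightarrow> 0) at_top" by (rule filterlim_compose[OF e N_lim])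
  have sq: "((\<lambda>t. sqrt (real (N t) / t)) \<longlongrightarrow> sqrt \<nu>) at_top" by (intro tendsto_intros N_ratio)
  have "((\<lambda>t. (B * ((D (n0 t) - D (N t)) / sqrt t) - x * \<theta> / \<nu> - (rem t / sqrt t) / \<nu> - e (N t) * sqrt (real (N t) / t)) /
      (\<sigma> * sqrt (real (N t) / t))) \<longlongrightarrow> (B * 0 - x * \<theta> / \<nu> - 0 / \<nu> - 0 * sqrt \<nu>) / (\<sigma> * sqrt \<nu>)) at_top"
    using nu sigma by (intro tendsto_intros window rem eN sq) auto
  moreover have "\<forall>\<^sub>F t in at_top.
      (B * ((D (n0 t) - D (N t)) / sqrt t) - x * \<theta> / \<nu> - (rem t / sqrt t) / \<nu> - e (N t) * sqrt (real (N t) / t)) /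
      (\<sigma> * sqrt (real (N t) / t)) = (t - C (N t)) / (\<sigma> * sqrt (real (N t)))"
    using eventually_gt_at_top[of 0] filterlim_at_top_dense[THEN iffD1, OF N_real, rule_format, of 0]
  proof eventually_elim
    case (elim t)
    have st: "sqrt t \<noteq> 0" "sqrt t > 0" using elim by auto
    have "real (N t) = rem t + (\<nu> * t - \<nu> * B * D (n0 t) + x * \<theta> * sqrt t)" by (simp add: rem_def)
    then have "real (N t) / \<nu> = rem t / \<nu> + t - B * D (n0 t) + x * \<theta> * sqrt t / \<nu>"
      using nu by (simp add: field_simps)
    then have num: "t - C (N t) = B * (D (n0 t) - D (N t)) - x * \<theta> * sqrt t / \<nu> - rem t / \<nu> - e (N t) * sqrt (real (N t))"
      unfolding C by (simp add: algebra_simps)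
    have sqN: "sqrt (real (N t) / t) = sqrt (real (N t)) / sqrt t" by (rule real_sqrt_divide)
    have "B * ((D (n0 t) - D (N t)) / sqrt t) - x * \<theta> / \<nu> - (rem t / sqrt t) / \<nu> - e (N t) * sqrt (real (N t) / t) =
      (t - C (N t)) / sqrt t"
      unfolding num sqN using st by (simp add: diff_divide_distrib right_diff_distrib mult.commute)
    then show ?case unfolding sqN using st by simp
  qed
  ultimately have "((\<lambda>t. (t - C (N t)) / (\<sigma> * sqrt (real (N t)))) \<longlongrightarrow> (B * 0 - x * \<theta> / \<nu> - 0 / \<nu> - 0 * sqrt \<nu>) / (\<sigma> * sqrt \<nu>)) at_top"
    by (rule Lim_transform_eventually)
  then show "((\<lambda>t. (t - C (N t)) / (\<sigma> * sqrt (real (N t)))) \<longlongrightarrow> - (x * \<theta> / (\<nu> * \<sigma> * sqrt \<nu>))) at_top"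
    by (simp add: mult.assoc)
qed

context trapped_walk_model
begin

definition mean_of :: "real measure \<Rightarrow> real" where
  "mean_of \<mu> = enn2real (site_mom 1 \<mu>)"

lemma site_mean_eq: "site_mean \<omega> k = mean_of (\<omega> k)"
  by (simp add: site_mean_def mean_of_def)

lemma mean_of_nonneg: "0 \<le> mean_of \<mu>"
  by (simp add: mean_of_def)

lemma measurable_mean_of: "mean_of \<in> borel_measurable \<pi>"
  unfolding mean_of_def[abs_def] using measurable_site_mom[of 1] by measurable

lemma space_pi: "\<mu> \<in> space \<pi> \<Longrightarrow> prob_space \<mu> \<and> sets \<mu> = sets pos_borel"
  using sets_eq_imp_space_eq[OF sets_pi] by (simp add: space_prob_algebra)

lemma site_mom_1_le: "\<mu> \<in> space \<pi> \<Longrightarrow> site_mom 1 \<mu> \<le> 1 + site_mom 2 \<mu>"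
proof -
  assume m: "\<mu> \<in> space \<pi>"
  then interpret mu: prob_space \<mu> using space_pi by blast
  have meas: "(\<lambda>h. ennreal (h\<^sup>2)) \<in> borel_measurable \<mu>"
    unfolding measurable_cong_sets[OF conjunct2[OF space_pi[OF m]] refl]
    by (rule measurable_restrict_space1) measurable
  have "site_mom 1 \<mu> \<le> (\<integral>\<^sup>+h. 1 + ennreal (h\<^sup>2) \<partial>\<mu>)"
    unfolding site_mom_def
  proof (rule nn_integral_mono)
    fix h :: real
    have "2 * h \<le> h\<^sup>2 + 1" using zero_le_power2[of "h - 1"] by (simp add: power2_diff)
    moreover have "0 \<le> h\<^sup>2" by simp
    ultimately have "h \<le> 1 + h\<^sup>2" by linarith
    then have "ennreal (h ^ 1) \<le> ennreal (1 + h\<^sup>2)" by (intro ennreal_leI) simp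
    then show "ennreal (h ^ 1) \<le> 1 + ennreal (h\<^sup>2)" by simp
  qed
  also have "\<dots> = 1 + site_mom 2 \<mu>"
    using meas by (simp add: nn_integral_add mu.emeasure_space_1 site_mom_def)
  finally show ?thesis .
qed

lemma nn_integral_site_mom_1: "(\<integral>\<^sup>+\<mu>. site_mom 1 \<mu> \<partial>\<pi>) < \<infinity>"
proof -
  have "(\<integral>\<^sup>+\<mu>. site_mom 1 \<mu> \<partial>\<pi>) \<le> (\<integral>\<^sup>+\<mu>. 1 + site_mom 2 \<mu> \<partial>\<pi>)"
    by (intro nn_integral_mono site_mom_1_le)
  also have "\<dots> = 1 + annealed_sq"
    using measurable_site_mom[of 2] by (simp add: nn_integral_add emeasure_space_1 annealed_sq_def)
  also have "\<dots> < \<infinity>" using annealed_sq_finite by (simp add: less_top)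
  finally show ?thesis .
qed

lemma AE_mean_of: "AE \<mu> in \<pi>. site_mom 1 \<mu> = ennreal (mean_of \<mu>)"
proof -
  have "AE \<mu> in \<pi>. site_mom 1 \<mu> \<noteq> \<infinity>"
    by (rule nn_integral_PInf_AE[OF measurable_site_mom]) (use nn_integral_site_mom_1 in simp)
  then show ?thesis by eventually_elim (simp add: mean_of_def less_top)
qed

definition \<mu>0 :: real where "\<mu>0 = (\<integral>\<mu>. mean_of \<mu> \<partial>\<pi>)"

lemma nn_integral_mean_of: "(\<integral>\<^sup>+\<mu>. site_mom 1 \<mu> \<partial>\<pi>) = ennreal \<mu>0"
proof -
  have "\<mu>0 = enn2real (\<integral>\<^sup>+\<mu>. ennreal (mean_of \<mu>) \<partial>\<pi>)"
    unfolding \<mu>0_def by (rule integral_eq_nn_integral[OF measurable_mean_of]) (simp add: mean_of_nonneg)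
  also have "(\<integral>\<^sup>+\<mu>. ennreal (mean_of \<mu>) \<partial>\<pi>) = (\<integral>\<^sup>+\<mu>. site_mom 1 \<mu> \<partial>\<pi>)"
    by (rule nn_integral_cong_AE) (use AE_mean_of in eventually_elim, simp)
  finally show ?thesis using nn_integral_site_mom_1 by (simp add: less_top)
qed

lemma mu0_pos: "0 < \<mu>0"
proof -
  have "\<not> (\<integral>\<^sup>+\<mu>. site_mom 1 \<mu> \<partial>\<pi>) = 0"
  proof
    assume "(\<integral>\<^sup>+\<mu>. site_mom 1 \<mu> \<partial>\<pi>) = 0"
    then have "AE \<mu> in \<pi>. site_mom 1 \<mu> = 0" by (simp add: nn_integral_0_iff_AE[OF measurable_site_mom])
    then have "AE \<mu> in \<pi>. False" using AE_space
    proof eventually_elim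
      case (elim \<mu>)
      then interpret mu: prob_space \<mu> using space_pi by blast
      have s: "sets \<mu> = sets pos_borel" using space_pi elim by blast
      have "(\<lambda>h. ennreal (h ^ 1)) \<in> borel_measurable \<mu>"
        unfolding measurable_cong_sets[OF s refl] by (rule measurable_restrict_space1) measurable
      then have "AE h in \<mu>. ennreal (h ^ 1) = 0"
        using elim(1) unfolding site_mom_def by (simp add: nn_integral_0_iff_AE)
      then have "AE h in \<mu>. False" using AE_space
        by eventually_elim (use sets_eq_imp_space_eq[OF s] in \<open>auto simp: space_restrict_space ennreal_eq_0_iff\<close>)
      then show False by (simp add: mu.AE_False)
    qed
    then show False by (simp add: AE_False)
  qed
  then have "\<mu>0 > 0 \<or> \<not> 0 \<le> \<mu>0" unfolding nn_integral_mean_of by (auto simp: ennreal_eq_0_iff)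
  moreover have "0 \<le> \<mu>0" unfolding \<mu>0_def by (intro integral_nonneg_AE) (simp add: mean_of_nonneg)
  ultimately show ?thesis by simp
qed

lemma annealed_site_time: "(\<integral>s. site_time x i s \<partial>annealed \<beta> \<pi>) = \<mu>0"
proof -
  have pos: "AE s in annealed \<beta> \<pi>. 0 \<le> site_time x i s"
    using AE_space
  proof eventually_elim
    case (elim s)
    then have "s \<in> space sample_space" using sets_eq_imp_space_eq[OF sets_annealed] by simp
    then show ?case unfolding site_time_def by (rule less_imp_le[OF sample_pos])
  qed
  have m: "site_time x i \<in> borel_measurable (annealed \<beta> \<pi>)"
    unfolding measurable_cong_sets[OF sets_annealed refl] by (rule measurable_site_time)
  have "(\<integral>\<^sup>+s. ennreal (site_time x i s) \<partial>annealed \<beta> \<pi>) = (\<integral>\<^sup>+\<omega>. \<integral>\<^sup>+s. ennreal (site_time x i s) \<partial>quenched \<beta> \<omega> \<partial>E)"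
    by (rule nn_integral_annealed) measurable
  also have "\<dots> = (\<integral>\<^sup>+\<omega>. site_mom 1 (\<omega> x) \<partial>E)"
  proof (rule nn_integral_cong)
    fix \<omega> assume "\<omega> \<in> space E"
    then interpret trap_environment \<beta> \<omega> by (rule env_trap_environment)
    show "(\<integral>\<^sup>+s. ennreal (site_time x i s) \<partial>quenched \<beta> \<omega>) = site_mom 1 (\<omega> x)"
      by (simp add: nn_integral_site_time[where f=ennreal] site_mom_def)
  qed
  also have "\<dots> = ennreal \<mu>0"
    by (simp only: nn_integral_coord[OF measurable_site_mom] nn_integral_mean_of)
  finally show ?thesis using mu0_pos by (simp add: integral_eq_nn_integral[OF m pos])
qed

lemma quenched_site_time: "\<omega> \<in> space E \<Longrightarrow> (\<integral>s. site_time x i s \<partial>quenched \<beta> \<omega>) = site_mean \<omega> x"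
  using trap_environment.expectation_site_time[OF env_trap_environment]
  by (simp add: site_mean_def site_mom_def)

definition site_sum :: "environment \<Rightarrow> nat \<Rightarrow> real" where
  "site_sum \<omega> n = (\<Sum>k<n. site_mean \<omega> (int k) - \<mu>0)"

text \<open>The truncation exponent \<open>c = 1 / 2 - d\<close> must be at least \<open>1 / (2 + \<epsilon>)\<close>; the
  bound \<open>1 / 20\<close> leaves room for all the other exponents. The two bounds are
  \<open>window_bound\<close> with \<open>(q, a, b)\<close> equal to \<open>(1/2, 1, 1/2 + 2 d)\<close> and to
  \<open>(1/2 - d, 1/2 + 3 d, 1/2 - d/2)\<close>. The windows of the second are longer than the fluctuations of
  the first.\<close>

lemma site_sum_windows:
  assumes eps: "0 < \<epsilon>" and int: "integrable E (\<lambda>\<omega>. (\<integral>s. holding_time 0 s \<partial>quenched \<beta> \<omega>) powr (2 + \<epsilon>))"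
  shows "\<exists>d. 0 < d \<and> d \<le> 1 / 20 \<and> (AE \<omega> in E.
    (\<forall>\<^sub>F n in sequentially. \<bar>site_sum \<omega> n\<bar> \<le> real n powr (1 / 2 + 2 * d)) \<and>
    (\<forall>\<^sub>F n in sequentially. \<forall>l\<le>n. real l \<le> real n powr (1 / 2 + 3 * d) \<longrightarrow>
      \<bar>site_sum \<omega> n - site_sum \<omega> (n - l)\<bar> \<le> real n powr (1 / 2 - d / 2)))"
proof -
  define p where "p = 2 + \<epsilon>"
  define d where "d = min (1 / 20) (1 / 2 - 1 / p)"
  have p: "2 < p" using eps by (simp add: p_def)
  have d: "0 < d" "d \<le> 1 / 20" "1 / p \<le> 1 / 2 - d"
    using p by (auto simp: d_def field_simps min_def)
  have intE: "integrable E (\<lambda>\<omega>. mean_of (\<omega> 0) powr p)"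
  proof (rule Bochner_Integration.integrable_cong[OF refl, THEN iffD1, OF _ int])
    fix \<omega> assume w: "\<omega> \<in> space E"
    then interpret trap_environment \<beta> \<omega> by (rule env_trap_environment)
    show "(\<integral>s. holding_time 0 s \<partial>quenched \<beta> \<omega>) powr (2 + \<epsilon>) = mean_of (\<omega> 0) powr p"
      using quenched_site_time[OF w, of 0 1] by (simp add: holding_time_0 site_mean_eq p_def)
  qed
  have mp: "integrable \<pi> (\<lambda>\<mu>. mean_of \<mu> powr p)"
  proof -
    have "integrable (distr P \<pi> (\<lambda>\<omega>. \<omega> 0)) (\<lambda>\<mu>. mean_of \<mu> powr p)"
    proof (subst integrable_distr_eq)
      show "(\<lambda>\<omega>. \<omega> 0) \<in> P \<rightarrow>\<^sub>M \<pi>" by (rule measurable_component_singleton) simp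
      show "(\<lambda>\<mu>. mean_of \<mu> powr p) \<in> borel_measurable \<pi>" using measurable_mean_of by measurable
      show "integrable P (\<lambda>\<omega>. mean_of (\<omega> 0) powr p)" using intE by (simp add: E_eq)
    qed
    then show ?thesis by (simp add: P.PiM_component)
  qed
  have m2: "integrable \<pi> (\<lambda>\<mu>. (mean_of \<mu>)\<^sup>2)"
  proof (rule Bochner_Integration.integrable_bound[where f="\<lambda>\<mu>. 1 + mean_of \<mu> powr p"])
    show "integrable \<pi> (\<lambda>\<mu>. 1 + mean_of \<mu> powr p)" using mp by simp
    show "(\<lambda>\<mu>. (mean_of \<mu>)\<^sup>2) \<in> borel_measurable \<pi>" using measurable_mean_of by measurable
    show "AE \<mu> in \<pi>. norm ((mean_of \<mu>)\<^sup>2) \<le> norm (1 + mean_of \<mu> powr p)"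
    proof (rule AE_I2)
      fix \<mu>
      show "norm ((mean_of \<mu>)\<^sup>2) \<le> norm (1 + mean_of \<mu> powr p)"
      proof (cases "mean_of \<mu> \<le> 1")
        case True
        then have "(mean_of \<mu>)\<^sup>2 \<le> 1" using mean_of_nonneg by (simp add: power_le_one)
        also have "1 \<le> 1 + mean_of \<mu> powr p" by simp
        finally show ?thesis by simp
      next
        case False
        then have "(mean_of \<mu>)\<^sup>2 = mean_of \<mu> powr 2" by simp
        also have "\<dots> \<le> mean_of \<mu> powr p" using False p by (intro powr_mono) auto
        finally show ?thesis by simp
      qed
    qed
  qed
  have "AE \<omega> in P. \<forall>\<^sub>F n in sequentially. \<forall>k<n. mean_of (\<omega> (int k)) \<le> real n powr (1 / 2 - d)"
    by (rule eventually_truncated[OF measurable_mean_of mean_of_nonneg mp]) (use p d in auto)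
  note window = window_bound[OF measurable_mean_of mean_of_nonneg m2 this, folded \<mu>0_def E_eq]
  have w1: "AE \<omega> in E. \<forall>\<^sub>F n in sequentially. \<forall>l\<le>n. real l \<le> real n powr 1 \<longrightarrow>
      \<bar>\<Sum>k\<in>{n-l..<n}. mean_of (\<omega> (int k)) - \<mu>0\<bar> \<le> real n powr (1 / 2 + 2 * d)"
    by (rule window[where q="1 / 2"]) (use d in auto)
  have w2: "AE \<omega> in E. \<forall>\<^sub>F n in sequentially. \<forall>l\<le>n. real l \<le> real n powr (1 / 2 + 3 * d) \<longrightarrow>
      \<bar>\<Sum>k\<in>{n-l..<n}. mean_of (\<omega> (int k)) - \<mu>0\<bar> \<le> real n powr (1 / 2 - d / 2)"
    by (rule window[where q="1 / 2 - d"]) (use d in auto)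
  have diff: "site_sum \<omega> n - site_sum \<omega> (n - l) = (\<Sum>k\<in>{n-l..<n}. mean_of (\<omega> (int k)) - \<mu>0)" for \<omega> n l
    unfolding site_sum_def site_mean_eq lessThan_atLeast0
    using sum.atLeastLessThan_concat[of 0 "n - l" n "\<lambda>k. mean_of (\<omega> (int k)) - \<mu>0"] by simp
  have "AE \<omega> in E.
    (\<forall>\<^sub>F n in sequentially. \<bar>site_sum \<omega> n\<bar> \<le> real n powr (1 / 2 + 2 * d)) \<and>
    (\<forall>\<^sub>F n in sequentially. \<forall>l\<le>n. real l \<le> real n powr (1 / 2 + 3 * d) \<longrightarrow>
      \<bar>site_sum \<omega> n - site_sum \<omega> (n - l)\<bar> \<le> real n powr (1 / 2 - d / 2))"
    using w1 w2
  proof eventually_elim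
    case (elim \<omega>)
    have "\<forall>\<^sub>F n in sequentially. \<bar>site_sum \<omega> n\<bar> \<le> real n powr (1 / 2 + 2 * d)"
      using elim(1)
    proof eventually_elim
      case (elim n)
      from elim[rule_format, of n] show ?case
        using diff[of \<omega> n n] by (cases "n = 0") (auto simp: site_sum_def)
    qed
    with elim(2) show ?case unfolding diff by blast
  qed
  with d show ?thesis by blast
qed

text \<open>At a fixed \<open>x\<close>, the probability that \<open>X\<^sub>t\<close> exceeds its centring by \<open>x
  \<theta> sqrt t\<close> lies between those of \<open>\<tau>\<^sub>N\<^sub>+\<^sub>r \<le> t\<close>, reduced
  by a term geometrically small in \<open>r\<close>, and of \<open>\<tau>\<^sub>N \<le> t\<close>. Both converge
  to \<open>\<Phi> (- x)\<close>: the limit theorem for \<open>\<tau>\<close> is uniform by Polya's theorem, so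
  it may be applied at a moving argument.\<close>

lemma trapped_walk_clt:
  fixes G :: "environment \<Rightarrow> real \<Rightarrow> real" and \<nu> \<theta> \<epsilon> :: real
  assumes eps: "0 < \<epsilon>" and int: "integrable E (\<lambda>\<omega>. (\<integral>s. holding_time 0 s \<partial>quenched \<beta> \<omega>) powr (2 + \<epsilon>))"
    and nu_def: "\<nu> = (\<beta> - 1) / (\<mu>0 * (\<beta> + 1))" and theta_def: "\<theta> = crossing_sd * \<nu> powr (3 / 2)"
    and G_def: "\<And>\<omega> t. \<omega> \<in> space E \<Longrightarrow> 0 \<le> t \<Longrightarrow>
      G \<omega> t = \<nu> * t - \<nu> * ((\<beta> + 1) / (\<beta> - 1)) * site_sum \<omega> (nat \<lfloor>\<nu> * t\<rfloor>)"
  shows "AE \<omega> in E. uniform_limit UNIV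
     (\<lambda>t x. measure (quenched \<beta> \<omega>) {s \<in> space (quenched \<beta> \<omega>). (trapped_walk s t - G \<omega> t) / (\<theta> * sqrt t) \<le> x}) \<Phi> at_top"
proof -
  define B where "B = (\<beta> + 1) / (\<beta> - 1)"
  have B: "0 < B" using beta by (simp add: B_def)
  have nu: "0 < \<nu>" unfolding nu_def using beta mu0_pos by (intro divide_pos_pos mult_pos_pos) auto
  have Bmu: "1 / \<nu> = B * \<mu>0" unfolding B_def nu_def using beta mu0_pos by simp
  have theta: "0 < \<theta>" using crossing_sd_pos nu by (simp add: theta_def)
  obtain d where d: "0 < d" "d \<le> 1 / 20" and win: "AE \<omega> in E.
    (\<forall>\<^sub>F n in sequentially. \<bar>site_sum \<omega> n\<bar> \<le> real n powr (1 / 2 + 2 * d)) \<and>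
    (\<forall>\<^sub>F n in sequentially. \<forall>l\<le>n. real l \<le> real n powr (1 / 2 + 3 * d) \<longrightarrow>
      \<bar>site_sum \<omega> n - site_sum \<omega> (n - l)\<bar> \<le> real n powr (1 / 2 - d / 2))"
    using site_sum_windows[OF eps int] by blast
  show ?thesis
    using hitting_time_clt mean_time_centering win AE_space
  proof eventually_elim
    case (elim \<omega>)
    note clt = elim(1) and centering = elim(2) and w1 = conjunct1[OF elim(3)] and w2 = conjunct2[OF elim(3)]
    interpret trap_environment \<beta> \<omega> by (rule env_trap_environment[OF elim(4)])
    define C where "C n = (\<Sum>k<n. mean_at \<omega> (int k))" for n
    define D where "D = site_sum \<omega>"
    define e where "e n = (C n - B * (\<Sum>k<n. site_mean \<omega> (int k))) / sqrt (real n)" for n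
    have e: "e \<longlonglongrightarrow> 0" using centering unfolding e_def C_def B_def .
    have C: "C n = real n / \<nu> + B * D n + e n * sqrt (real n)" for n
    proof -
      have S: "(\<Sum>k<n. site_mean \<omega> (int k)) = D n + real n * \<mu>0"
        unfolding D_def site_sum_def by (simp add: sum_subtractf)
      have "real n / \<nu> = B * \<mu>0 * real n" using arg_cong[OF Bmu, of "(*) (real n)"] by simp
      then have "real n / \<nu> + B * D n = B * (\<Sum>k<n. site_mean \<omega> (int k))"
        unfolding S by (simp add: algebra_simps)
      moreover have "e n * sqrt (real n) = C n - B * (\<Sum>k<n. site_mean \<omega> (int k))"
        by (cases "n = 0") (auto simp: e_def C_def)
      ultimately show ?thesis by simp
    qed
    have ht[measurable]: "hitting_time m \<in> borel_measurable Q" for m by (rule measurable_hitting_time_Q)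
    define F where "F n y = Q.prob {s \<in> space Q. (hitting_time (int n) s - C n) / (crossing_sd * sqrt (real n)) \<le> y}" for n y
    have F_mono: "mono (F n)" for n
      unfolding F_def by (intro monoI Q.finite_measure_mono) auto
    have F_unif: "uniform_limit UNIV F \<Phi> sequentially"
    proof (rule polya_uniform_limit[OF F_mono])
      show "0 \<le> F n y" "F n y \<le> 1" for n y by (simp_all add: F_def)
      show "(\<lambda>n. F n x) \<longlonglongrightarrow> \<Phi> x" for x using clt unfolding F_def C_def by blast
    qed (use Phi_facts cdf_normal_isCont in auto)
    have F_hit: "Q.prob {s \<in> space Q. hitting_time (int n) s \<le> t} = F n ((t - C n) / (crossing_sd * sqrt (real n)))" if "0 < n" for n t
    proof -
      have "0 < crossing_sd * sqrt (real n)" using crossing_sd_pos that by simp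
      then show ?thesis unfolding F_def by (intro arg_cong[where f=Q.prob]) (auto simp: divide_le_cancel)
    qed
    \<comment> \<open>If the clock stayed below \<open>j\<close>, all hitting times would, but their centring exceeds \<open>sqrt n\<close>
      by any factor.\<close>
    have unb: "AE s in Q. \<forall>t. \<exists>k. t < clock s k"
    proof -
      have zero: "AE s in Q. \<not> (\<forall>k. clock s k \<le> real j)" for j :: nat
      proof -
        let ?A = "{s \<in> space Q. \<forall>k. clock s k \<le> real j}"
        have cl[measurable]: "(\<lambda>s. clock s k) \<in> borel_measurable Q" for k
          unfolding measurable_Q by (rule measurable_clock)
        have A: "?A \<in> sets Q" by measurable
        define y where "y n = (real j - C n) / (crossing_sd * sqrt (real n))" for n
        have le: "Q.prob ?A \<le> F n (y n)" if "0 < n" for n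
          unfolding y_def F_hit[OF that, symmetric]
        proof (rule Q.finite_measure_mono_AE)
          show "AE s in Q. s \<in> ?A \<longrightarrow> s \<in> {s \<in> space Q. hitting_time (int n) s \<le> real j}"
            using AE_hitting_time by eventually_elim auto
        qed measurable
        have "filterlim (\<lambda>n. C n / real n * (sqrt (real n) / crossing_sd) - real j / (crossing_sd * sqrt (real n))) at_top sequentially"
        proof -
          have "(\<lambda>n. D n / real n) \<longlonglongrightarrow> 0"
          proof (rule Lim_null_comparison)
            show "(\<lambda>n. real n powr (1 / 2 + 2 * d) / real n) \<longlonglongrightarrow> 0" using d by real_asymp
            show "\<forall>\<^sub>F n in sequentially. norm (D n / real n) \<le> real n powr (1 / 2 + 2 * d) / real n"
              using w1 by eventually_elim (simp add: D_def divide_right_mono)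
          qed
          moreover have "(\<lambda>n. sqrt (real n) / real n) \<longlonglongrightarrow> 0" by real_asymp
          ultimately have "(\<lambda>n. 1 / \<nu> + B * (D n / real n) + e n * (sqrt (real n) / real n)) \<longlonglongrightarrow> 1 / \<nu> + B * 0 + 0 * 0"
            by (intro tendsto_intros e)
          moreover have "\<forall>\<^sub>F n in sequentially. 1 / \<nu> + B * (D n / real n) + e n * (sqrt (real n) / real n) = C n / real n"
            using eventually_gt_at_top[of 0] by eventually_elim (simp add: C add_divide_distrib)
          ultimately have lim: "(\<lambda>n. C n / real n) \<longlonglongrightarrow> 1 / \<nu> + B * 0 + 0 * 0" by (rule Lim_transform_eventually)
          have top: "filterlim (\<lambda>n. C n / real n * (sqrt (real n) / crossing_sd)) at_top sequentially"
          proof (rule filterlim_tendsto_pos_mult_at_top[OF lim])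
            show "filterlim (\<lambda>n. sqrt (real n) / crossing_sd) at_top sequentially" using crossing_sd_pos by real_asymp
          qed (use nu in simp)
          have "(\<lambda>n. - (real j / (crossing_sd * sqrt (real n)))) \<longlonglongrightarrow> 0" using crossing_sd_pos by real_asymp
          from filterlim_tendsto_add_at_top[OF this top] show ?thesis by (simp add: add.commute)
        qed
        then have "filterlim (\<lambda>n. - (C n / real n * (sqrt (real n) / crossing_sd) - real j / (crossing_sd * sqrt (real n)))) at_bot sequentially"
          by (simp only: filterlim_uminus_at_top)
        moreover have "\<forall>\<^sub>F n in sequentially. - (C n / real n * (sqrt (real n) / crossing_sd) - real j / (crossing_sd * sqrt (real n))) = y n"
          using eventually_gt_at_top[of 0]
        proof eventually_elim
          case (elim n)
          have "C n / real n * (sqrt (real n) / crossing_sd) = C n / (crossing_sd * sqrt (real n))"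
            using elim crossing_sd_pos by (simp add: field_simps)
          then show ?case by (simp add: y_def diff_divide_distrib)
        qed
        ultimately have y: "filterlim y at_bot sequentially"
          by (simp cong: filterlim_cong)
        have "((\<lambda>n. F n (y n) - \<Phi> (y n)) \<longlongrightarrow> 0) sequentially"
        proof (rule tendstoI)
          fix r :: real assume "0 < r"
          from uniform_limitD[OF F_unif this]
          show "\<forall>\<^sub>F n in sequentially. dist (F n (y n) - \<Phi> (y n)) 0 < r"
            by eventually_elim (simp add: dist_real_def)
        qed
        from tendsto_add[OF this filterlim_compose[OF Phi_facts(2) y]] have "(\<lambda>n. F n (y n)) \<longlonglongrightarrow> 0" by simp
        then have "Q.prob ?A \<le> 0"
        proof (rule tendsto_lowerbound)
          show "\<forall>\<^sub>F n in sequentially. Q.prob ?A \<le> F n (y n)"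
            using eventually_gt_at_top[of 0] by eventually_elim (rule le)
        qed simp
        then have "Q.prob ?A = 0" by (simp add: measure_le_0_iff)
        then show ?thesis using A by (simp add: Q.prob_eq_0)
      qed
      then have "AE s in Q. \<forall>j::nat. \<not> (\<forall>k. clock s k \<le> real j)" by (simp add: AE_all_countable)
      then show ?thesis
      proof eventually_elim
        case (elim s)
        show ?case
        proof
          fix t
          obtain j :: nat where j: "t \<le> real j" using real_arch_simple by blast
          obtain k where "real j < clock s k" using elim[rule_format, of j] by (auto simp: not_le)
          with j show "\<exists>k. t < clock s k" by (intro exI[of _ k]) simp
        qed
      qed
    qed
    have tw[measurable]: "(\<lambda>s. trapped_walk s t) \<in> Q \<rightarrow>\<^sub>M count_space UNIV" for t
      unfolding measurable_Q by (rule measurable_trapped_walk)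
    define X where "X t x = Q.prob {s \<in> space Q. (real_of_int (trapped_walk s t) - G \<omega> t) / (\<theta> * sqrt t) \<le> x}" for t x
    have X_sets: "{s \<in> space Q. (real_of_int (trapped_walk s t) - G \<omega> t) / (\<theta> * sqrt t) \<le> x} \<in> sets Q" for t x
    proof -
      have "(\<lambda>s. (real_of_int (trapped_walk s t) - G \<omega> t) / (\<theta> * sqrt t)) \<in> borel_measurable Q"
        by (rule measurable_compose[OF tw]) simp
      then show ?thesis by measurable
    qed
    have "uniform_limit UNIV X \<Phi> at_top"
    proof (rule polya_uniform_limit)
      show "mono (X t)" for t
        unfolding X_def by (intro monoI Q.finite_measure_mono) (use X_sets in auto)
      show "0 \<le> X t x" "X t x \<le> 1" for t x by (simp_all add: X_def)
      fix x
      define z where "z t = \<nu> * t - \<nu> * B * D (nat \<lfloor>\<nu> * t\<rfloor>) + x * \<theta> * sqrt t" for t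
      have z0: "\<forall>\<^sub>F t in at_top. 0 \<le> z t"
        unfolding z_def D_def by (rule center_eventually_nonneg[OF nu d B w1])
      define N where "N r t = nat (\<lfloor>z t\<rfloor> + 1) + r" for r :: nat and t
      define y where "y r t = (t - C (N r t)) / (crossing_sd * sqrt (real (N r t)))" for r t
      have N_close: "\<forall>\<^sub>F t in at_top. \<bar>real (N r t) - z t\<bar> \<le> real r + 1" for r
        using z0
      proof eventually_elim
        case (elim t)
        then have "real (N r t) = of_int \<lfloor>z t\<rfloor> + 1 + real r" unfolding N_def by simp
        then show ?case by (simp add: abs_le_iff) linarith
      qed
      note mw = moving_window[OF nu crossing_sd_pos d B C e w1[folded D_def] w2[folded D_def] N_close[unfolded z_def]]
      have "x * \<theta> / (\<nu> * crossing_sd * sqrt \<nu>) = x"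
      proof -
        have "\<nu> powr (3 / 2) = \<nu> powr (1 + 1 / 2)" by simp
        also have "\<dots> = \<nu> * sqrt \<nu>" unfolding powr_add using nu by (simp add: powr_half_sqrt)
        finally show ?thesis unfolding theta_def using nu crossing_sd_pos by simp
      qed
      with mw(1) have y_lim: "(y r \<longlongrightarrow> - x) at_top" for r unfolding y_def by simp
      have N_lim: "filterlim (N r) sequentially at_top" for r by (rule mw(2))
      have hit_lim: "((\<lambda>t. Q.prob {s \<in> space Q. hitting_time (int (N r t)) s \<le> t}) \<longlongrightarrow> 1 - \<Phi> x) at_top" for r
      proof -
        have "((\<lambda>t. F (N r t) (y r t)) \<longlongrightarrow> \<Phi> (- x)) at_top"
          by (rule uniform_limit_moving[OF F_unif cdf_normal_isCont N_lim y_lim])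
        moreover have "\<forall>\<^sub>F t in at_top. F (N r t) (y r t) = Q.prob {s \<in> space Q. hitting_time (int (N r t)) s \<le> t}"
          using eventually_compose_filterlim[OF eventually_gt_at_top[of 0] N_lim[of r]]
          by eventually_elim (simp add: F_hit y_def)
        ultimately show ?thesis unfolding normal_cdf_uminus by (rule Lim_transform_eventually)
      qed
      have X_eq: "\<forall>\<^sub>F t in at_top. X t x = 1 - Q.prob {s \<in> space Q. int (N 0 t) \<le> trapped_walk s t}"
        using z0 eventually_gt_at_top[of 0]
      proof eventually_elim
        case (elim t)
        have pos: "0 < \<theta> * sqrt t" using theta elim by simp
        have z: "z t = G \<omega> t + x * (\<theta> * sqrt t)"
          unfolding z_def D_def B_def using G_def[OF \<open>\<omega> \<in> space E\<close>, of t] elim by simp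
        have N0: "int (N 0 t) = \<lfloor>z t\<rfloor> + 1" unfolding N_def using elim by simp
        have "{s \<in> space Q. (real_of_int (trapped_walk s t) - G \<omega> t) / (\<theta> * sqrt t) \<le> x} =
          space Q - {s \<in> space Q. int (N 0 t) \<le> trapped_walk s t}"
        proof -
          have "(real_of_int a - G \<omega> t) / (\<theta> * sqrt t) \<le> x \<longleftrightarrow> \<not> int (N 0 t) \<le> a" for a
          proof -
            have "(real_of_int a - G \<omega> t) / (\<theta> * sqrt t) \<le> x \<longleftrightarrow> real_of_int a \<le> z t"
              unfolding pos_divide_le_eq[OF pos] z by linarith
            also have "\<dots> \<longleftrightarrow> a \<le> \<lfloor>z t\<rfloor>" by (rule le_floor_iff[symmetric])
            finally show ?thesis unfolding N0 by linarith
          qed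
          then show ?thesis by auto
        qed
        then show ?case unfolding X_def by (simp add: Q.prob_compl)
      qed
      show "((\<lambda>t. X t x) \<longlongrightarrow> \<Phi> x) at_top"
      proof (rule tendstoI)
        fix \<delta> :: real assume \<delta>: "0 < \<delta>"
        have "(\<lambda>r. \<gamma> ^ r / (1 - \<rho>)) \<longlonglongrightarrow> 0 / (1 - \<rho>)"
          using gamma rho by (intro tendsto_intros LIMSEQ_realpow_zero) auto
        then have "\<forall>\<^sub>F r in sequentially. \<gamma> ^ r / (1 - \<rho>) < \<delta> / 2"
          using \<delta> by (intro order_tendstoD) auto
        then obtain r where r: "\<gamma> ^ r / (1 - \<rho>) < \<delta> / 2" by (auto simp: eventually_sequentially)
        have "\<forall>\<^sub>F t in at_top. dist (Q.prob {s \<in> space Q. hitting_time (int (N 0 t)) s \<le> t}) (1 - \<Phi> x) < \<delta> / 2"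
          by (rule tendstoD[OF hit_lim]) (use \<delta> in simp)
        moreover have "\<forall>\<^sub>F t in at_top. dist (Q.prob {s \<in> space Q. hitting_time (int (N r t)) s \<le> t}) (1 - \<Phi> x) < \<delta> / 2"
          by (rule tendstoD[OF hit_lim]) (use \<delta> in simp)
        ultimately show "\<forall>\<^sub>F t in at_top. dist (X t x) (\<Phi> x) < \<delta>"
          using X_eq eventually_ge_at_top[of 0]
        proof eventually_elim
          case (elim t)
          have Nr: "N 0 t + r = N r t" by (simp add: N_def)
          note bounds = prob_trapped_walk_bounds(1)[OF unb elim(4), of "N 0 t"]
            prob_trapped_walk_bounds(2)[OF unb elim(4), of "N 0 t" r, unfolded Nr]
          show ?case
            using bounds elim(1,2) r unfolding elim(3) dist_real_def by linarith
        qed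
      qed
    qed (use Phi_facts cdf_normal_isCont in auto)
    then show ?case unfolding X_def .
  qed
qed

end

theorem theorem2:
  fixes \<beta> \<nu> \<sigma> \<theta> :: real
    and \<pi> :: "real measure measure"
    and G :: "environment \<Rightarrow> real \<Rightarrow> real"
  assumes "\<beta> > 1"
    and "\<pi> \<in> space (prob_algebra (prob_algebra pos_borel))"
    and "integrable (annealed \<beta> \<pi>) (\<lambda>s. (holding_time 0 s)\<^sup>2)"
    and "\<exists>\<epsilon>>0. integrable (env_law \<pi>)
           (\<lambda>\<omega>. prob_space.expectation (quenched \<beta> \<omega>) (holding_time 0) powr (2 + \<epsilon>))"
    and "\<nu> = (\<beta> - 1) / (prob_space.expectation (annealed \<beta> \<pi>) (holding_time 0) * (\<beta> + 1))"
    and "\<sigma> = sqrt (prob_space.expectation (env_law \<pi>)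
           (\<lambda>\<omega>. prob_space.variance (quenched \<beta> \<omega>) (hitting_time 1)))"
    and "\<theta> = \<sigma> * \<nu> powr (3 / 2)"
    and "\<And>\<omega> t. G \<omega> t = \<nu> * t - \<nu> * (\<Sum>k = 0..\<lfloor>\<nu> * t - 1\<rfloor>. (\<beta> + 1) / (\<beta> - 1) *
           (prob_space.expectation (quenched \<beta> \<omega>) (site_time k 0)
            - prob_space.expectation (annealed \<beta> \<pi>) (site_time k 0)))"
  shows "AE \<omega> in env_law \<pi>. uniform_limit UNIV
           (\<lambda>t x. \<P>(s in quenched \<beta> \<omega>. (trapped_walk s t - G \<omega> t) / (\<theta> * sqrt t) \<le> x))
           (\<lambda>x. LBINT u:{..x}. exp (- u\<^sup>2 / 2) / sqrt (2 * pi))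
           at_top"
proof -
  interpret trapped_walk_model \<beta> \<pi>
    by (intro trapped_walk_model.intro biased_walk.intro trapped_walk_model_axioms.intro assms(1-3))
  obtain \<epsilon> where eps: "0 < \<epsilon>" "integrable E (\<lambda>\<omega>. (\<integral>s. holding_time 0 s \<partial>quenched \<beta> \<omega>) powr (2 + \<epsilon>))"
    using assms(4) by blast
  have holding: "holding_time 0 = site_time 0 1"
    by (simp add: fun_eq_iff holding_time_def local_time_def)
  have nu_eq: "\<nu> = (\<beta> - 1) / (\<mu>0 * (\<beta> + 1))"
    using assms(5) unfolding holding by (simp only: annealed_site_time)
  have nu: "0 < \<nu>" unfolding nu_eq using beta mu0_pos by (intro divide_pos_pos mult_pos_pos) auto
  have sigma: "\<sigma> = crossing_sd" unfolding assms(6) crossing_sd_def centred_mean_def mean_time_def ..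
  have G: "G \<omega> t = \<nu> * t - \<nu> * ((\<beta> + 1) / (\<beta> - 1)) * site_sum \<omega> (nat \<lfloor>\<nu> * t\<rfloor>)"
    if w: "\<omega> \<in> space E" and t: "0 \<le> t" for \<omega> t
  proof -
    have "0 \<le> \<lfloor>\<nu> * t\<rfloor>" using nu t by simp
    then have set: "{0..\<lfloor>\<nu> * t - 1\<rfloor>} = int ` {..<nat \<lfloor>\<nu> * t\<rfloor>}"
    proof (intro set_eqI iffI)
      fix k assume "k \<in> {0..\<lfloor>\<nu> * t - 1\<rfloor>}"
      then have "0 \<le> k" "k < \<lfloor>\<nu> * t\<rfloor>" by simp_all
      then have "k = int (nat k)" "nat k < nat \<lfloor>\<nu> * t\<rfloor>" by linarith+
      then show "k \<in> int ` {..<nat \<lfloor>\<nu> * t\<rfloor>}" by blast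
    next
      fix k assume "k \<in> int ` {..<nat \<lfloor>\<nu> * t\<rfloor>}"
      then obtain j where j: "k = int j" "j < nat \<lfloor>\<nu> * t\<rfloor>" by blast
      then have "k \<le> \<lfloor>\<nu> * t\<rfloor> - 1" by linarith
      also have "\<dots> = \<lfloor>\<nu> * t - 1\<rfloor>" by simp
      finally show "k \<in> {0..\<lfloor>\<nu> * t - 1\<rfloor>}" using j by simp
    qed
    have "(\<Sum>k = 0..\<lfloor>\<nu> * t - 1\<rfloor>. (\<beta> + 1) / (\<beta> - 1) *
           (prob_space.expectation (quenched \<beta> \<omega>) (site_time k 0)
            - prob_space.expectation (annealed \<beta> \<pi>) (site_time k 0))) =
      (\<Sum>k = 0..\<lfloor>\<nu> * t - 1\<rfloor>. (\<beta> + 1) / (\<beta> - 1) * (site_mean \<omega> k - \<mu>0))"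
      by (simp only: annealed_site_time quenched_site_time[OF w])
    also have "\<dots> = (\<beta> + 1) / (\<beta> - 1) * site_sum \<omega> (nat \<lfloor>\<nu> * t\<rfloor>)"
      unfolding set site_sum_def sum_distrib_left by (subst sum.reindex) auto
    finally show ?thesis unfolding assms(8) by simp
  qed
  have "(\<lambda>x. LBINT u:{..x}. exp (- u\<^sup>2 / 2) / sqrt (2 * pi)) = \<Phi>"
    by (simp add: fun_eq_iff normal_cdf_eq)
  then show ?thesis
    using trapped_walk_clt[OF eps nu_eq assms(7)[unfolded sigma] G] by simp
qed

end
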